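(* Let $\mathcal{B}=C_0[0,\infty)+\mathbb{C}\mathbf{1}$ be the unital $C^*$-algebra of all continuous functions on $\mathbb{R}_+=[0,\infty)$ that have a limit at infinity. Let $F:=\mathcal{B}$ as a right Hilbert $\mathcal{B}$-module (inner product $\langle x,y\rangle=x^*y$), turned into a correspondence over $\mathcal{B}$ by the left action $b.x:=\mathcal{S}_1(b)\,x$, where $[\mathcal{S}_t(b)](s)=b(s+t)$. Let $\Gamma^\odot(F)=(\Gamma_t(F))_{t\in\mathbb{R}_+}$ be the time ordered product system over $F$, and let $\xi^\odot=(\xi_t)_{t\in\mathbb{R}_+}$ be the continuous unit for $\Gamma^\odot(F)$ corresponding to the parameter $\zeta:=\mathbf{1}\in F$. Let $E^\odot=(E_t)_{t\in\mathbb{R}_+}$ be the product subsystem of $\Gamma^\odot(F)$ generated by $\xi^\odot$. Then $E^\odot$ has no central unit vectors; that is, for every $t>0$ there is no $\omega\in E_t$ with $\langle\omega,\omega\rangle=\mathbf{1}$ and $b\omega=\omega b$ for all $b\in\mathcal{B}$. In particular, $E^\odot$ is not isomorphic to a time ordered product system $\Gamma^\odot(G)$ for any correspondence $G$ over $\mathcal{B}$.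
   Context: Correspondences and product systems. A correspondence over a unital $C^*$-algebra $\mathcal{B}$ is a right Hilbert $\mathcal{B}$-module with a nondegenerate (unital) left action of $\mathcal{B}$ by adjointable operators; $\odot$ denotes the internal tensor product over $\mathcal{B}$; "bilinear" means $\mathcal{B}$-$\mathcal{B}$-bimodule map. A product system is a family $E^\odot=(E_t)_{t\in\mathbb{R}_+}$ of correspondences over $\mathcal{B}$ with bilinear unitaries $u_{s,t}\colon E_s\odot E_t\to E_{s+t}$ such that the product $x_sy_t:=u_{s,t}(x_s\odot y_t)$ is associative, with $E_0=\mathcal{B}$ and $u_{0,t}$, $u_{s,0}$ being left and right multiplication by elements of $\mathcal{B}$. Two product systems are isomorphic if there is a family of bilinear unitaries between their members (the identity of $\mathcal{B}$ at $t=0$) that respects products. A unit for $E^\odot$ is a family $\xi^\odot=(\xi_t)$, $\xi_t\in E_t$, with $\xi_s\xi_t=\xi_{s+t}$ and $\xi_0=\mathbf{1}$; it is continuous if the semigroup $t\mapsto\langle\xi_t,\bullet\,\xi_t\rangle$ of maps on $\mathcal{B}$ is uniformly (operator norm) continuous. The product subsystem generated by a unit $\xi^\odot$ is given by $E_0=\mathcal{B}$ and, for $t>0$, $$E_t=\overline{\mathrm{span}}\{b_n\xi_{t_n}\cdots b_1\xi_{t_1}b_0: n\in\mathbb{N},\ t_i>0,\ t_1+\dots+t_n=t,\ b_i\in\mathcal{B}\}.$$ Time ordered product systems. For a correspondence $F$ over $\mathcal{B}$, $L^2(\mathbb{R}_+,F)$ is the completion of the space of right continuous (compactly supported) $F$-valued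 step functions with respect to the inner product $\langle f,g\rangle=\int\langle f(s),g(s)\rangle\,ds$, with pointwise left and right actions. The full Fock module is $\mathcal{F}(L^2(\mathbb{R}_+,F))=\bigoplus_{n\ge0}L^2(\mathbb{R}_+,F)^{\odot n}$, with $L^2(\mathbb{R}_+,F)^{\odot0}=\mathcal{B}$; the $n$-particle sector $L^2(\mathbb{R}_+,F)^{\odot n}$ is viewed as the completion of the step functions on $\mathbb{R}_+^n$ with values in $F^{\odot n}$. Let $\Delta_n$ be the projection on the $n$-particle sector given by multiplication by the indicator function of $\{(t_n,\dots,t_1):t_n>\dots>t_1\ge0\}$ ($\Delta_0=\mathrm{id}$), and $\Delta=\bigoplus_n\Delta_n$. The time ordered Fock module is $\Gamma(F)=\Delta\mathcal{F}(L^2(\mathbb{R}_+,F))$, and $\Gamma_t(F)$ is its subcorrespondence of functions vanishing whenever the largest time argument satisfies $t_n\ge t$ (so $\Gamma_0(F)=\mathcal{B}$). With $$[u_{s,t}(F_s^m\odot G_t^n)](s_m,\dots,s_1,t_n,\dots,t_1)=F_s^m(s_m-t,\dots,s_1-t)\odot G_t^n(t_n,\dots,t_1)$$ the family $\Gamma^\odot(F)=(\Gamma_t(F))_{t\in\mathbb{R}_+}$ is a product system, the time ordered product system over $F$. For $\zeta\in F$, the unit corresponding to the parameter $\zeta$ has as $\xi_t$ the element of $\Gamma_t(F)$ whose $n$-particle component is the constant function $\zeta^{\odot n}$ on $\{t>t_n>\dots>t_1\ge0\}$ for $n\ge1$ and whose $0$-particle component is $\mathbf{1}$. *)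

theory Defs
  imports "HOL-Analysis.Analysis" "HOL-Library.Poly_Mapping"
begin

section \<open>Unital C*-algebras\<close>

class unital_cstar_algebra = real_normed_algebra_1 + banach +
  fixes cscale :: "complex \<Rightarrow> 'a \<Rightarrow> 'a" and adj :: "'a \<Rightarrow> 'a"
  assumes cscale_add_right: "cscale c (a + b) = cscale c a + cscale c b"
    and cscale_add_left: "cscale (c + d) a = cscale c a + cscale d a"
    and cscale_cscale: "cscale c (cscale d a) = cscale (c * d) a"
    and cscale_of_real: "cscale (complex_of_real r) a = r *\<^sub>R a"
    and cscale_mult_left: "cscale c a * b = cscale c (a * b)"
    and cscale_mult_right: "a * cscale c b = cscale c (a * b)"
    and norm_cscale: "norm (cscale c a) = cmod c * norm a"
    and adj_adj: "adj (adj a) = a"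
    and adj_add: "adj (a + b) = adj a + adj b"
    and adj_mult: "adj (a * b) = adj b * adj a"
    and adj_cscale: "adj (cscale c a) = cscale (cnj c) (adj a)"
    and cstar_identity: "norm (adj a * a) = (norm a)\<^sup>2"


section \<open>The algebra of continuous functions on the half-line with a limit at infinity\<close>

text \<open>A function on \<open>[0,\<infinity>)\<close> is represented by its extension by 0 to the real line.\<close>

typedef climfun = "{f :: real \<Rightarrow> complex.
    continuous_on {0..} f \<and> (\<exists>l. (f \<longlongrightarrow> l) at_top) \<and> (\<forall>s<0. f s = 0)}"
  morphisms cl_app Abs_climfun
proof (rule exI, rule CollectI, intro conjI)
  show "continuous_on {0..} (\<lambda>_::real. 0::complex)" by simp
  show "\<exists>l. ((\<lambda>_::real. 0::complex) \<longlongrightarrow> l) at_top" by (rule exI, rule tendsto_const)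
qed simp

setup_lifting type_definition_climfun

lemma cl_cont: "continuous_on {0..} (cl_app f)"
  and cl_lim: "\<exists>l. (cl_app f \<longlongrightarrow> l) at_top"
  and cl_neg: "s < 0 \<Longrightarrow> cl_app f s = 0"
  using cl_app[of f] by auto

lemma cl_eqI: "(\<And>s. s \<ge> 0 \<Longrightarrow> cl_app f s = cl_app g s) \<Longrightarrow> f = g"
  by (metis cl_app_inject cl_neg ext linorder_not_less)

lemma cl_bdd: "\<exists>K. \<forall>s. cmod (cl_app f s) \<le> K"
proof -
  obtain l where l: "(cl_app f \<longlongrightarrow> l) at_top" using cl_lim by blast
  have "\<forall>\<^sub>F s in at_top. dist (cl_app f s) l < 1" using tendstoD[OF l, of 1] by simp
  then obtain N where N: "\<And>s. s \<ge> N \<Longrightarrow> dist (cl_app f s) l < 1"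
    by (auto simp: eventually_at_top_linorder)
  have "compact (cl_app f ` {0..N})"
    by (rule compact_continuous_image[OF continuous_on_subset[OF cl_cont]]) auto
  then obtain K where K: "\<And>s. s \<in> {0..N} \<Longrightarrow> cmod (cl_app f s) \<le> K"
    using compact_imp_bounded bounded_iff by (metis imageI)
  have "cmod (cl_app f s) \<le> max K (max (cmod l + 1) 0)" for s
  proof -
    consider "s < 0" | "s \<in> {0..N}" | "s \<ge> N" by fastforce
    then show ?thesis
    proof cases
      case 3
      have "cmod (cl_app f s) \<le> cmod l + dist (cl_app f s) l"
        by (metis dist_norm norm_triangle_sub)
      then show ?thesis using N[OF 3] by simp
    qed (use cl_neg K in \<open>auto simp: le_max_iff_disj\<close>)
  qed
  then show ?thesis by blast
qed

instantiation climfun :: real_normed_vector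
begin

lift_definition zero_climfun :: climfun is "\<lambda>_. 0"
  by (auto intro!: tendsto_const)

lift_definition plus_climfun :: "climfun \<Rightarrow> climfun \<Rightarrow> climfun" is "\<lambda>f g s. f s + g s"
  by (auto intro: continuous_on_add tendsto_add)

lift_definition minus_climfun :: "climfun \<Rightarrow> climfun \<Rightarrow> climfun" is "\<lambda>f g s. f s - g s"
  by (auto intro: continuous_on_diff tendsto_diff)

lift_definition uminus_climfun :: "climfun \<Rightarrow> climfun" is "\<lambda>f s. - f s"
  by (auto intro: continuous_on_minus tendsto_minus)

lift_definition scaleR_climfun :: "real \<Rightarrow> climfun \<Rightarrow> climfun" is "\<lambda>r f s. r *\<^sub>R f s"
proof (intro conjI)
  fix r :: real and f :: "real \<Rightarrow> complex"
  assume f: "continuous_on {0..} f \<and> (\<exists>l. (f \<longlongrightarrow> l) at_top) \<and> (\<forall>s<0. f s = 0)"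
  then obtain l where "(f \<longlongrightarrow> l) at_top" by blast
  then have "((\<lambda>s. r *\<^sub>R f s) \<longlongrightarrow> r *\<^sub>R l) at_top" by (intro tendsto_intros)
  then show "\<exists>l. ((\<lambda>s. r *\<^sub>R f s) \<longlongrightarrow> l) at_top" by blast
  show "continuous_on {0..} (\<lambda>s. r *\<^sub>R f s)" using f by (auto intro!: continuous_intros)
  show "\<forall>s<0. r *\<^sub>R f s = 0" using f by simp
qed

definition norm_climfun :: "climfun \<Rightarrow> real" where
  "norm_climfun f = (SUP s\<in>{0..}. cmod (cl_app f s))"

definition dist_climfun :: "climfun \<Rightarrow> climfun \<Rightarrow> real" where
  "dist_climfun f g = norm (f - g)"

definition sgn_climfun :: "climfun \<Rightarrow> climfun" where
  "sgn_climfun f = inverse (norm f) *\<^sub>R f"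

definition uniformity_climfun :: "(climfun \<times> climfun) filter" where
  "uniformity_climfun = (INF e\<in>{0<..}. principal {(f, g). dist f g < e})"

definition open_climfun :: "climfun set \<Rightarrow> bool" where
  "open_climfun U = (\<forall>f\<in>U. eventually (\<lambda>(f', g). f' = f \<longrightarrow> g \<in> U) uniformity)"

lemma cl_norm_ge: "cmod (cl_app f s) \<le> norm f"
proof (cases "s < 0")
  case False
  obtain K where "\<forall>s. cmod (cl_app f s) \<le> K" using cl_bdd by blast
  then have "bdd_above ((\<lambda>s. cmod (cl_app f s)) ` {0..})" by (auto intro!: bdd_aboveI2)
  then show ?thesis unfolding norm_climfun_def using False
    by (intro cSUP_upper) auto
next
  case True
  obtain K where "\<forall>s. cmod (cl_app f s) \<le> K" using cl_bdd by blast
  then have "bdd_above ((\<lambda>s. cmod (cl_app f s)) ` {0..})" by (auto intro!: bdd_aboveI2)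
  then have "cmod (cl_app f 0) \<le> norm f" unfolding norm_climfun_def by (intro cSUP_upper) auto
  then show ?thesis using True cl_neg[of s f] norm_ge_zero[of "cl_app f 0"]
    by (metis norm_zero order_trans)
qed

lemma cl_norm_le: "(\<And>s. s \<ge> 0 \<Longrightarrow> cmod (cl_app f s) \<le> K) \<Longrightarrow> norm f \<le> K"
  unfolding norm_climfun_def by (rule cSUP_least) auto

instance
proof
  fix f g h :: climfun and r q :: real
  show "f + g + h = f + (g + h)" by transfer (simp add: add.assoc)
  show "f + g = g + f" by transfer (simp add: add.commute)
  show "0 + f = f" by transfer simp
  show "- f + f = 0" by transfer simp
  show "f - g = f + - g" by transfer simp
  show "r *\<^sub>R (f + g) = r *\<^sub>R f + r *\<^sub>R g" by transfer (simp add: scaleR_add_right)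
  show "(r + q) *\<^sub>R f = r *\<^sub>R f + q *\<^sub>R f" by transfer (simp add: scaleR_add_left)
  show "r *\<^sub>R q *\<^sub>R f = (r * q) *\<^sub>R f" by transfer simp
  show "1 *\<^sub>R f = f" by transfer simp
  show "dist f g = norm (f - g)" by (simp add: dist_climfun_def)
  show "sgn f = inverse (norm f) *\<^sub>R f" by (simp add: sgn_climfun_def)
  show "uniformity = (INF e\<in>{0<..}. principal {(f :: climfun, g). dist f g < e})"
    by (simp add: uniformity_climfun_def)
  show "open U = (\<forall>f\<in>U. eventually (\<lambda>(f', g). f' = f \<longrightarrow> g \<in> U) uniformity)"
    for U :: "climfun set" by (simp add: open_climfun_def)
  show "(norm f = 0) = (f = 0)"
  proof
    assume "norm f = 0"
    then have "cl_app f s = 0" for s using cl_norm_ge[of f s] by simp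
    then show "f = 0" by (intro cl_eqI) (simp add: zero_climfun.rep_eq)
  next
    assume "f = 0"
    then show "norm f = 0" by (simp add: norm_climfun_def zero_climfun.rep_eq)
  qed
  show "norm (f + g) \<le> norm f + norm g"
    by (rule cl_norm_le)
      (simp add: plus_climfun.rep_eq, meson add_mono cl_norm_ge norm_triangle_ineq order_trans)
  show "norm (r *\<^sub>R f) = \<bar>r\<bar> * norm f"
  proof (rule antisym)
    show "norm (r *\<^sub>R f) \<le> \<bar>r\<bar> * norm f"
      by (rule cl_norm_le) (simp add: scaleR_climfun.rep_eq cl_norm_ge mult_left_mono)
    show "\<bar>r\<bar> * norm f \<le> norm (r *\<^sub>R f)"
    proof (cases "r = 0")
      case True
      then show ?thesis
        using order_trans[OF norm_ge_zero cl_norm_ge[of "r *\<^sub>R f" 0]] by simp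
    next
      case False
      have "norm f \<le> norm (r *\<^sub>R f) / \<bar>r\<bar>"
      proof (rule cl_norm_le)
        fix s :: real
        have "\<bar>r\<bar> * cmod (cl_app f s) \<le> norm (r *\<^sub>R f)"
          using cl_norm_ge[of "r *\<^sub>R f" s] by (simp add: scaleR_climfun.rep_eq)
        then show "cmod (cl_app f s) \<le> norm (r *\<^sub>R f) / \<bar>r\<bar>"
          using False by (simp add: field_simps)
      qed
      then show ?thesis using False by (simp add: field_simps)
    qed
  qed
qed

end

instance climfun :: banach
proof
  fix X :: "nat \<Rightarrow> climfun"
  assume X: "Cauchy X"
  have uC: "uniformly_Cauchy_on UNIV (\<lambda>n. cl_app (X n))"
  proof (rule uniformly_Cauchy_onI)
    fix e :: real assume "e > 0"
    then obtain M where M: "\<And>m n. m \<ge> M \<Longrightarrow> n \<ge> M \<Longrightarrow> dist (X m) (X n) < e"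
      using X unfolding Cauchy_def by blast
    have "dist (cl_app (X m) s) (cl_app (X n) s) < e" if "m \<ge> M" "n \<ge> M" for m n s
      using M[OF that] cl_norm_ge[of "X m - X n" s]
      by (simp add: dist_norm minus_climfun.rep_eq)
    then show "\<exists>M. \<forall>s\<in>UNIV. \<forall>m\<ge>M. \<forall>n\<ge>M. dist (cl_app (X m) s) (cl_app (X n) s) < e"
      by blast
  qed
  then obtain g where g: "uniform_limit UNIV (\<lambda>n. cl_app (X n)) g sequentially"
    using Cauchy_uniformly_convergent unfolding uniformly_convergent_on_def by blast
  have g0: "continuous_on {0..} g"
    by (rule uniform_limit_theorem[OF _ uniform_limit_on_subset[OF g]]) (auto simp: cl_cont)
  have "\<forall>n. \<exists>l. (cl_app (X n) \<longlongrightarrow> l) at_top" by (simp add: cl_lim)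
  from choice[OF this] obtain L where L: "\<And>n. (cl_app (X n) \<longlongrightarrow> L n) at_top" by blast
  have "Cauchy L"
  proof (rule metric_CauchyI)
    fix e :: real assume e: "e > 0"
    then obtain M where M: "\<And>m n. m \<ge> M \<Longrightarrow> n \<ge> M \<Longrightarrow> dist (X m) (X n) < e / 2"
      using X unfolding Cauchy_def by (meson half_gt_zero)
    have "dist (L m) (L n) < e" if "m \<ge> M" "n \<ge> M" for m n
    proof -
      have "dist (L m) (L n) \<le> e / 2"
      proof (rule tendsto_upperbound)
        show "((\<lambda>s. dist (cl_app (X m) s) (cl_app (X n) s)) \<longlongrightarrow> dist (L m) (L n)) at_top"
          by (intro tendsto_dist L)
        have "dist (cl_app (X m) s) (cl_app (X n) s) \<le> e / 2" for s
          using M[OF that] cl_norm_ge[of "X m - X n" s]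
          by (simp add: dist_norm minus_climfun.rep_eq)
        then show "\<forall>\<^sub>F s in at_top. dist (cl_app (X m) s) (cl_app (X n) s) \<le> e / 2" by simp
      qed simp
      then show ?thesis using e by simp
    qed
    then show "\<exists>M. \<forall>m\<ge>M. \<forall>n\<ge>M. dist (L m) (L n) < e" by blast
  qed
  then obtain l where l: "L \<longlonglongrightarrow> l" using Cauchy_convergent convergent_def by blast
  have g1: "(g \<longlongrightarrow> l) at_top"
    by (rule swap_uniform_limit'[OF _ l g]) (auto simp: L)
  have g2: "g s = 0" if "s < 0" for s
  proof -
    have "(\<lambda>n. cl_app (X n) s) \<longlonglongrightarrow> g s" using tendsto_uniform_limitI[OF g] by simp
    then show ?thesis using that by (simp add: cl_neg LIMSEQ_const_iff)
  qed
  define G where "G = Abs_climfun g"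
  have G: "cl_app G = g" unfolding G_def
    by (rule Abs_climfun_inverse) (use g0 g1 g2 in auto)
  have "X \<longlonglongrightarrow> G"
  proof (rule metric_LIMSEQ_I)
    fix e :: real assume e: "e > 0"
    then have "\<forall>\<^sub>F n in sequentially. \<forall>s\<in>UNIV. dist (cl_app (X n) s) (g s) < e / 2"
      using g unfolding uniform_limit_iff by (meson half_gt_zero)
    then obtain N where N: "\<And>n s. n \<ge> N \<Longrightarrow> dist (cl_app (X n) s) (g s) < e / 2"
      by (auto simp: eventually_sequentially)
    have "dist (X n) G < e" if "n \<ge> N" for n
    proof -
      have "norm (X n - G) \<le> e / 2"
        by (rule cl_norm_le) (use N[OF that] in \<open>simp add: minus_climfun.rep_eq G dist_norm less_imp_le\<close>)
      then show ?thesis using e by (simp add: dist_norm)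
    qed
    then show "\<exists>N. \<forall>n\<ge>N. dist (X n) G < e" by blast
  qed
  then show "convergent X" unfolding convergent_def by blast
qed

instantiation climfun :: unital_cstar_algebra
begin

lift_definition one_climfun :: climfun is "\<lambda>s. if s < 0 then 0 else 1"
proof (intro conjI)
  show "continuous_on {0..} (\<lambda>s::real. if s < 0 then 0 else (1::complex))"
    by (rule continuous_on_eq[where f="\<lambda>_. 1"]) auto
  have "\<forall>\<^sub>F s in at_top. (1::complex) = (if s < (0::real) then 0 else 1)"
    using eventually_ge_at_top[of "0::real"] by eventually_elim simp
  then show "\<exists>l. ((\<lambda>s::real. if s < 0 then 0 else (1::complex)) \<longlongrightarrow> l) at_top"
    by (intro exI[of _ 1] Lim_transform_eventually[OF tendsto_const])
qed simp

lift_definition times_climfun :: "climfun \<Rightarrow> climfun \<Rightarrow> climfun" is "\<lambda>f g s. f s * g s"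
  by (auto intro: continuous_on_mult tendsto_mult)

lift_definition cscale_climfun :: "complex \<Rightarrow> climfun \<Rightarrow> climfun" is "\<lambda>c f s. c * f s"
proof (intro conjI)
  fix c :: complex and f :: "real \<Rightarrow> complex"
  assume f: "continuous_on {0..} f \<and> (\<exists>l. (f \<longlongrightarrow> l) at_top) \<and> (\<forall>s<0. f s = 0)"
  then obtain l where "(f \<longlongrightarrow> l) at_top" by blast
  then have "((\<lambda>s. c * f s) \<longlongrightarrow> c * l) at_top" by (intro tendsto_intros)
  then show "\<exists>l. ((\<lambda>s. c * f s) \<longlongrightarrow> l) at_top" by blast
  show "continuous_on {0..} (\<lambda>s. c * f s)" using f by (auto intro!: continuous_intros)
  show "\<forall>s<0. c * f s = 0" using f by simp
qed

lift_definition adj_climfun :: "climfun \<Rightarrow> climfun" is "\<lambda>f s. cnj (f s)"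
  by (auto intro: continuous_on_cnj tendsto_cnj)

instance
proof
  fix f g h :: climfun and c d :: complex and r :: real
  show "f * g * h = f * (g * h)" by transfer (simp add: mult.assoc)
  show "(f + g) * h = f * h + g * h" by transfer (simp add: distrib_right)
  show "f * (g + h) = f * g + f * h" by transfer (simp add: distrib_left)
  show "r *\<^sub>R f * g = r *\<^sub>R (f * g)" by transfer simp
  show "f * r *\<^sub>R g = r *\<^sub>R (f * g)" by transfer simp
  show "1 * f = f" by (rule cl_eqI) (simp add: times_climfun.rep_eq one_climfun.rep_eq)
  show "f * 1 = f" by (rule cl_eqI) (simp add: times_climfun.rep_eq one_climfun.rep_eq)
  have "cl_app (0::climfun) 0 \<noteq> cl_app 1 0"
    by (simp add: zero_climfun.rep_eq one_climfun.rep_eq)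
  then show "(0::climfun) \<noteq> 1" by metis
  show "norm (f * g) \<le> norm f * norm g"
    by (rule cl_norm_le)
      (simp add: times_climfun.rep_eq norm_mult mult_mono cl_norm_ge)
  show "norm (1::climfun) = 1"
  proof (rule antisym)
    show "norm (1::climfun) \<le> 1" by (rule cl_norm_le) (simp add: one_climfun.rep_eq)
    show "1 \<le> norm (1::climfun)" using cl_norm_ge[of 1 0] by (simp add: one_climfun.rep_eq)
  qed
  show "cscale c (f + g) = cscale c f + cscale c g" by transfer (simp add: distrib_left)
  show "cscale (c + d) f = cscale c f + cscale d f" by transfer (simp add: distrib_right)
  show "cscale c (cscale d f) = cscale (c * d) f" by transfer (simp add: mult.assoc)
  show "cscale (complex_of_real r) f = r *\<^sub>R f" by transfer (simp add: scaleR_conv_of_real)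
  show "cscale c f * g = cscale c (f * g)" by transfer (simp add: mult.assoc)
  show "f * cscale c g = cscale c (f * g)" by transfer (simp add: mult.left_commute)
  show "adj (adj f) = f" by transfer simp
  show "adj (f + g) = adj f + adj g" by transfer simp
  show "adj (f * g) = adj g * adj f" by transfer (simp add: mult.commute)
  show "adj (cscale c f) = cscale (cnj c) (adj f)" by transfer simp
  show "norm (cscale c f) = cmod c * norm f"
  proof (rule antisym)
    show "norm (cscale c f) \<le> cmod c * norm f"
      by (rule cl_norm_le) (simp add: cscale_climfun.rep_eq norm_mult cl_norm_ge mult_left_mono)
    show "cmod c * norm f \<le> norm (cscale c f)"
    proof (cases "c = 0")
      case False
      have "norm f \<le> norm (cscale c f) / cmod c"
      proof (rule cl_norm_le)
        fix s :: real
        have "cmod c * cmod (cl_app f s) \<le> norm (cscale c f)"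
          using cl_norm_ge[of "cscale c f" s] by (simp add: cscale_climfun.rep_eq norm_mult)
        then show "cmod (cl_app f s) \<le> norm (cscale c f) / cmod c"
          using False by (simp add: field_simps)
      qed
      then show ?thesis using False by (simp add: field_simps)
    qed simp
  qed
  show "norm (adj f * f) = (norm f)\<^sup>2"
  proof (rule antisym)
    show "norm (adj f * f) \<le> (norm f)\<^sup>2"
      by (rule cl_norm_le)
        (simp add: times_climfun.rep_eq adj_climfun.rep_eq norm_mult power2_eq_square
          mult_mono cl_norm_ge)
    have "norm f \<le> sqrt (norm (adj f * f))"
    proof (rule cl_norm_le)
      fix s :: real
      have "(cmod (cl_app f s))\<^sup>2 \<le> norm (adj f * f)"
        using cl_norm_ge[of "adj f * f" s]
        by (simp add: times_climfun.rep_eq adj_climfun.rep_eq norm_mult power2_eq_square)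
      then show "cmod (cl_app f s) \<le> sqrt (norm (adj f * f))" by (rule real_le_rsqrt)
    qed
    then show "(norm f)\<^sup>2 \<le> norm (adj f * f)"
      by (metis norm_ge_zero power_mono real_sqrt_pow2)
  qed
qed

end

text \<open>The shift \<open>S\<^sub>t\<close>, for \<open>t \<ge> 0\<close>.\<close>

definition cl_shift :: "real \<Rightarrow> climfun \<Rightarrow> climfun" where
  "cl_shift t f = Abs_climfun (\<lambda>s. if s < 0 then 0 else cl_app f (s + t))"

lemma cl_app_shift:
  assumes "t \<ge> 0"
  shows "cl_app (cl_shift t f) s = (if s < 0 then 0 else cl_app f (s + t))"
proof -
  let ?g = "\<lambda>s. if s < 0 then 0 else cl_app f (s + t)"
  have "continuous_on {0..} (\<lambda>s. cl_app f (s + t))"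
    by (rule continuous_on_compose2[OF cl_cont]) (use assms in \<open>auto intro!: continuous_intros\<close>)
  then have 1: "continuous_on {0..} ?g" by (rule continuous_on_eq) auto
  obtain l where l: "(cl_app f \<longlongrightarrow> l) at_top" using cl_lim by blast
  have "filterlim (\<lambda>s. s + t) at_top at_top"
    by (subst add.commute, rule filterlim_tendsto_add_at_top[OF tendsto_const filterlim_ident])
  then have "((\<lambda>s. cl_app f (s + t)) \<longlongrightarrow> l) at_top"
    using l by (rule filterlim_compose[rotated])
  moreover have "\<forall>\<^sub>F s in at_top. cl_app f (s + t) = ?g s"
    using eventually_ge_at_top[of "0::real"] by eventually_elim simp
  ultimately have "(?g \<longlongrightarrow> l) at_top" by (rule Lim_transform_eventually)
  with 1 have "?g \<in> {f. continuous_on {0..} f \<and> (\<exists>l. (f \<longlongrightarrow> l) at_top) \<and> (\<forall>s<0. f s = 0)}"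
    by auto
  then show ?thesis unfolding cl_shift_def by (subst Abs_climfun_inverse) auto
qed


section \<open>Hilbert modules and correspondences\<close>

record ('b, 'e) corr =
  mcar :: "'e set"
  mzero :: 'e
  madd :: "'e \<Rightarrow> 'e \<Rightarrow> 'e"
  mlact :: "'b \<Rightarrow> 'e \<Rightarrow> 'e"
  mract :: "'e \<Rightarrow> 'b \<Rightarrow> 'e"
  mip :: "'e \<Rightarrow> 'e \<Rightarrow> 'b"

text \<open>Since the algebra is unital, the vector space structure is part of the right action:
  \<open>\<lambda>x = x(\<lambda>1)\<close>.\<close>

definition mscale :: "('b::unital_cstar_algebra, 'e) corr \<Rightarrow> complex \<Rightarrow> 'e \<Rightarrow> 'e" where
  "mscale M c x = mract M x (cscale c 1)"

definition mdiff :: "('b::unital_cstar_algebra, 'e) corr \<Rightarrow> 'e \<Rightarrow> 'e \<Rightarrow> 'e" where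
  "mdiff M x y = madd M x (mscale M (- 1) y)"

definition mnorm :: "('b::unital_cstar_algebra, 'e) corr \<Rightarrow> 'e \<Rightarrow> real" where
  "mnorm M x = sqrt (norm (mip M x x))"

definition mcauchy :: "('b::unital_cstar_algebra, 'e) corr \<Rightarrow> (nat \<Rightarrow> 'e) \<Rightarrow> bool" where
  "mcauchy M f \<longleftrightarrow> (\<forall>k. f k \<in> mcar M) \<and>
    (\<forall>e>0. \<exists>N. \<forall>j\<ge>N. \<forall>k\<ge>N. mnorm M (mdiff M (f j) (f k)) < e)"

definition hilbert_module :: "('b::unital_cstar_algebra, 'e) corr \<Rightarrow> bool" where
  "hilbert_module M \<longleftrightarrow>
    mzero M \<in> mcar M \<and>
    (\<forall>x\<in>mcar M. \<forall>y\<in>mcar M. madd M x y \<in> mcar M \<and> madd M x y = madd M y x) \<and>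
    (\<forall>x\<in>mcar M. \<forall>y\<in>mcar M. \<forall>z\<in>mcar M. madd M (madd M x y) z = madd M x (madd M y z)) \<and>
    (\<forall>x\<in>mcar M. madd M (mzero M) x = x \<and> mdiff M x x = mzero M) \<and>
    (\<forall>x\<in>mcar M. \<forall>a. mract M x a \<in> mcar M) \<and>
    (\<forall>x\<in>mcar M. \<forall>y\<in>mcar M. \<forall>a. mract M (madd M x y) a = madd M (mract M x a) (mract M y a)) \<and>
    (\<forall>x\<in>mcar M. \<forall>a b. mract M x (a + b) = madd M (mract M x a) (mract M x b) \<and>
      mract M x (a * b) = mract M (mract M x a) b) \<and>
    (\<forall>x\<in>mcar M. mract M x 1 = x) \<and>
    (\<forall>x\<in>mcar M. \<forall>y\<in>mcar M. \<forall>z\<in>mcar M. mip M x (madd M y z) = mip M x y + mip M x z) \<and>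
    (\<forall>x\<in>mcar M. \<forall>y\<in>mcar M. \<forall>a. mip M x (mract M y a) = mip M x y * a) \<and>
    (\<forall>x\<in>mcar M. \<forall>y\<in>mcar M. adj (mip M x y) = mip M y x) \<and>
    (\<forall>x\<in>mcar M. \<exists>a. mip M x x = adj a * a) \<and>
    (\<forall>x\<in>mcar M. mip M x x = 0 \<longrightarrow> x = mzero M) \<and>
    (\<forall>f. mcauchy M f \<longrightarrow> (\<exists>x\<in>mcar M. (\<lambda>k. mnorm M (mdiff M (f k) x)) \<longlonglongrightarrow> 0))"

definition correspondence :: "('b::unital_cstar_algebra, 'e) corr \<Rightarrow> bool" where
  "correspondence M \<longleftrightarrow> hilbert_module M \<and>
    (\<forall>x\<in>mcar M. \<forall>a. mlact M a x \<in> mcar M) \<and>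
    (\<forall>x\<in>mcar M. \<forall>y\<in>mcar M. \<forall>a. mlact M a (madd M x y) = madd M (mlact M a x) (mlact M a y)) \<and>
    (\<forall>x\<in>mcar M. \<forall>a b. mlact M a (mract M x b) = mract M (mlact M a x) b) \<and>
    (\<forall>x\<in>mcar M. \<forall>a b. mlact M (a + b) x = madd M (mlact M a x) (mlact M b x) \<and>
      mlact M (a * b) x = mlact M a (mlact M b x)) \<and>
    (\<forall>x\<in>mcar M. \<forall>c a. mlact M (cscale c a) x = mscale M c (mlact M a x)) \<and>
    (\<forall>x\<in>mcar M. mlact M 1 x = x) \<and>
    (\<forall>x\<in>mcar M. \<forall>y\<in>mcar M. \<forall>a. mip M x (mlact M a y) = mip M (mlact M (adj a) x) y)"

definition bilinear_unitary ::
  "('b::unital_cstar_algebra, 'e) corr \<Rightarrow> ('b, 'f) corr \<Rightarrow> ('e \<Rightarrow> 'f) \<Rightarrow> bool" where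
  "bilinear_unitary M N v \<longleftrightarrow> v ` mcar M = mcar N \<and>
    (\<forall>x\<in>mcar M. \<forall>y\<in>mcar M. v (madd M x y) = madd N (v x) (v y) \<and> mip N (v x) (v y) = mip M x y) \<and>
    (\<forall>x\<in>mcar M. \<forall>a. v (mlact M a x) = mlact N a (v x) \<and> v (mract M x a) = mract N (v x) a)"

inductive_set mspan :: "('b::unital_cstar_algebra, 'e) corr \<Rightarrow> 'e set \<Rightarrow> 'e set"
  for M :: "('b, 'e) corr" and S :: "'e set" where
  zero: "mzero M \<in> mspan M S"
| step: "x \<in> S \<Longrightarrow> y \<in> mspan M S \<Longrightarrow> madd M (mscale M c x) y \<in> mspan M S"

definition mclosure :: "('b::unital_cstar_algebra, 'e) corr \<Rightarrow> 'e set \<Rightarrow> 'e set" where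
  "mclosure M S = {x \<in> mcar M. \<forall>e>0. \<exists>y\<in>S. mnorm M (mdiff M x y) < e}"


section \<open>Completion\<close>

text \<open>Let \<open>P\<close> be a pre-correspondence: a right module with a (possibly degenerate) semi-inner
  product and a left action by adjointable maps. Its Hausdorff completion is realised as the
  closure of the image of \<open>P\<close> in its dual: a Cauchy sequence \<open>f\<close> is identified with the map
  \<open>y \<mapsto> lim\<^sub>k \<langle>y, f\<^sub>k\<rangle>\<close>, and two Cauchy sequences yield the same map iff
  they differ by a null sequence. For an element \<open>\<phi>\<close> of the completion and \<open>y\<close> in \<open>P\<close> thus
  \<open>\<phi> y = \<langle>y, \<phi>\<rangle>\<close>; in particular \<open>(a\<phi>) y = \<langle>y, a\<phi>\<rangle> = \<langle>a*y, \<phi>\<rangle> = \<phi> (a*y)\<close>.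
  Outside the carrier of \<open>P\<close> the maps are 0.\<close>

definition represents ::
  "('b::unital_cstar_algebra, 'e) corr \<Rightarrow> (nat \<Rightarrow> 'e) \<Rightarrow> ('e \<Rightarrow> 'b) \<Rightarrow> bool" where
  "represents P f \<phi> \<longleftrightarrow> mcauchy P f \<and>
    (\<forall>y\<in>mcar P. (\<lambda>k. mip P y (f k)) \<longlonglongrightarrow> \<phi> y) \<and> (\<forall>y. y \<notin> mcar P \<longrightarrow> \<phi> y = 0)"

definition completion :: "('b::unital_cstar_algebra, 'e) corr \<Rightarrow> ('b, 'e \<Rightarrow> 'b) corr" where
  "completion P = \<lparr>
    mcar = {\<phi>. \<exists>f. represents P f \<phi>},
    mzero = (\<lambda>_. 0),
    madd = (\<lambda>\<phi> \<psi> y. \<phi> y + \<psi> y),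
    mlact = (\<lambda>a \<phi> y. if y \<in> mcar P then \<phi> (mlact P (adj a) y) else 0),
    mract = (\<lambda>\<phi> a y. \<phi> y * a),
    mip = (\<lambda>\<phi> \<psi>. THE a. \<forall>f. represents P f \<phi> \<longrightarrow> (\<lambda>k. \<psi> (f k)) \<longlonglongrightarrow> a)\<rparr>"

definition canon :: "('b::unital_cstar_algebra, 'e) corr \<Rightarrow> 'e \<Rightarrow> 'e \<Rightarrow> 'b" where
  "canon P x = (\<lambda>y. if y \<in> mcar P then mip P y x else 0)"

text \<open>The continuous extension to the completions of a bounded map \<open>h\<close> that is biadditive up to
  null vectors.\<close>

definition extend2 :: "('b::unital_cstar_algebra, 'e) corr \<Rightarrow> ('b, 'f) corr \<Rightarrow> ('b, 'g) corr \<Rightarrow>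
    ('e \<Rightarrow> 'f \<Rightarrow> 'g) \<Rightarrow> ('e \<Rightarrow> 'b) \<Rightarrow> ('f \<Rightarrow> 'b) \<Rightarrow> ('g \<Rightarrow> 'b)" where
  "extend2 P Q R h \<phi> \<psi> = (THE \<theta>. \<forall>f g. represents P f \<phi> \<longrightarrow> represents Q g \<psi> \<longrightarrow>
    represents R (\<lambda>k. h (f k) (g k)) \<theta>)"


section \<open>Internal tensor powers\<close>

text \<open>The elementary tensor \<open>x\<^sub>n \<odot> \<dots> \<odot> x\<^sub>1\<close> is the word \<open>[x\<^sub>n, \<dots>, x\<^sub>1]\<close>.
  The \<open>n\<close>-fold internal tensor power is the Hausdorff completion of the free right module over
  the words of length \<open>n\<close>; for \<open>n = 0\<close> this is the algebra itself, generated by the empty word.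
  \<open>word_ip F a v w\<close> is \<open>\<langle>v, a w\<rangle>\<close>, computed by
  \<open>\<langle>x \<odot> v, a(y \<odot> w)\<rangle> = \<langle>v, \<langle>x, ay\<rangle> w\<rangle>\<close>.\<close>

fun word_ip :: "('b::unital_cstar_algebra, 'f) corr \<Rightarrow> 'b \<Rightarrow> 'f list \<Rightarrow> 'f list \<Rightarrow> 'b" where
  "word_ip F a [] [] = a"
| "word_ip F a (x # v) (y # w) = word_ip F (mip F x (mlact F a y)) v w"
| "word_ip F a _ _ = 0"

text \<open>\<open>word_single F v a w c\<close> is \<open>v \<odot> a w c\<close>.\<close>

fun word_single :: "('b::unital_cstar_algebra, 'f) corr \<Rightarrow> 'f list \<Rightarrow> 'b \<Rightarrow> 'f list \<Rightarrow> 'b \<Rightarrow>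
    'f list \<Rightarrow>\<^sub>0 'b" where
  "word_single F v a [] c = Poly_Mapping.single v (a * c)"
| "word_single F v a (x # w) c = Poly_Mapping.single (v @ mlact F a x # w) c"

definition tensor_pre :: "('b::unital_cstar_algebra, 'f) corr \<Rightarrow> nat \<Rightarrow> ('b, 'f list \<Rightarrow>\<^sub>0 'b) corr" where
  "tensor_pre F n = \<lparr>
    mcar = {f. \<forall>w\<in>Poly_Mapping.keys f. length w = n \<and> set w \<subseteq> mcar F},
    mzero = 0,
    madd = (+),
    mlact = (\<lambda>a f. \<Sum>w\<in>Poly_Mapping.keys f. word_single F [] a w (Poly_Mapping.lookup f w)),
    mract = (\<lambda>f a. Poly_Mapping.map (\<lambda>c. c * a) f),
    mip = (\<lambda>f g. \<Sum>v\<in>Poly_Mapping.keys f. \<Sum>w\<in>Poly_Mapping.keys g.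
      adj (Poly_Mapping.lookup f v) * word_ip F 1 v w * Poly_Mapping.lookup g w)\<rparr>"

type_synonym ('b, 'f) tensors = "('f list \<Rightarrow>\<^sub>0 'b) \<Rightarrow> 'b"

definition tensor_power ::
  "('b::unital_cstar_algebra, 'f) corr \<Rightarrow> nat \<Rightarrow> ('b, ('b, 'f) tensors) corr" where
  "tensor_power F n = completion (tensor_pre F n)"

text \<open>The identification of the internal tensor product of the \<open>m\<close>-th and the \<open>n\<close>-th tensor
  power with the \<open>(m + n)\<close>-th.\<close>

definition tensor_mult :: "('b::unital_cstar_algebra, 'f) corr \<Rightarrow> nat \<Rightarrow> nat \<Rightarrow>
    ('b, 'f) tensors \<Rightarrow> ('b, 'f) tensors \<Rightarrow> ('b, 'f) tensors" where
  "tensor_mult F m n = extend2 (tensor_pre F m) (tensor_pre F n) (tensor_pre F (m + n))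
    (\<lambda>f g. \<Sum>v\<in>Poly_Mapping.keys f. \<Sum>w\<in>Poly_Mapping.keys g.
      word_single F v (Poly_Mapping.lookup f v) w (Poly_Mapping.lookup g w))"


section \<open>The Fock module\<close>

text \<open>A point \<open>(t\<^sub>n, \<dots>, t\<^sub>1)\<close> is the function \<open>i \<mapsto> t\<^sub>i\<close> in
  \<open>{1..n} \<rightarrow>\<^sub>E UNIV\<close>.
  The \<open>n\<close>-particle sector is the completion of the step functions on \<open>[0,\<infinity>)\<^sup>n\<close> with values
  in the \<open>n\<close>-th tensor power; for \<open>n = 0\<close> the domain is a single point of measure 1.
  Step functions take finitely many values, each on a Borel set, and have bounded support in
  \<open>[0,\<infinity>)\<^sup>n\<close>. Unlike the span of indicator functions of boxes, whose completion is the same,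
  this class is stable under multiplication with the indicator function of a Borel set.\<close>

definition step_pre :: "('b::unital_cstar_algebra, 'f) corr \<Rightarrow> nat \<Rightarrow>
    ('b, (nat \<Rightarrow> real) \<Rightarrow> ('b, 'f) tensors) corr" where
  "step_pre F n = (let V = tensor_power F n; L = PiM {1..n} (\<lambda>_. lborel :: real measure) in \<lparr>
    mcar = {f. finite (range f) \<and> range f \<subseteq> mcar V \<and> (\<forall>v. {p \<in> space L. f p = v} \<in> sets L) \<and>
      (\<exists>r. \<forall>p. p \<notin> {1..n} \<rightarrow>\<^sub>E {0..<r} \<longrightarrow> f p = mzero V)},
    mzero = (\<lambda>_. mzero V),
    madd = (\<lambda>f g p. madd V (f p) (g p)),
    mlact = (\<lambda>a f p. mlact V a (f p)),
    mract = (\<lambda>f a p. mract V (f p) a),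
    mip = (\<lambda>f g. Bochner_Integration.simple_bochner_integral L (\<lambda>p. mip V (f p) (g p)))\<rparr>)"

type_synonym ('b, 'f) particles = "((nat \<Rightarrow> real) \<Rightarrow> ('b, 'f) tensors) \<Rightarrow> 'b"

definition sector ::
  "('b::unital_cstar_algebra, 'f) corr \<Rightarrow> nat \<Rightarrow> ('b, ('b, 'f) particles) corr" where
  "sector F n = completion (step_pre F n)"

text \<open>Multiplication with the indicator function of \<open>D\<close>: \<open>\<langle>f, 1\<^sub>D \<phi>\<rangle> = \<langle>1\<^sub>D f, \<phi>\<rangle>\<close>.\<close>

definition mult_ind :: "('b::unital_cstar_algebra, 'f) corr \<Rightarrow> nat \<Rightarrow> (nat \<Rightarrow> real) set \<Rightarrow>
    ('b, 'f) particles \<Rightarrow> ('b, 'f) particles" where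
  "mult_ind F n D \<phi> = (\<lambda>f. if f \<in> mcar (step_pre F n)
    then \<phi> (\<lambda>p. if p \<in> D then f p else mzero (tensor_power F n)) else 0)"

text \<open>The constant function \<open>wc\<close> on \<open>D\<close>, as an element of the \<open>n\<close>-particle sector.\<close>

definition const_on :: "('b::unital_cstar_algebra, 'f) corr \<Rightarrow> nat \<Rightarrow> (nat \<Rightarrow> real) set \<Rightarrow>
    'f list \<Rightarrow> 'b \<Rightarrow> ('b, 'f) particles" where
  "const_on F n D w c = canon (step_pre F n) (\<lambda>p. if p \<in> D
    then canon (tensor_pre F n) (Poly_Mapping.single w c) else mzero (tensor_power F n))"

definition fock :: "('b::unital_cstar_algebra, 'f) corr \<Rightarrow> ('b, nat \<Rightarrow> ('b, 'f) particles) corr" where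
  "fock F = \<lparr>
    mcar = {x. (\<forall>n. x n \<in> mcar (sector F n)) \<and> summable (\<lambda>n. mip (sector F n) (x n) (x n))},
    mzero = (\<lambda>n. mzero (sector F n)),
    madd = (\<lambda>x y n. madd (sector F n) (x n) (y n)),
    mlact = (\<lambda>a x n. mlact (sector F n) a (x n)),
    mract = (\<lambda>x a n. mract (sector F n) (x n) a),
    mip = (\<lambda>x y. suminf (\<lambda>n. mip (sector F n) (x n) (y n)))\<rparr>"

definition ord_simplex :: "nat \<Rightarrow> (nat \<Rightarrow> real) set" where
  "ord_simplex n = {p \<in> {1..n} \<rightarrow>\<^sub>E {0..}. strict_mono_on {1..n} p}"

definition time_ordered_fock ::
  "('b::unital_cstar_algebra, 'f) corr \<Rightarrow> ('b, nat \<Rightarrow> ('b, 'f) particles) corr" where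
  "time_ordered_fock F = (fock F)\<lparr>mcar := (\<lambda>x n. mult_ind F n (ord_simplex n) (x n)) ` mcar (fock F)\<rparr>"


section \<open>Product systems\<close>

text \<open>\<open>ps_mult E s t\<close> is the product of the members at \<open>s\<close> and at \<open>t\<close>, and \<open>ps_emb E\<close> the
  identification of the algebra with the member at 0. Only times \<open>\<ge> 0\<close> are relevant.\<close>

record ('b, 'e) product_system =
  ps_mem :: "real \<Rightarrow> ('b, 'e) corr"
  ps_mult :: "real \<Rightarrow> real \<Rightarrow> 'e \<Rightarrow> 'e \<Rightarrow> 'e"
  ps_emb :: "'b \<Rightarrow> 'e"

definition ps_isomorphic ::
  "('b::unital_cstar_algebra, 'e) product_system \<Rightarrow> ('b, 'f) product_system \<Rightarrow> bool" where
  "ps_isomorphic E E' \<longleftrightarrow> (\<exists>v.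
    (\<forall>t\<ge>0. bilinear_unitary (ps_mem E t) (ps_mem E' t) (v t)) \<and>
    (\<forall>a. v 0 (ps_emb E a) = ps_emb E' a) \<and>
    (\<forall>s\<ge>0. \<forall>t\<ge>0. \<forall>x\<in>mcar (ps_mem E s). \<forall>y\<in>mcar (ps_mem E t).
      v (s + t) (ps_mult E s t x y) = ps_mult E' s t (v s x) (v t y)))"

definition central_unit_vector :: "('b::unital_cstar_algebra, 'e) corr \<Rightarrow> 'e \<Rightarrow> bool" where
  "central_unit_vector M \<omega> \<longleftrightarrow> \<omega> \<in> mcar M \<and> mip M \<omega> \<omega> = 1 \<and> (\<forall>a. mlact M a \<omega> = mract M \<omega> a)"

text \<open>\<open>unit_word E \<xi> [(a\<^sub>n, t\<^sub>n), \<dots>, (a\<^sub>1, t\<^sub>1)] a\<^sub>0\<close> is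
  \<open>a\<^sub>n\<xi>\<^sub>t\<^sub>n \<cdots> a\<^sub>1\<xi>\<^sub>t\<^sub>1 a\<^sub>0\<close>, where \<open>a\<^sub>0\<close> acts as an element of the member at 0.\<close>

fun unit_word :: "('b::unital_cstar_algebra, 'e) product_system \<Rightarrow> (real \<Rightarrow> 'e) \<Rightarrow>
    ('b \<times> real) list \<Rightarrow> 'b \<Rightarrow> 'e" where
  "unit_word E \<xi> [] a\<^sub>0 = ps_emb E a\<^sub>0"
| "unit_word E \<xi> ((a, t) # ps) a\<^sub>0 =
    ps_mult E t (sum_list (map snd ps)) (mlact (ps_mem E t) a (\<xi> t)) (unit_word E \<xi> ps a\<^sub>0)"

definition generated_subsystem ::
  "('b::unital_cstar_algebra, 'e) product_system \<Rightarrow> (real \<Rightarrow> 'e) \<Rightarrow> ('b, 'e) product_system" where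
  "generated_subsystem E \<xi> = E\<lparr>ps_mem := (\<lambda>t. if t = 0 then ps_mem E 0 else
    (ps_mem E t)\<lparr>mcar := mclosure (ps_mem E t) (mspan (ps_mem E t)
      {unit_word E \<xi> ps a\<^sub>0 | ps a\<^sub>0. (\<forall>(a, s)\<in>set ps. s > 0) \<and> sum_list (map snd ps) = t})\<rparr>)\<rparr>"


section \<open>Time ordered product systems\<close>

text \<open>In \<open>(s\<^sub>m, \<dots>, s\<^sub>1, t\<^sub>n, \<dots>, t\<^sub>1)\<close> the time \<open>t\<^sub>i\<close> is coordinate \<open>i\<close> and
  \<open>s\<^sub>i\<close> is coordinate \<open>n + i\<close>. Step functions vanish at points with a negative coordinate.\<close>

definition particle_mult :: "('b::unital_cstar_algebra, 'f) corr \<Rightarrow> real \<Rightarrow> nat \<Rightarrow> nat \<Rightarrow>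
    ('b, 'f) particles \<Rightarrow> ('b, 'f) particles \<Rightarrow> ('b, 'f) particles" where
  "particle_mult F t m n = extend2 (step_pre F m) (step_pre F n) (step_pre F (m + n))
    (\<lambda>f g p. if p \<in> {1..m + n} \<rightarrow>\<^sub>E {0..}
      then tensor_mult F m n (f (\<lambda>i\<in>{1..m}. p (n + i) - t)) (g (restrict p {1..n}))
      else mzero (tensor_power F (m + n)))"

definition time_ordered_system ::
  "('b::unital_cstar_algebra, 'f) corr \<Rightarrow> ('b, nat \<Rightarrow> ('b, 'f) particles) product_system" where
  "time_ordered_system F = \<lparr>
    ps_mem = (\<lambda>t. (time_ordered_fock F)\<lparr>mcar := {x \<in> mcar (time_ordered_fock F).
      \<forall>n\<ge>1. mult_ind F n {p. p n \<ge> t} (x n) = mzero (sector F n)}\<rparr>),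
    ps_mult = (\<lambda>s t x y N f. \<Sum>m\<le>N. particle_mult F t m (N - m) (x m) (y (N - m)) f),
    ps_emb = (\<lambda>a n. if n = 0 then const_on F 0 (ord_simplex 0) [] a else mzero (sector F n))\<rparr>"

definition time_ordered_unit ::
  "('b::unital_cstar_algebra, 'f) corr \<Rightarrow> 'f \<Rightarrow> real \<Rightarrow> nat \<Rightarrow> ('b, 'f) particles" where
  "time_ordered_unit F \<zeta> t = (\<lambda>n. const_on F n {p \<in> ord_simplex n. n \<ge> 1 \<longrightarrow> p n < t} (replicate n \<zeta>) 1)"


section \<open>The correspondence given by the shift\<close>

definition shift_corr :: "(climfun, climfun) corr" where
  "shift_corr = \<lparr>mcar = UNIV, mzero = 0, madd = (+), mlact = (\<lambda>a x. cl_shift 1 a * x),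
    mract = (*), mip = (\<lambda>x y. adj x * y)\<rparr>"

lemma correspondence_shift_corr: "correspondence shift_corr"
proof -
  have sc: "mscale shift_corr c x = cscale c x" for c x
    by (simp add: mscale_def shift_corr_def cscale_mult_right)
  have df: "mdiff shift_corr x y = x - y" for x y
    using cscale_of_real[of "- 1" y] by (simp add: mdiff_def sc) (simp add: shift_corr_def)
  have nm: "mnorm shift_corr x = norm x" for x
    by (simp add: mnorm_def shift_corr_def cstar_identity)
  have comp: "\<exists>x\<in>mcar shift_corr. (\<lambda>k. mnorm shift_corr (mdiff shift_corr (f k) x)) \<longlonglongrightarrow> 0"
    if "mcauchy shift_corr f" for f
  proof -
    have "Cauchy f"
      using that unfolding mcauchy_def df nm Cauchy_def dist_norm by auto
    then obtain x where "f \<longlonglongrightarrow> x" using Cauchy_convergent convergent_def by blast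
    then have "(\<lambda>k. mnorm shift_corr (mdiff shift_corr (f k) x)) \<longlonglongrightarrow> 0"
      by (simp add: df nm tendsto_norm_zero LIM_zero)
    then show ?thesis by (auto simp: shift_corr_def)
  qed
  have ip0: "x = 0" if "adj x * x = 0" for x :: climfun
    using that cstar_identity[of x] by simp
  have "hilbert_module shift_corr"
    unfolding hilbert_module_def df
  proof (intro conjI)
    show "\<forall>f. mcauchy shift_corr f \<longrightarrow>
        (\<exists>x\<in>mcar shift_corr. (\<lambda>k. mnorm shift_corr (f k - x)) \<longlonglongrightarrow> 0)"
      using comp unfolding df by blast
    show "\<forall>x\<in>mcar shift_corr. \<exists>a. mip shift_corr x x = adj a * a"
      by (auto simp: shift_corr_def)
    show "\<forall>x\<in>mcar shift_corr. mip shift_corr x x = 0 \<longrightarrow> x = mzero shift_corr"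
      by (simp add: shift_corr_def) (blast intro: ip0)
  qed (simp_all add: shift_corr_def distrib_left distrib_right mult.assoc adj_mult adj_adj
      add.commute add.assoc)
  moreover have "correspondence shift_corr = hilbert_module shift_corr"
  proof -
    have 1: "cl_shift 1 (a + b) = cl_shift 1 a + cl_shift 1 b"
      and 2: "cl_shift 1 (a * b) = cl_shift 1 a * cl_shift 1 b"
      and 3: "cl_shift 1 (cscale c a) = cscale c (cl_shift 1 a)"
      and 4: "cl_shift 1 (adj a) = adj (cl_shift 1 a)"
      and 5: "cl_shift 1 1 = (1 :: climfun)" for a b c
      by (rule cl_eqI, simp add: cl_app_shift plus_climfun.rep_eq times_climfun.rep_eq
          cscale_climfun.rep_eq adj_climfun.rep_eq one_climfun.rep_eq)+
    show ?thesis unfolding correspondence_def sc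
      by (simp add: shift_corr_def 1 2 3 4 5 distrib_left distrib_right mult.assoc
          cscale_mult_left adj_mult adj_adj)
  qed
  ultimately show ?thesis by simp
qed

end

theory Submission
  imports Defs
begin

text \<open>The \<open>n\<close>-th tensor power of \<open>F\<close> is the algebra with left action \<open>S\<^sub>n\<close>, so pairing a
  central vector of \<open>E\<^sub>t\<close> with the \<open>n\<close>-particle part of \<open>\<xi>\<^sub>t\<close> gives a function \<open>w\<^sub>n\<close> with
  \<open>\<Sum>\<^sub>n (S\<^sub>n(b) - b)\<^sup>* w\<^sub>n = 0\<close> for all \<open>b\<close>; taking for \<open>b\<close> a bump at \<open>s + n\<close> yields \<open>w\<^sub>n = 0\<close>
  for \<open>n \<ge> 1\<close>. Evaluation at infinity is a character invariant under the shift. Under it every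
  word \<open>b\<^sub>n\<xi>\<^sub>t\<^sub>n \<cdots> b\<^sub>1\<xi>\<^sub>t\<^sub>1 b\<^sub>0\<close> becomes a multiple of \<open>\<xi>\<^sub>t\<close>, whence \<open>w\<^sub>1(\<infinity>) = t w\<^sub>0(\<infinity>)\<close> for every
  vector of \<open>E\<^sub>t\<close>, and \<open>\<Sum>\<^sub>n w\<^sub>n(\<infinity>) \<noteq> 0\<close> for every unit vector. These are incompatible.

  An isomorphism with \<open>\<Gamma>(G)\<close> would pull the vacuum, which is central, back to a central unit
  vector.\<close>


section \<open>Continuous functions with a limit at infinity\<close>

text \<open>Elements of the completions are functionals, and inner products and products of them are
  definite descriptions over all representing sequences, so they can be computed only on images of
  step functions. A general vector of the subsystem is therefore never described: spans of words
  turn out to consist of sequences of step functions, and the closure is reached by estimates alone.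
  Both relations at infinity survive this limit because \<open>cl_inf\<close> is contractive. The
  factor t between w_1 and w_0 is the quotient of two volumes, that of the interval [0,t) for one
  particle and that of a single point for none.

  Particle numbers can be separated at a finite point s because centrality there compares the values
  of b at s, s+1, s+2, ..., of which a bump picks out one. At infinity all these values coincide, so
  nothing is separated, and exactly this makes every word look like the unit. The contradiction sets
  the two ends of the half-line against each other.

  Centrality enters only through pairings with the unit. This weak form is also what an isomorphism
  transports by preserving inner products.\<close>

instance climfun :: comm_ring_1
proof
  fix f g h :: climfun
  show "f * g = g * f"
    by (rule cl_eqI) (simp add: times_climfun.rep_eq mult.commute)
qed (simp_all add: distrib_right)

lemmas cl_rep = zero_climfun.rep_eq plus_climfun.rep_eq minus_climfun.rep_eq uminus_climfun.rep_eq
  scaleR_climfun.rep_eq times_climfun.rep_eq cscale_climfun.rep_eq adj_climfun.rep_eq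

lemma cl_app_one [simp]: "s \<ge> 0 \<Longrightarrow> cl_app 1 s = 1"
  by (simp add: one_climfun.rep_eq)

lemma bounded_linear_cl_app: "bounded_linear (\<lambda>f. cl_app f s)"
  by (rule bounded_linear_intro[where K=1]) (simp_all add: cl_rep cl_norm_ge)

lemma adj_zero [simp]: "adj (0::'b::unital_cstar_algebra) = 0"
  by (metis add_cancel_right_right adj_add)

lemma adj_one [simp]: "adj (1::'b::unital_cstar_algebra) = 1"
  by (metis adj_adj adj_mult mult.right_neutral mult_1)

lemma adj_minus: "adj (- a) = - adj (a::'b::unital_cstar_algebra)"
  by (metis adj_add adj_zero add.right_inverse add_eq_0_iff)

lemma adj_diff: "adj (a - b) = adj a - adj (b::'b::unital_cstar_algebra)"
  by (metis adj_add adj_minus diff_conv_add_uminus)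

lemma norm_adj_climfun [simp]: "norm (adj (f::climfun)) = norm f"
  by (simp add: norm_climfun_def cl_rep)

lemma bounded_linear_adj: "bounded_linear (adj :: climfun \<Rightarrow> climfun)"
proof (rule bounded_linear_intro[where K=1])
  show "adj (r *\<^sub>R f) = r *\<^sub>R adj f" for r and f :: climfun
    by (rule cl_eqI) (simp add: cl_rep)
qed (simp_all add: adj_add)

lemma cscale_minus_one [simp]: "cscale (- 1) (1::'b::unital_cstar_algebra) = - 1"
  using cscale_of_real[of "- 1" "1::'b"] by simp

lemma cscale_one_one [simp]: "cscale 1 (1::'b::unital_cstar_algebra) = 1"
  using cscale_of_real[of 1 "1::'b"] by simp

definition cl_inf :: "climfun \<Rightarrow> complex" where
  "cl_inf f = Lim at_top (cl_app f)"

lemma cl_inf: "(cl_app f \<longlongrightarrow> cl_inf f) at_top"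
  using cl_lim[of f] unfolding cl_inf_def by (auto simp: tendsto_Lim)

lemma cl_infI: "(cl_app f \<longlongrightarrow> l) at_top \<Longrightarrow> cl_inf f = l"
  unfolding cl_inf_def by (rule tendsto_Lim) simp

lemma cl_inf_add: "cl_inf (f + g) = cl_inf f + cl_inf g"
  by (rule cl_infI) (auto simp: cl_rep intro!: tendsto_intros cl_inf)

lemma cl_inf_mult: "cl_inf (f * g) = cl_inf f * cl_inf g"
  by (rule cl_infI) (auto simp: cl_rep intro!: tendsto_intros cl_inf)

lemma cl_inf_adj: "cl_inf (adj f) = cnj (cl_inf f)"
  by (rule cl_infI) (auto simp: cl_rep intro!: tendsto_intros cl_inf)

lemma cl_inf_cscale: "cl_inf (cscale c f) = c * cl_inf f"
  by (rule cl_infI) (auto simp: cl_rep intro!: tendsto_intros cl_inf)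

lemma cl_inf_one [simp]: "cl_inf 1 = 1"
proof (rule cl_infI, rule Lim_transform_eventually[OF tendsto_const])
  show "\<forall>\<^sub>F s in at_top. 1 = cl_app 1 s"
    using eventually_ge_at_top[of "0::real"] by eventually_elim simp
qed

lemma cmod_cl_inf_le: "cmod (cl_inf f) \<le> norm f"
  by (rule tendsto_upperbound[OF tendsto_norm[OF cl_inf]]) (simp_all add: cl_norm_ge)

lemma bounded_linear_cl_inf: "bounded_linear cl_inf"
proof (rule bounded_linear_intro[where K=1])
  show "cl_inf (r *\<^sub>R f) = r *\<^sub>R cl_inf f" for r f
    using cl_inf_cscale[of "of_real r" f] by (simp add: cscale_of_real scaleR_conv_of_real)
qed (simp_all add: cl_inf_add cmod_cl_inf_le)

lemma cl_inf_diff: "cl_inf (f - g) = cl_inf f - cl_inf g"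
  by (rule linear_diff[OF bounded_linear.linear[OF bounded_linear_cl_inf]])

lemma cl_inf_zero [simp]: "cl_inf 0 = 0"
  using bounded_linear.linear[OF bounded_linear_cl_inf] linear_0 by blast

lemma
  assumes "t \<ge> 0"
  shows cl_shift_add: "cl_shift t (f + g) = cl_shift t f + cl_shift t g"
    and cl_shift_mult: "cl_shift t (f * g) = cl_shift t f * cl_shift t g"
    and cl_shift_diff: "cl_shift t (f - g) = cl_shift t f - cl_shift t g"
    and cl_shift_adj: "cl_shift t (adj f) = adj (cl_shift t f)"
    and cl_shift_one: "cl_shift t 1 = 1"
    and cl_shift_zero: "cl_shift t 0 = 0"
  by (rule cl_eqI, use assms in \<open>auto simp: cl_app_shift cl_rep one_climfun.rep_eq\<close>)+

lemma cl_shift_0 [simp]: "cl_shift 0 f = f"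
  by (rule cl_eqI) (simp add: cl_app_shift)

lemma cl_shift_shift: "s \<ge> 0 \<Longrightarrow> t \<ge> 0 \<Longrightarrow> cl_shift s (cl_shift t f) = cl_shift (s + t) f"
  by (rule cl_eqI) (simp add: cl_app_shift add_ac)

lemma norm_cl_shift_le: "t \<ge> 0 \<Longrightarrow> norm (cl_shift t f) \<le> norm f"
  by (rule cl_norm_le) (simp add: cl_app_shift cl_norm_ge)

lemma cl_inf_shift: "t \<ge> 0 \<Longrightarrow> cl_inf (cl_shift t f) = cl_inf f"
proof (rule cl_infI)
  assume t: "t \<ge> 0"
  have "filterlim (\<lambda>s. s + t) at_top at_top"
    by (subst add.commute, rule filterlim_tendsto_add_at_top[OF tendsto_const filterlim_ident])
  then have "((\<lambda>s. cl_app f (s + t)) \<longlongrightarrow> cl_inf f) at_top"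
    using cl_inf by (rule filterlim_compose[rotated])
  moreover have "\<forall>\<^sub>F s in at_top. cl_app f (s + t) = cl_app (cl_shift t f) s"
    using eventually_ge_at_top[of "0::real"] by eventually_elim (simp add: cl_app_shift t)
  ultimately show "(cl_app (cl_shift t f) \<longlongrightarrow> cl_inf f) at_top"
    by (rule Lim_transform_eventually)
qed

text \<open>A tent of height 1 and half-width 1/2 vanishes at every point whose distance from the
  centre is a nonzero integer. Among the points s, s+1, s+2, ... it therefore sees only its own
  centre, which isolates one particle number.\<close>

lemma ex_climfun_bump:
  assumes "s0 \<ge> 0"
  shows "\<exists>f. \<forall>s\<ge>0. cl_app f s = complex_of_real (max 0 (1 - 2 * \<bar>s - s0\<bar>))"
proof -
  let ?g = "\<lambda>s. if s < 0 then 0 else complex_of_real (max 0 (1 - 2 * \<bar>s - s0\<bar>))"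
  have "continuous_on {0..} (\<lambda>s. complex_of_real (max 0 (1 - 2 * \<bar>s - s0\<bar>)))"
    by (intro continuous_intros)
  then have 1: "continuous_on {0..} ?g" by (rule continuous_on_eq) auto
  have "\<forall>\<^sub>F s in at_top. 0 = ?g s"
    using eventually_ge_at_top[of "s0 + 1"] by eventually_elim auto
  then have "(?g \<longlongrightarrow> 0) at_top" by (rule Lim_transform_eventually[OF tendsto_const])
  with 1 have "?g \<in> {f. continuous_on {0..} f \<and> (\<exists>l. (f \<longlongrightarrow> l) at_top) \<and> (\<forall>s<0. f s = 0)}"
    by auto
  then show ?thesis by (intro exI[of _ "Abs_climfun ?g"]) (subst Abs_climfun_inverse, auto)
qed

section \<open>Semi-inner products and their completions\<close>

lemma ex_add_bound:
  fixes a b :: "nat \<Rightarrow> nat \<Rightarrow> real"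
  assumes a: "\<And>e. e > 0 \<Longrightarrow> \<exists>N. \<forall>j\<ge>N. \<forall>k\<ge>N. a j k < e"
    and b: "\<And>e. e > 0 \<Longrightarrow> \<exists>N. \<forall>j\<ge>N. \<forall>k\<ge>N. b j k < e" and e: "e > 0"
  shows "\<exists>N. \<forall>j\<ge>N. \<forall>k\<ge>N. a j k + b j k < e"
proof -
  have e2: "e / 2 > 0" using e by simp
  obtain M where M: "\<forall>j\<ge>M. \<forall>k\<ge>M. a j k < e / 2" using a[OF e2] by blast
  obtain N where N: "\<forall>j\<ge>N. \<forall>k\<ge>N. b j k < e / 2" using b[OF e2] by blast
  show ?thesis
  proof (intro exI[of _ "max M N"] allI impI)
    fix j k assume "j \<ge> max M N" "k \<ge> max M N"
    then have "a j k < e / 2" "b j k < e / 2" using M N by simp_all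
    then show "a j k + b j k < e" by linarith
  qed
qed

text \<open>One set of axioms for semi-inner products covers words, step functions, their
  completions, finite blocks of sectors and the Fock module. Positivity is stated pointwise, since
  the scalars are functions; this reduces Cauchy-Schwarz to a scalar inequality at each point. Laws
  of addition are visible only through inner products, as befits possibly degenerate
  modules.\<close>

locale pre_ip =
  fixes P :: "(climfun, 'e) corr"
  assumes madd_closed: "x \<in> mcar P \<Longrightarrow> y \<in> mcar P \<Longrightarrow> madd P x y \<in> mcar P"
    and mract_closed: "x \<in> mcar P \<Longrightarrow> mract P x a \<in> mcar P"
    and mip_add: "x \<in> mcar P \<Longrightarrow> y \<in> mcar P \<Longrightarrow> z \<in> mcar P \<Longrightarrow>
      mip P x (madd P y z) = mip P x y + mip P x z"
    and mip_mract: "x \<in> mcar P \<Longrightarrow> y \<in> mcar P \<Longrightarrow> mip P x (mract P y a) = mip P x y * a"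
    and mip_adj: "x \<in> mcar P \<Longrightarrow> y \<in> mcar P \<Longrightarrow> adj (mip P x y) = mip P y x"
    and mip_pos: "x \<in> mcar P \<Longrightarrow> 0 \<le> Re (cl_app (mip P x x) s)"
begin

lemma mscale_closed: "x \<in> mcar P \<Longrightarrow> mscale P c x \<in> mcar P"
  by (simp add: mscale_def mract_closed)

lemma mdiff_closed: "x \<in> mcar P \<Longrightarrow> y \<in> mcar P \<Longrightarrow> mdiff P x y \<in> mcar P"
  by (simp add: mdiff_def madd_closed mscale_closed)

lemma mip_add_left: "x \<in> mcar P \<Longrightarrow> y \<in> mcar P \<Longrightarrow> z \<in> mcar P \<Longrightarrow>
    mip P (madd P x y) z = mip P x z + mip P y z"
  using arg_cong[OF mip_add[of z x y], of adj] by (simp add: adj_add mip_adj madd_closed)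

lemma mip_mract_left: "x \<in> mcar P \<Longrightarrow> y \<in> mcar P \<Longrightarrow> mip P (mract P x a) y = adj a * mip P x y"
  using arg_cong[OF mip_mract[of y x a], of adj] by (simp add: adj_mult mip_adj mract_closed)

lemma mip_mscale: "x \<in> mcar P \<Longrightarrow> y \<in> mcar P \<Longrightarrow> mip P x (mscale P c y) = cscale c (mip P x y)"
  by (simp add: mscale_def mip_mract cscale_mult_right)

lemma mip_mdiff: "x \<in> mcar P \<Longrightarrow> y \<in> mcar P \<Longrightarrow> z \<in> mcar P \<Longrightarrow>
    mip P x (mdiff P y z) = mip P x y - mip P x z"
  by (simp add: mdiff_def mip_add mscale_closed) (simp add: mscale_def mip_mract)

lemma mip_mdiff_left: "x \<in> mcar P \<Longrightarrow> y \<in> mcar P \<Longrightarrow> z \<in> mcar P \<Longrightarrow>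
    mip P (mdiff P x y) z = mip P x z - mip P y z"
  using arg_cong[OF mip_mdiff[of z x y], of adj] by (simp add: adj_diff mip_adj mdiff_closed)

lemma cl_app_mip_self:
  assumes "x \<in> mcar P"
  shows "cl_app (mip P x x) s = complex_of_real (Re (cl_app (mip P x x) s))"
proof -
  have "cnj (cl_app (mip P x x) s) = cl_app (mip P x x) s"
    using arg_cong[OF mip_adj[OF assms assms], of "\<lambda>f. cl_app f s"] by (simp add: cl_rep)
  then have "Im (cl_app (mip P x x) s) = 0"
    by (simp add: complex_eq_iff)
  then show ?thesis by (simp add: complex_eq_iff)
qed

lemma Cauchy_Schwarz_point:
  assumes x: "x \<in> mcar P" and y: "y \<in> mcar P"
  shows "(cmod (cl_app (mip P x y) s))\<^sup>2 \<le> Re (cl_app (mip P x x) s) * Re (cl_app (mip P y y) s)"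
proof (cases "s < 0")
  case True
  then show ?thesis by (simp add: cl_neg)
next
  case False
  define a b c where "a = Re (cl_app (mip P x x) s)" and "b = cl_app (mip P x y) s"
    and "c = Re (cl_app (mip P y y) s)"
  have a: "cl_app (mip P x x) s = complex_of_real a" and c: "cl_app (mip P y y) s = complex_of_real c"
    unfolding a_def c_def by (rule cl_app_mip_self[OF x], rule cl_app_mip_self[OF y])
  have *: "0 \<le> a + 2 * Re (l * b) + (cmod l)\<^sup>2 * c" for l
  proof -
    let ?z = "madd P x (mscale P l y)"
    have z: "?z \<in> mcar P" and ly: "mscale P l y \<in> mcar P"
      using x y by (auto intro: madd_closed mscale_closed)
    have ml: "mip P (mscale P l y) w = adj (cscale l (mip P w y))" if "w \<in> mcar P" for w
      using mip_adj[OF that ly] mip_mscale[OF that y] by simp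
    have "mip P ?z ?z = mip P x x + cscale l (mip P x y) +
        (adj (cscale l (mip P x y)) + cscale l (adj (cscale l (mip P y y))))"
      using x y ly z by (simp add: mip_add mip_add_left mip_mscale ml cscale_add_right)
    then have "cl_app (mip P ?z ?z) s = a + l * b + (cnj (l * b) + l * (cnj l * c))"
      using a c by (simp add: cl_rep b_def)
    then have "Re (cl_app (mip P ?z ?z) s) = a + 2 * Re (l * b) + (cmod l)\<^sup>2 * c"
      unfolding cmod_power2 by (simp add: power2_eq_square algebra_simps)
    then show ?thesis using mip_pos[OF z, of s] by simp
  qed
  have c0: "c \<ge> 0" unfolding c_def by (rule mip_pos[OF y])
  have lb: "Re (complex_of_real r * cnj b * b) = r * (cmod b)\<^sup>2" for r
    unfolding cmod_power2 by (simp add: power2_eq_square algebra_simps)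
  have "(cmod b)\<^sup>2 \<le> a * c"
  proof (cases "c = 0")
    case True
    have "0 \<le> a - 2 * r * (cmod b)\<^sup>2" for r
      using *[of "complex_of_real (- r) * cnj b"] unfolding lb True by simp
    \<comment> \<open>If \<open>b\<close> were nonzero, this value of \<open>r\<close> would give 0
      \<le> -1.\<close>
    from this[of "(a + 1) / (2 * (cmod b)\<^sup>2)"] have "b = 0"
      by (cases "b = 0") auto
    then show ?thesis using True by simp
  next
    case False
    with c0 have c: "c > 0" by simp
    \<comment> \<open>The choice \<open>l = - cnj b / c\<close> minimises the quadratic expression
      in \<open>l\<close>.\<close>
    have "0 \<le> a + 2 * (- (1 / c) * (cmod b)\<^sup>2) + ((1 / c) * cmod b)\<^sup>2 * c"
      using *[of "complex_of_real (- (1 / c)) * cnj b"] c unfolding lb by (simp add: norm_divide)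
    also have "\<dots> = a - (cmod b)\<^sup>2 / c"
      using c by (simp add: field_simps power2_eq_square)
    finally show ?thesis using c by (simp add: field_simps)
  qed
  then show ?thesis by (simp add: a_def b_def c_def)
qed

lemma mnorm_sq: "(mnorm P x)\<^sup>2 = norm (mip P x x)"
  by (simp add: mnorm_def)

lemma mnorm_nonneg [simp]: "0 \<le> mnorm P x"
  by (simp add: mnorm_def)

lemma Re_mip_le_mnorm: "Re (cl_app (mip P x x) s) \<le> (mnorm P x)\<^sup>2"
  unfolding mnorm_sq by (rule order_trans[OF complex_Re_le_cmod cl_norm_ge])

lemma mnorm_leI:
  assumes x: "x \<in> mcar P" and K: "0 \<le> K"
    and le: "\<And>s. s \<ge> 0 \<Longrightarrow> Re (cl_app (mip P x x) s) \<le> K\<^sup>2"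
  shows "mnorm P x \<le> K"
proof -
  have "norm (mip P x x) \<le> K\<^sup>2"
  proof (rule cl_norm_le)
    fix s :: real assume s: "s \<ge> 0"
    have "cmod (cl_app (mip P x x) s) = Re (cl_app (mip P x x) s)"
      by (subst cl_app_mip_self[OF x]) (simp only: norm_of_real abs_of_nonneg mip_pos[OF x])
    then show "cmod (cl_app (mip P x x) s) \<le> K\<^sup>2" using le[OF s] by simp
  qed
  then have "(mnorm P x)\<^sup>2 \<le> K\<^sup>2" by (simp add: mnorm_sq)
  then show ?thesis using K by (rule power2_le_imp_le)
qed

lemma Cauchy_Schwarz:
  assumes x: "x \<in> mcar P" and y: "y \<in> mcar P"
  shows "norm (mip P x y) \<le> mnorm P x * mnorm P y"
proof (rule cl_norm_le)
  fix s :: real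
  have "(cmod (cl_app (mip P x y) s))\<^sup>2 \<le> (mnorm P x * mnorm P y)\<^sup>2"
    unfolding power_mult_distrib
    by (rule order_trans[OF Cauchy_Schwarz_point[OF x y]])
      (intro mult_mono Re_mip_le_mnorm mip_pos x y zero_le_power2)
  then show "cmod (cl_app (mip P x y) s) \<le> mnorm P x * mnorm P y"
    by (rule power2_le_imp_le) simp
qed

text \<open>Cancels one factor of the norm, so that an estimate of \<langle>x, x\<rangle> obtained
  by applying Cauchy-Schwarz to one side only becomes an estimate of x.\<close>

lemma mnorm_le_of_mip: "norm (mip P x x) \<le> mnorm P x * K \<Longrightarrow> 0 \<le> K \<Longrightarrow> mnorm P x \<le> K"
  unfolding mnorm_sq[symmetric] power2_eq_square
  by (cases "mnorm P x = 0") (auto simp: mult_le_cancel_left less_le)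

text \<open>The relation "z is the sum of x and y" is asked for only when paired with z, because in
  a degenerate module it may hold merely up to null vectors. It also fits differences of
  differences, where the carrier elements need not coincide literally.\<close>

lemma mnorm_triangle:
  assumes "x \<in> mcar P" "y \<in> mcar P" "z \<in> mcar P" and eq: "mip P z z = mip P z x + mip P z y"
  shows "mnorm P z \<le> mnorm P x + mnorm P y"
proof (rule mnorm_le_of_mip)
  show "norm (mip P z z) \<le> mnorm P z * (mnorm P x + mnorm P y)"
    unfolding eq distrib_left
    by (rule order_trans[OF norm_triangle_ineq]) (intro add_mono Cauchy_Schwarz assms)
qed simp

lemma mnorm_mdiff_self [simp]: "x \<in> mcar P \<Longrightarrow> mnorm P (mdiff P x x) = 0"
  by (simp add: mnorm_def mip_mdiff mdiff_closed)

lemma mnorm_mract_le: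
  assumes x: "x \<in> mcar P"
  shows "mnorm P (mract P x a) \<le> mnorm P x * norm a"
proof (rule mnorm_le_of_mip)
  note xa = mract_closed[OF x, of a]
  show "norm (mip P (mract P x a) (mract P x a)) \<le> mnorm P (mract P x a) * (mnorm P x * norm a)"
    unfolding mip_mract[OF xa x] mult.assoc[symmetric]
    by (rule order_trans[OF norm_mult_ineq mult_right_mono[OF Cauchy_Schwarz[OF xa x]]]) simp
qed simp

section \<open>Cauchy sequences and the vectors they represent\<close>

lemma mcauchy_carrier: "mcauchy P f \<Longrightarrow> f k \<in> mcar P"
  by (simp add: mcauchy_def)

lemma mcauchyD:
  "mcauchy P f \<Longrightarrow> e > 0 \<Longrightarrow> \<exists>N. \<forall>j\<ge>N. \<forall>k\<ge>N. mnorm P (mdiff P (f j) (f k)) < e"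
  by (simp add: mcauchy_def)

lemma mcauchyI:
  assumes f: "\<And>k. f k \<in> mcar P" and d: "\<And>e. e > 0 \<Longrightarrow> \<exists>N. \<forall>j\<ge>N. \<forall>k\<ge>N. d j k < e"
    and le: "\<And>j k. mnorm P (mdiff P (f j) (f k)) \<le> C * d j k" and C: "C \<ge> 0"
  shows "mcauchy P f"
  unfolding mcauchy_def
proof (intro conjI allI impI)
  fix e :: real assume "e > 0"
  \<comment> \<open>The divisor C + 1 keeps the threshold meaningful for C = 0.\<close>
  then obtain N where N: "\<And>j k. j \<ge> N \<Longrightarrow> k \<ge> N \<Longrightarrow> d j k < e / (C + 1)"
    using d[of "e / (C + 1)"] C by auto
  show "\<exists>N. \<forall>j\<ge>N. \<forall>k\<ge>N. mnorm P (mdiff P (f j) (f k)) < e"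
  proof (intro exI allI impI)
    fix j k assume "j \<ge> N" "k \<ge> N"
    then have "C * d j k \<le> C * (e / (C + 1))" 
      using less_imp_le[OF N] C by (intro mult_left_mono) auto
    also have "\<dots> < e" using C \<open>e > 0\<close> by (simp add: field_simps)
    finally show "mnorm P (mdiff P (f j) (f k)) < e" using le[of j k] by simp
  qed
qed (rule f)

lemma mcauchyD':
  "mcauchy P f \<Longrightarrow> e > 0 \<Longrightarrow> \<exists>N. \<forall>j\<ge>N. \<forall>k\<ge>N. mnorm P (mdiff P (f k) (f j)) < e"
  using mcauchyD by blast

lemma mcauchy_bounded:
  assumes f: "mcauchy P f"
  shows "\<exists>K\<ge>0. \<forall>k. mnorm P (f k) \<le> K"
proof -
  obtain N where N: "\<And>j k. j \<ge> N \<Longrightarrow> k \<ge> N \<Longrightarrow> mnorm P (mdiff P (f j) (f k)) < 1"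
    using mcauchyD[OF f, of 1] by auto
  have fc: "f k \<in> mcar P" for k by (rule mcauchy_carrier[OF f])
  define K where "K = Max ((\<lambda>k. mnorm P (f k)) ` {..N}) + 1"
  have K: "mnorm P (f k) \<le> K - 1" if "k \<le> N" for k
    unfolding K_def using that by (simp add: Max_ge)
  have "mnorm P (f k) \<le> K" for k
  proof (cases "k \<le> N")
    case False
    have "mnorm P (f k) \<le> mnorm P (f N) + mnorm P (mdiff P (f k) (f N))"
      by (rule mnorm_triangle) (simp_all add: fc mdiff_closed mip_mdiff)
    then show ?thesis using N[of k N] False K[of N] by simp
  qed (use K in force)
  moreover have "0 \<le> K" using calculation[of 0] mnorm_nonneg[of "f 0"] by linarith
  ultimately show ?thesis by blast
qed

lemma represents_unique: "represents P f \<phi> \<Longrightarrow> represents P f \<psi> \<Longrightarrow> \<phi> = \<psi>"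
  by (rule ext) (metis LIMSEQ_unique represents_def)

lemma represents_mcauchy: "represents P f \<phi> \<Longrightarrow> mcauchy P f"
  by (simp add: represents_def)

lemma represents_lim: "represents P f \<phi> \<Longrightarrow> x \<in> mcar P \<Longrightarrow> (\<lambda>k. mip P x (f k)) \<longlonglongrightarrow> \<phi> x"
  by (simp add: represents_def)

text \<open>Each \<open>\<psi> (f k)\<close> is the limit over j of the pairings of
  \<open>f k\<close> with \<open>g j\<close>. Since \<open>f\<close> is bounded and \<open>g\<close>
  is Cauchy, replacing j by k costs an error that is uniformly small in k, so the iterated limit may
  be computed along the diagonal.\<close>

lemma represents_diag:
  assumes f: "mcauchy P f" and g: "represents P g \<psi>"
  shows "(\<lambda>k. \<psi> (f k) - mip P (f k) (g k)) \<longlonglongrightarrow> 0"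
proof (rule LIMSEQ_I)
  fix e :: real assume e: "e > 0"
  have fc: "f k \<in> mcar P" for k by (rule mcauchy_carrier[OF f])
  have gc: "g k \<in> mcar P" for k by (rule mcauchy_carrier[OF represents_mcauchy[OF g]])
  obtain K' where K': "\<And>k. mnorm P (f k) \<le> K'" using mcauchy_bounded[OF f] by auto
  define K where "K = \<bar>K'\<bar> + 1"
  have K: "K > 0" "\<And>k. mnorm P (f k) \<le> K" unfolding K_def
    using order_trans[OF K'] by (simp_all add: abs_le_D1)
  obtain N where N: "\<And>j k. j \<ge> N \<Longrightarrow> k \<ge> N \<Longrightarrow> mnorm P (mdiff P (g j) (g k)) < e / 2 / K"
    using mcauchyD[OF represents_mcauchy[OF g], of "e / 2 / K"] K e by auto
  have "norm (\<psi> (f k) - mip P (f k) (g k) - 0) < e" if k: "k \<ge> N" for k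
  proof -
    have "norm (mip P (f k) (g j) - mip P (f k) (g k)) \<le> e / 2" if "j \<ge> N" for j
    proof -
      have "norm (mip P (f k) (g j) - mip P (f k) (g k)) \<le> mnorm P (f k) * mnorm P (mdiff P (g j) (g k))"
        using Cauchy_Schwarz[of "f k" "mdiff P (g j) (g k)"] by (simp add: mip_mdiff fc gc mdiff_closed)
      also have "\<dots> \<le> K * (e / 2 / K)"
        using K N[OF that k] by (intro mult_mono) auto
      finally show ?thesis using K by simp
    qed
    then have "\<forall>\<^sub>F j in sequentially. norm (mip P (f k) (g j) - mip P (f k) (g k)) \<le> e / 2"
      by (auto simp: eventually_sequentially)
    moreover have "(\<lambda>j. norm (mip P (f k) (g j) - mip P (f k) (g k))) \<longlonglongrightarrow>
        norm (\<psi> (f k) - mip P (f k) (g k))"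
      by (intro tendsto_intros represents_lim[OF g] fc)
    ultimately have "norm (\<psi> (f k) - mip P (f k) (g k)) \<le> e / 2"
      by (intro tendsto_upperbound) auto
    then show ?thesis using e by simp
  qed
  then show "\<exists>N. \<forall>k\<ge>N. norm (\<psi> (f k) - mip P (f k) (g k) - 0) < e" by blast
qed

lemma mip_seq_convergent:
  assumes f: "mcauchy P f" and g: "mcauchy P g"
  shows "convergent (\<lambda>k. mip P (f k) (g k))"
proof (rule Cauchy_convergent, rule metric_CauchyI)
  fix e :: real assume e: "e > 0"
  have fc: "f k \<in> mcar P" for k by (rule mcauchy_carrier[OF f])
  have gc: "g k \<in> mcar P" for k by (rule mcauchy_carrier[OF g])
  obtain K1 where K1: "K1 \<ge> 0" "\<And>k. mnorm P (f k) \<le> K1" using mcauchy_bounded[OF f] by blast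
  obtain K2 where K2: "K2 \<ge> 0" "\<And>k. mnorm P (g k) \<le> K2" using mcauchy_bounded[OF g] by blast
  define K where "K = K1 + K2 + 1"
  have K: "K > 0" "mnorm P (f k) \<le> K" "mnorm P (g k) \<le> K" for k
    using K1(2)[of k] K2(2)[of k] K1(1) K2(1) unfolding K_def by linarith+
  obtain N where N: "\<And>j k. j \<ge> N \<Longrightarrow> k \<ge> N \<Longrightarrow>
      mnorm P (mdiff P (f j) (f k)) + mnorm P (mdiff P (g k) (g j)) < e / K"
    
    using ex_add_bound[OF mcauchyD[OF f] mcauchyD'[OF g] divide_pos_pos[OF e K(1)]] by blast
  have "dist (mip P (f j) (g j)) (mip P (f k) (g k)) < e" if jk: "j \<ge> N" "k \<ge> N" for j k
  proof -
    \<comment> \<open>Product rule for the difference of two inner products. The second difference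
      appears with its arguments exchanged, whence the minus sign and the use of
      \<open>mcauchyD'\<close>.\<close>
    have eq: "mip P (f j) (g j) - mip P (f k) (g k) =
        mip P (mdiff P (f j) (f k)) (g j) - mip P (f k) (mdiff P (g k) (g j))"
      by (simp add: mip_mdiff mip_mdiff_left fc gc)
    have "dist (mip P (f j) (g j)) (mip P (f k) (g k)) \<le>
        mnorm P (mdiff P (f j) (f k)) * mnorm P (g j) + mnorm P (f k) * mnorm P (mdiff P (g k) (g j))"
      unfolding dist_norm eq
      by (rule order_trans[OF norm_triangle_ineq4]) (intro add_mono Cauchy_Schwarz fc gc mdiff_closed)
    also have "\<dots> \<le> mnorm P (mdiff P (f j) (f k)) * K + K * mnorm P (mdiff P (g k) (g j))"
      using K by (intro add_mono mult_mono) auto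
    also have "\<dots> = K * (mnorm P (mdiff P (f j) (f k)) + mnorm P (mdiff P (g k) (g j)))"
      by (simp add: algebra_simps)
    also have "\<dots> < e" using N[OF jk] K by (simp add: field_simps)
    finally show ?thesis .
  qed
  then show "\<exists>N. \<forall>j\<ge>N. \<forall>k\<ge>N. dist (mip P (f j) (g j)) (mip P (f k) (g k)) < e" by blast
qed

lemma mip_completion:
  assumes f: "represents P f \<phi>" and g: "represents P g \<psi>"
  shows "(\<lambda>k. mip P (f k) (g k)) \<longlonglongrightarrow> mip (completion P) \<phi> \<psi>"
proof -
  note F = represents_mcauchy[OF f] and G = represents_mcauchy[OF g]
  obtain L where L: "(\<lambda>k. mip P (f k) (g k)) \<longlonglongrightarrow> L"
    using mip_seq_convergent[OF F G] by (auto simp: convergent_def)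
  have "(\<lambda>k. \<psi> (f' k)) \<longlonglongrightarrow> L" if f': "represents P f' \<phi>" for f'
  proof -
    \<comment> \<open>The limits along different sequences representing \<open>\<phi>\<close> agree
      because each of them is the limit of \<open>adj (\<phi> (g k))\<close>, which mentions no such
      sequence. This is the uniqueness that the definite description for the inner product
      demands.\<close>
    have "(\<lambda>k. adj (\<phi> (g k))) \<longlonglongrightarrow> L'" if "represents P f' \<phi>" "(\<lambda>k. mip P (f' k) (g k)) \<longlonglongrightarrow> L'"
      for f' L'
    proof -
      note F' = represents_mcauchy[OF that(1)]
      have "(\<lambda>k. adj (\<phi> (g k) - mip P (g k) (f' k)) + mip P (f' k) (g k)) \<longlonglongrightarrow> adj 0 + L'"
        by (intro tendsto_add bounded_linear.tendsto[OF bounded_linear_adj] that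
            represents_diag[OF G])
      then show ?thesis
        by (simp add: adj_diff mip_adj mcauchy_carrier[OF G] mcauchy_carrier[OF F'])
    qed
    moreover obtain L' where L': "(\<lambda>k. mip P (f' k) (g k)) \<longlonglongrightarrow> L'"
      using mip_seq_convergent[OF represents_mcauchy[OF f'] G] by (auto simp: convergent_def)
    ultimately have "L' = L" using f f' L by (blast intro: LIMSEQ_unique)
    moreover have "(\<lambda>k. (\<psi> (f' k) - mip P (f' k) (g k)) + mip P (f' k) (g k)) \<longlonglongrightarrow> 0 + L'"
      by (intro tendsto_add represents_diag L' represents_mcauchy[OF f'] g)
    ultimately show ?thesis by simp
  qed
  then have "mip (completion P) \<phi> \<psi> = L"
    using f unfolding completion_def by simp (blast intro: LIMSEQ_unique)
  then show ?thesis using L by simp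
qed

lemma represents_madd:
  assumes f: "represents P f \<phi>" and g: "represents P g \<psi>"
  shows "represents P (\<lambda>k. madd P (f k) (g k)) (madd (completion P) \<phi> \<psi>)"
proof -
  note F = represents_mcauchy[OF f] and G = represents_mcauchy[OF g]
  have fc: "f k \<in> mcar P" for k by (rule mcauchy_carrier[OF F])
  have gc: "g k \<in> mcar P" for k by (rule mcauchy_carrier[OF G])
  have "mcauchy P (\<lambda>k. madd P (f k) (g k))"
  proof (rule mcauchyI[where C=1 and d="\<lambda>j k. mnorm P (mdiff P (f j) (f k)) +
        mnorm P (mdiff P (g j) (g k))"])
    show "\<exists>N. \<forall>j\<ge>N. \<forall>k\<ge>N. mnorm P (mdiff P (f j) (f k)) + mnorm P (mdiff P (g j) (g k)) < e"
      if "e > 0" for e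
      by (rule ex_add_bound[OF mcauchyD[OF F] mcauchyD[OF G] that])
    have "mnorm P (mdiff P (madd P (f j) (g j)) (madd P (f k) (g k))) \<le>
        mnorm P (mdiff P (f j) (f k)) + mnorm P (mdiff P (g j) (g k))" for j k
      by (rule mnorm_triangle)
        (simp_all add: fc gc madd_closed mdiff_closed mip_mdiff mip_add)
    then show "mnorm P (mdiff P (madd P (f j) (g j)) (madd P (f k) (g k))) \<le>
        1 * (mnorm P (mdiff P (f j) (f k)) + mnorm P (mdiff P (g j) (g k)))" for j k
      by simp
  qed (simp_all add: fc gc madd_closed)
  then show ?thesis
    using f g by (auto simp: represents_def completion_def mip_add fc gc intro!: tendsto_add)
qed

lemma represents_mract:
  assumes f: "represents P f \<phi>"
  shows "represents P (\<lambda>k. mract P (f k) a) (mract (completion P) \<phi> a)"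
proof -
  note F = represents_mcauchy[OF f]
  have fc: "f k \<in> mcar P" for k by (rule mcauchy_carrier[OF F])
  have "mcauchy P (\<lambda>k. mract P (f k) a)"
  proof (rule mcauchyI[where C="norm a", OF _ mcauchyD[OF F]])
    fix j k
    let ?z = "mdiff P (mract P (f j) a) (mract P (f k) a)" and ?w = "mdiff P (f j) (f k)"
    have z: "?z \<in> mcar P" by (simp add: fc mract_closed mdiff_closed)
    have "mip P ?z ?z = mip P ?z ?w * a"
      using z by (simp add: mip_mdiff mip_mract fc mract_closed left_diff_distrib)
    also have "norm \<dots> \<le> mnorm P ?z * mnorm P ?w * norm a"
      by (rule order_trans[OF norm_mult_ineq], intro mult_right_mono Cauchy_Schwarz z mdiff_closed fc) simp
    finally show "mnorm P ?z \<le> norm a * mnorm P ?w"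
      by (intro mnorm_le_of_mip) (simp_all add: mult_ac)
  qed (simp_all add: fc mract_closed)
  then show ?thesis
    using f by (auto simp: represents_def completion_def mip_mract fc intro!: tendsto_mult_right)
qed

lemma represents_canon: "x \<in> mcar P \<Longrightarrow> represents P (\<lambda>_. x) (canon P x)"
  by (auto simp: represents_def mcauchy_def canon_def)

lemma canon_closed: "x \<in> mcar P \<Longrightarrow> canon P x \<in> mcar (completion P)"
  using represents_canon by (force simp: completion_def)

lemma completion_carrier: "\<phi> \<in> mcar (completion P) \<longleftrightarrow> (\<exists>f. represents P f \<phi>)"
  by (simp add: completion_def)

lemma pre_ip_completion: "pre_ip (completion P)"
proof
  fix \<phi> \<psi> \<theta> :: "'e \<Rightarrow> climfun" and a :: climfun and s :: real
  assume "\<phi> \<in> mcar (completion P)"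
  then obtain f where f: "represents P f \<phi>" by (auto simp: completion_carrier)
  have fc: "f k \<in> mcar P" for k by (rule mcauchy_carrier[OF represents_mcauchy[OF f]])
  show "mract (completion P) \<phi> a \<in> mcar (completion P)"
    unfolding completion_carrier using represents_mract[OF f] by blast
  show "0 \<le> Re (cl_app (mip (completion P) \<phi> \<phi>) s)"
    by (rule tendsto_lowerbound[OF tendsto_Re[OF bounded_linear.tendsto[OF bounded_linear_cl_app
        mip_completion[OF f f]]]]) (simp_all add: mip_pos fc)
  assume "\<psi> \<in> mcar (completion P)"
  then obtain g where g: "represents P g \<psi>" by (auto simp: completion_carrier)
  have gc: "g k \<in> mcar P" for k by (rule mcauchy_carrier[OF represents_mcauchy[OF g]])
  show "madd (completion P) \<phi> \<psi> \<in> mcar (completion P)"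
    unfolding completion_carrier using represents_madd[OF f g] by blast
  show "mip (completion P) \<phi> (mract (completion P) \<psi> a) = mip (completion P) \<phi> \<psi> * a"
    using mip_completion[OF f represents_mract[OF g, of a]]
      tendsto_mult_right[OF mip_completion[OF f g], of a]
    by (simp add: mip_mract fc gc LIMSEQ_unique)
  show "adj (mip (completion P) \<phi> \<psi>) = mip (completion P) \<psi> \<phi>"
    using bounded_linear.tendsto[OF bounded_linear_adj mip_completion[OF f g]]
      mip_completion[OF g f] by (simp add: mip_adj fc gc LIMSEQ_unique)
  assume "\<theta> \<in> mcar (completion P)"
  then obtain h where h: "represents P h \<theta>" by (auto simp: completion_carrier)
  have hc: "h k \<in> mcar P" for k by (rule mcauchy_carrier[OF represents_mcauchy[OF h]])
  show "mip (completion P) \<phi> (madd (completion P) \<psi> \<theta>) =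
      mip (completion P) \<phi> \<psi> + mip (completion P) \<phi> \<theta>"
    using mip_completion[OF f represents_madd[OF g h]]
      tendsto_add[OF mip_completion[OF f g] mip_completion[OF f h]]
    by (simp add: mip_add fc gc hc LIMSEQ_unique)
qed

lemma mip_canon_left:
  assumes x: "x \<in> mcar P" and "\<phi> \<in> mcar (completion P)"
  shows "mip (completion P) (canon P x) \<phi> = \<phi> x"
proof -
  obtain g where g: "represents P g \<phi>" using assms by (auto simp: completion_carrier)
  show ?thesis
    using mip_completion[OF represents_canon[OF x] g] represents_lim[OF g x] by (rule LIMSEQ_unique)
qed

lemma mip_canon_canon:
  "x \<in> mcar P \<Longrightarrow> y \<in> mcar P \<Longrightarrow> mip (completion P) (canon P x) (canon P y) = mip P x y"
  by (simp add: mip_canon_left canon_closed) (simp add: canon_def)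

lemma completion_mract_arg:
  assumes x: "x \<in> mcar P" and "\<phi> \<in> mcar (completion P)"
  shows "\<phi> (mract P x a) = adj a * \<phi> x"
proof -
  obtain g where g: "represents P g \<phi>" using assms by (auto simp: completion_carrier)
  have gc: "g k \<in> mcar P" for k by (rule mcauchy_carrier[OF represents_mcauchy[OF g]])
  show ?thesis
    using represents_lim[OF g mract_closed[OF x, of a]]
      tendsto_mult_left[OF represents_lim[OF g x], of "adj a"]
    by (simp add: mip_mract_left x gc LIMSEQ_unique)
qed

lemma canon_madd:
  "x \<in> mcar P \<Longrightarrow> y \<in> mcar P \<Longrightarrow> madd (completion P) (canon P x) (canon P y) = canon P (madd P x y)"
  by (auto simp: canon_def completion_def mip_add)

lemma canon_mract: "x \<in> mcar P \<Longrightarrow> mract (completion P) (canon P x) a = canon P (mract P x a)"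
  by (auto simp: canon_def completion_def mip_mract)

text \<open>The differences form a Cauchy sequence that represents the zero functional; comparing
  that sequence with itself along the diagonal shows that its squared norms tend to 0.\<close>

lemma represents_same_null:
  assumes f: "represents P f \<phi>" and g: "represents P g \<phi>"
  shows "(\<lambda>k. mnorm P (mdiff P (f k) (g k))) \<longlonglongrightarrow> 0"
proof -
  note F = represents_mcauchy[OF f] and G = represents_mcauchy[OF g]
  have fc: "f k \<in> mcar P" for k by (rule mcauchy_carrier[OF F])
  have gc: "g k \<in> mcar P" for k by (rule mcauchy_carrier[OF G])
  let ?h = "\<lambda>k. mdiff P (f k) (g k)"
  have "mcauchy P ?h"
  proof (rule mcauchyI[where C=1, OF _ ex_add_bound[OF mcauchyD[OF F] mcauchyD'[OF G]]])
    have "mnorm P (mdiff P (?h j) (?h k)) \<le>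
        mnorm P (mdiff P (f j) (f k)) + mnorm P (mdiff P (g k) (g j))" for j k
      by (rule mnorm_triangle) (simp_all add: fc gc mdiff_closed mip_mdiff)
    then show "mnorm P (mdiff P (?h j) (?h k)) \<le>
        1 * (mnorm P (mdiff P (f j) (f k)) + mnorm P (mdiff P (g k) (g j)))" for j k
      by simp
  qed (simp_all add: fc gc mdiff_closed)
  moreover have "(\<lambda>k. mip P y (?h k)) \<longlonglongrightarrow> 0" if "y \<in> mcar P" for y
    using tendsto_diff[OF represents_lim[OF f that] represents_lim[OF g that]]
    by (simp add: mip_mdiff fc gc that)
  ultimately have "represents P ?h (\<lambda>_. 0)" by (simp add: represents_def)
  from tendsto_norm_zero[OF represents_diag[OF represents_mcauchy[OF this] this]]
  have "(\<lambda>k. (mnorm P (?h k))\<^sup>2) \<longlonglongrightarrow> 0" by (simp add: mnorm_sq)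
  from tendsto_real_sqrt[OF this] show ?thesis by simp
qed

end

text \<open>The hypothesis \<open>bound\<close> is the product rule h(x,y) - h(x',y') = h(x - x',y)
  + h(x',y - y') together with contractivity of \<open>h\<close>. The description in
  \<open>extend2\<close> ranges over all pairs of representing sequences: the constant pair
  determines the only candidate, and the bound shows that every other pair leads to it.\<close>

lemma extend2_canon:
  assumes "pre_ip P" "pre_ip Q" "pre_ip R"
    and closed: "\<And>x y. x \<in> mcar P \<Longrightarrow> y \<in> mcar Q \<Longrightarrow> h x y \<in> mcar R"
    and bound: "\<And>x x' y y'. x \<in> mcar P \<Longrightarrow> x' \<in> mcar P \<Longrightarrow> y \<in> mcar Q \<Longrightarrow> y' \<in> mcar Q \<Longrightarrow>
      mnorm R (mdiff R (h x y) (h x' y')) \<le>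
        mnorm P (mdiff P x x') * mnorm Q y + mnorm P x' * mnorm Q (mdiff Q y y')"
    and x: "x \<in> mcar P" and y: "y \<in> mcar Q"
  shows "extend2 P Q R h (canon P x) (canon Q y) = canon R (h x y)"
proof -
  interpret P: pre_ip P by fact
  interpret Q: pre_ip Q by fact
  interpret R: pre_ip R by fact
  have hxy: "h x y \<in> mcar R" by (simp add: closed x y)
  have main: "represents R (\<lambda>k. h (f k) (g k)) (canon R (h x y))"
    if f: "represents P f (canon P x)" and g: "represents Q g (canon Q y)" for f g
  proof -
    note F = P.represents_mcauchy[OF f] and G = Q.represents_mcauchy[OF g]
    have fc: "f k \<in> mcar P" for k by (rule P.mcauchy_carrier[OF F])
    have gc: "g k \<in> mcar Q" for k by (rule Q.mcauchy_carrier[OF G])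
    have hc: "h (f k) (g k) \<in> mcar R" for k by (simp add: closed fc gc)
    obtain K1 where K1: "\<And>k. mnorm P (f k) \<le> K1" "K1 \<ge> 0"
      using P.mcauchy_bounded[OF F] by auto
    obtain K2 where K2: "\<And>k. mnorm Q (g k) \<le> K2" "K2 \<ge> 0"
      using Q.mcauchy_bounded[OF G] by auto
    have "mcauchy R (\<lambda>k. h (f k) (g k))"
    proof (rule R.mcauchyI[where C="K1 + K2" and d="\<lambda>j k. mnorm P (mdiff P (f j) (f k)) +
        mnorm Q (mdiff Q (g j) (g k))"])
      show "\<exists>N. \<forall>j\<ge>N. \<forall>k\<ge>N. mnorm P (mdiff P (f j) (f k)) + mnorm Q (mdiff Q (g j) (g k)) < e"
        if "e > 0" for e
        by (rule ex_add_bound[OF P.mcauchyD[OF F] Q.mcauchyD[OF G] that])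
      show "mnorm R (mdiff R (h (f j) (g j)) (h (f k) (g k))) \<le>
          (K1 + K2) * (mnorm P (mdiff P (f j) (f k)) + mnorm Q (mdiff Q (g j) (g k)))" for j k
      proof -
        have "mnorm R (mdiff R (h (f j) (g j)) (h (f k) (g k))) \<le>
            mnorm P (mdiff P (f j) (f k)) * mnorm Q (g j) + mnorm P (f k) * mnorm Q (mdiff Q (g j) (g k))"
          by (rule bound) (simp_all add: fc gc)
        also have "\<dots> \<le> mnorm P (mdiff P (f j) (f k)) * (K1 + K2) + (K1 + K2) * mnorm Q (mdiff Q (g j) (g k))"
          using K1 K2 by (intro add_mono mult_mono) (auto intro: order_trans add_increasing add_increasing2)
        finally show ?thesis by (simp add: algebra_simps)
      qed
    qed (use K1 K2 hc in auto)
    moreover have "(\<lambda>k. mip R z (h (f k) (g k))) \<longlonglongrightarrow> mip R z (h x y)" if z: "z \<in> mcar R" for z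
    proof (rule LIM_zero_cancel, rule Lim_null_comparison)
      let ?b = "\<lambda>k. mnorm R z * (mnorm P (mdiff P (f k) x) * K2 + mnorm P x * mnorm Q (mdiff Q (g k) y))"
      show "\<forall>\<^sub>F k in sequentially. norm (mip R z (h (f k) (g k)) - mip R z (h x y)) \<le> ?b k"
      proof (rule always_eventually, rule allI)
        fix k
        have "norm (mip R z (h (f k) (g k)) - mip R z (h x y)) \<le>
            mnorm R z * mnorm R (mdiff R (h (f k) (g k)) (h x y))"
          using R.Cauchy_Schwarz[OF z, of "mdiff R (h (f k) (g k)) (h x y)"]
          by (simp add: R.mip_mdiff R.mdiff_closed z hc hxy)
        also have "mnorm R (mdiff R (h (f k) (g k)) (h x y)) \<le>
            mnorm P (mdiff P (f k) x) * mnorm Q (g k) + mnorm P x * mnorm Q (mdiff Q (g k) y)"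
          by (rule bound) (simp_all add: fc gc x y)
        also have "\<dots> \<le> mnorm P (mdiff P (f k) x) * K2 + mnorm P x * mnorm Q (mdiff Q (g k) y)"
          using K2 by (intro add_mono mult_left_mono) auto
        finally show "norm (mip R z (h (f k) (g k)) - mip R z (h x y)) \<le> ?b k"
          by (simp add: mult_left_mono)
      qed
      have "?b \<longlonglongrightarrow> mnorm R z * (0 * K2 + mnorm P x * 0)"
        by (intro tendsto_intros P.represents_same_null[OF f P.represents_canon[OF x]]
            Q.represents_same_null[OF g Q.represents_canon[OF y]])
      then show "?b \<longlonglongrightarrow> 0" by simp
    qed
    ultimately show ?thesis by (simp add: represents_def canon_def)
  qed
  show ?thesis
    unfolding extend2_def
  proof (rule the_equality)
    fix \<theta>
    assume "\<forall>f g. represents P f (canon P x) \<longrightarrow> represents Q g (canon Q y) \<longrightarrow>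
        represents R (\<lambda>k. h (f k) (g k)) \<theta>"
    then have "represents R (\<lambda>k. h x y) \<theta>"
      using P.represents_canon[OF x] Q.represents_canon[OF y] by blast
    then show "\<theta> = canon R (h x y)"
      using R.represents_canon[OF hxy] by (rule R.represents_unique)
  qed (use main in blast)
qed

section \<open>Step functions\<close>

abbreviation leb_cube :: "nat \<Rightarrow> (nat \<Rightarrow> real) measure" where
  "leb_cube n \<equiv> PiM {1..n} (\<lambda>_. lborel)"

interpretation lb: product_sigma_finite "\<lambda>_::nat. lborel :: real measure"
  by (rule product_sigma_finite.intro) (rule sigma_finite_lborel)

text \<open>The carrier conditions of \<open>step_pre\<close>, for values in any type with a zero.
  Besides algebra-valued functions this admits their images under scalar functionals, to which
  integration theory applies.\<close>

definition step_fun :: "nat \<Rightarrow> ((nat \<Rightarrow> real) \<Rightarrow> 'a::zero) \<Rightarrow> bool" where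
  "step_fun n g \<longleftrightarrow> finite (range g) \<and> (\<forall>v. {p \<in> space (leb_cube n). g p = v} \<in> sets (leb_cube n)) \<and>
    (\<exists>r. \<forall>p. p \<notin> {1..n} \<rightarrow>\<^sub>E {0..<r} \<longrightarrow> g p = 0)"

lemma step_fun_simple: "step_fun n g \<Longrightarrow> simple_function (leb_cube n) g"
  unfolding step_fun_def simple_function_def
proof (intro conjI ballI)
  assume g: "finite (range g) \<and> (\<forall>v. {p \<in> space (leb_cube n). g p = v} \<in> sets (leb_cube n)) \<and>
    (\<exists>r. \<forall>p. p \<notin> {1..n} \<rightarrow>\<^sub>E {0..<r} \<longrightarrow> g p = 0)"
  then show "finite (g ` space (leb_cube n))"
    by (meson finite_subset image_mono subset_UNIV)
  fix x
  have "g -` {x} \<inter> space (leb_cube n) = {p \<in> space (leb_cube n). g p = x}" by auto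
  then show "g -` {x} \<inter> space (leb_cube n) \<in> sets (leb_cube n)" using g by simp
qed

lemma emeasure_box: "emeasure (leb_cube n) ({1..n} \<rightarrow>\<^sub>E {0..<r}) < \<infinity>"
proof -
  have "emeasure lborel {0..<r} < \<infinity>" by (cases "0 \<le> r") (simp_all add: less_top)
  then show ?thesis by (subst lb.emeasure_PiM) (auto simp: less_top[symmetric] power_eq_top_ennreal)
qed

lemma box_sets: "({1..n} \<rightarrow>\<^sub>E {0..<r}) \<in> sets (leb_cube n)"
  by (rule sets_PiM_I_finite) auto

lemma step_fun_simple_integrable:
  assumes g: "step_fun n g"
  shows "Bochner_Integration.simple_bochner_integrable (leb_cube n) g"
proof
  show "simple_function (leb_cube n) g" by (rule step_fun_simple[OF g])
  obtain r where r: "\<And>p. p \<notin> {1..n} \<rightarrow>\<^sub>E {0..<r} \<Longrightarrow> g p = 0"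
    using g unfolding step_fun_def by blast
  have "emeasure (leb_cube n) {y \<in> space (leb_cube n). g y \<noteq> 0} \<le> emeasure (leb_cube n) ({1..n} \<rightarrow>\<^sub>E {0..<r})"
    by (rule emeasure_mono) (use r box_sets in blast)+
  then show "emeasure (leb_cube n) {y \<in> space (leb_cube n). g y \<noteq> 0} \<noteq> \<infinity>"
    using emeasure_box[of n r] by (auto simp: top_unique)
qed

lemma step_fun_sets:
  assumes "step_fun n g"
  shows "{p \<in> space (leb_cube n). Q (g p)} \<in> sets (leb_cube n)"
proof -
  have "{p \<in> space (leb_cube n). Q (g p)} = (\<Union>v\<in>range g \<inter> {v. Q v}. {p \<in> space (leb_cube n). g p = v})"
    by auto
  also have "\<dots> \<in> sets (leb_cube n)"
    using assms unfolding step_fun_def by (intro sets.finite_UN) auto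
  finally show ?thesis .
qed

text \<open>Level sets of the composite are finite unions of intersections of level sets, so
  \<open>h\<close> may be any function with h 0 0 = 0; this last condition keeps the support
  bounded.\<close>

lemma step_fun_comp2:
  assumes f: "step_fun n f" and g: "step_fun n g" and h: "h 0 0 = 0"
  shows "step_fun n (\<lambda>p. h (f p) (g p))"
  unfolding step_fun_def
proof (intro conjI allI)
  have "range (\<lambda>p. h (f p) (g p)) \<subseteq> (\<lambda>(x, y). h x y) ` (range f \<times> range g)" by auto
  then show "finite (range (\<lambda>p. h (f p) (g p)))"
    using f g unfolding step_fun_def by (meson finite_SigmaI finite_imageI finite_subset)
  fix v
  have "{p \<in> space (leb_cube n). h (f p) (g p) = v} =
      (\<Union>w\<in>range f. {p \<in> space (leb_cube n). f p = w} \<inter> {p \<in> space (leb_cube n). h w (g p) = v})"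
    by auto
  also have "\<dots> \<in> sets (leb_cube n)"
    using f step_fun_sets[OF g] unfolding step_fun_def by (intro sets.finite_UN sets.Int) auto
  finally show "{p \<in> space (leb_cube n). h (f p) (g p) = v} \<in> sets (leb_cube n)" .
next
  obtain r r' where "\<And>p. p \<notin> {1..n} \<rightarrow>\<^sub>E {0..<r} \<Longrightarrow> f p = 0"
    "\<And>p. p \<notin> {1..n} \<rightarrow>\<^sub>E {0..<r'} \<Longrightarrow> g p = 0"
    using f g unfolding step_fun_def by blast
  moreover have "({1..n} \<rightarrow>\<^sub>E {0..<r}) \<subseteq> ({1..n} \<rightarrow>\<^sub>E {0..<max r r'})"
    "({1..n} \<rightarrow>\<^sub>E {0..<r'}) \<subseteq> ({1..n} \<rightarrow>\<^sub>E {0..<max r r'})"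
    by (rule PiE_mono; auto)+
  ultimately have "h (f p) (g p) = 0" if "p \<notin> {1..n} \<rightarrow>\<^sub>E {0..<max r r'}" for p
    using that h by (metis subsetD)
  then show "\<exists>r. \<forall>p. p \<notin> {1..n} \<rightarrow>\<^sub>E {0..<r} \<longrightarrow> h (f p) (g p) = 0" by blast
qed

lemma step_fun_comp: "step_fun n f \<Longrightarrow> h 0 = 0 \<Longrightarrow> step_fun n (\<lambda>p. h (f p))"
  using step_fun_comp2[of n f f "\<lambda>x _. h x"] by simp

lemma step_fun_restrict:
  assumes f: "step_fun n f" and D: "D \<inter> space (leb_cube n) \<in> sets (leb_cube n)"
  shows "step_fun n (\<lambda>p. if p \<in> D then f p else 0)"
  unfolding step_fun_def
proof (intro conjI allI)
  have "range (\<lambda>p. if p \<in> D then f p else 0) \<subseteq> insert 0 (range f)" by auto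
  then show "finite (range (\<lambda>p. if p \<in> D then f p else 0))"
    using f unfolding step_fun_def by (meson finite_insert finite_subset)
  fix v
  have "{p \<in> space (leb_cube n). (if p \<in> D then f p else 0) = v} =
      (D \<inter> space (leb_cube n) \<inter> {p \<in> space (leb_cube n). f p = v}) \<union>
      (if v = 0 then space (leb_cube n) - D \<inter> space (leb_cube n) else {})"
    by auto
  also have "\<dots> \<in> sets (leb_cube n)"
    using f D unfolding step_fun_def by auto
  finally show "{p \<in> space (leb_cube n). (if p \<in> D then f p else 0) = v} \<in> sets (leb_cube n)" .
next
  show "\<exists>r. \<forall>p. p \<notin> {1..n} \<rightarrow>\<^sub>E {0..<r} \<longrightarrow> (if p \<in> D then f p else 0) = 0"
    using f unfolding step_fun_def by metis
qed

lemma step_fun_const: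
  assumes D: "D \<in> sets (leb_cube n)" and r: "D \<subseteq> {1..n} \<rightarrow>\<^sub>E {0..<r}"
  shows "step_fun n (\<lambda>p. if p \<in> D then c else 0)"
  unfolding step_fun_def
proof (intro conjI allI)
  have "range (\<lambda>p. if p \<in> D then c else 0) \<subseteq> {0, c}" by auto
  then show "finite (range (\<lambda>p. if p \<in> D then c else 0))"
    by (meson finite.emptyI finite_insert finite_subset)
  fix v
  have "{p \<in> space (leb_cube n). (if p \<in> D then c else 0) = v} =
      (if v = c then D else {}) \<union> (if v = 0 then space (leb_cube n) - D else {})"
    using sets.sets_into_space[OF D] by auto
  also have "\<dots> \<in> sets (leb_cube n)" using D by auto
  finally show "{p \<in> space (leb_cube n). (if p \<in> D then c else 0) = v} \<in> sets (leb_cube n)" .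
next
  show "\<exists>r. \<forall>p. p \<notin> {1..n} \<rightarrow>\<^sub>E {0..<r} \<longrightarrow> (if p \<in> D then c else 0) = 0"
    using r by (intro exI[of _ r]) auto
qed

definition step_ip :: "nat \<Rightarrow> ((nat \<Rightarrow> real) \<Rightarrow> climfun) \<Rightarrow> ((nat \<Rightarrow> real) \<Rightarrow> climfun) \<Rightarrow> climfun" where
  "step_ip n f g = Bochner_Integration.simple_bochner_integral (leb_cube n) (\<lambda>p. adj (f p) * g p)"

lemma step_fun_adj_mult: "step_fun n f \<Longrightarrow> step_fun n g \<Longrightarrow> step_fun n (\<lambda>p. adj (f p) * g p :: climfun)"
  by (rule step_fun_comp2[where h="\<lambda>x y. adj x * y"]) simp_all

text \<open>The algebra-valued integral is a finite sum. A bounded linear functional carries it to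
  an ordinary Bochner integral, for which monotonicity and Tonelli's theorem are at hand; the
  functionals used are point evaluations, their real parts, and \<open>cl_inf\<close>.\<close>

lemma step_ip_linear:
  assumes T: "bounded_linear (T :: climfun \<Rightarrow> 'c::{banach, second_countable_topology})"
    and f: "step_fun n f" and g: "step_fun n g"
  shows "T (step_ip n f g) = integral\<^sup>L (leb_cube n) (\<lambda>p. T (adj (f p) * g p))"
    and "integrable (leb_cube n) (\<lambda>p. T (adj (f p) * g p))"
proof -
  have i: "Bochner_Integration.simple_bochner_integrable (leb_cube n) (\<lambda>p. adj (f p) * g p)"
    by (rule step_fun_simple_integrable[OF step_fun_adj_mult[OF f g]])
  have T0: "T 0 = 0" using T by (simp add: linear_0 bounded_linear.linear)
  have "step_fun n (\<lambda>p. T (adj (f p) * g p))"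
    by (rule step_fun_comp[where h=T, OF step_fun_adj_mult[OF f g] T0])
  then have i': "Bochner_Integration.simple_bochner_integrable (leb_cube n) (\<lambda>p. T (adj (f p) * g p))"
    by (rule step_fun_simple_integrable)
  show "T (step_ip n f g) = integral\<^sup>L (leb_cube n) (\<lambda>p. T (adj (f p) * g p))"
    unfolding step_ip_def
    by (subst simple_bochner_integral_linear[OF bounded_linear.linear[OF T] i, symmetric])
      (rule simple_bochner_integrable_eq_integral[OF i'])
  show "integrable (leb_cube n) (\<lambda>p. T (adj (f p) * g p))"
    using has_bochner_integral_simple_bochner_integrable[OF i'] by (rule integrable.intros)
qed

lemma step_ip_zero_right: "step_ip n f (\<lambda>_. 0) = 0"
  by (simp add: step_ip_def Bochner_Integration.simple_bochner_integral_def image_constant_conv)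

lemma step_ip_adj:
  assumes f: "step_fun n f" and g: "step_fun n g"
  shows "adj (step_ip n f g) = step_ip n g f"
  unfolding step_ip_def
  by (subst simple_bochner_integral_linear[OF bounded_linear.linear[OF bounded_linear_adj]
        step_fun_simple_integrable[OF step_fun_adj_mult[OF f g]], symmetric])
    (simp add: adj_mult adj_adj)

lemma step_ip_add:
  assumes "step_fun n f" "step_fun n g" "step_fun n h"
  shows "step_ip n f (\<lambda>p. g p + h p) = step_ip n f g + step_ip n f h"
  unfolding step_ip_def
  using simple_bochner_integral_add[OF step_fun_simple_integrable[OF step_fun_adj_mult[OF assms(1,2)]]
      step_fun_simple_integrable[OF step_fun_adj_mult[OF assms(1,3)]]]
  by (simp add: distrib_left)

lemma step_ip_mult:
  assumes "step_fun n f" "step_fun n g"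
  shows "step_ip n f (\<lambda>p. g p * a) = step_ip n f g * a"
  unfolding step_ip_def
  using simple_bochner_integral_linear[OF bounded_linear.linear[OF bounded_linear_mult_left[of a]]
      step_fun_simple_integrable[OF step_fun_adj_mult[OF assms]]]
  by (simp add: mult.assoc)

text \<open>At a fixed point s the inner product of a step function with itself is a scalar squared
  L2 norm. Norm estimates for step functions are made there and then taken uniformly in s.\<close>

lemma Re_step_ip_self:
  assumes f: "step_fun n f"
  shows "Re (cl_app (step_ip n f f) s) = (\<integral>p. (cmod (cl_app (f p) s))\<^sup>2 \<partial>leb_cube n)"
    and "integrable (leb_cube n) (\<lambda>p. (cmod (cl_app (f p) s))\<^sup>2)"
proof -
  have T: "bounded_linear (\<lambda>f. Re (cl_app f s))"
    by (rule bounded_linear_compose[OF bounded_linear_Re bounded_linear_cl_app])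
  have eq: "Re (cl_app (adj x * x) s) = (cmod (cl_app x s))\<^sup>2" for x
    unfolding cmod_power2 by (simp add: cl_rep power2_eq_square)
  show "Re (cl_app (step_ip n f f) s) = (\<integral>p. (cmod (cl_app (f p) s))\<^sup>2 \<partial>leb_cube n)"
    "integrable (leb_cube n) (\<lambda>p. (cmod (cl_app (f p) s))\<^sup>2)"
    using step_ip_linear[OF T f f] by (simp_all only: eq)
qed

text \<open>A tensor power which, as a right module, is the algebra itself: the evaluation \<open>ev\<close>
  identifies it with the algebra, and the left action becomes multiplication with \<open>\<sigma> a\<close>.\<close>

locale scalar_power =
  fixes F :: "(climfun, 'f) corr" and n :: nat and ev :: "('f list \<Rightarrow>\<^sub>0 climfun) \<Rightarrow> climfun"
    and \<sigma> :: "climfun \<Rightarrow> climfun"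
  assumes pre_madd_closed: "x \<in> mcar (tensor_pre F n) \<Longrightarrow> y \<in> mcar (tensor_pre F n) \<Longrightarrow>
      madd (tensor_pre F n) x y \<in> mcar (tensor_pre F n)"
    and pre_mract_closed: "x \<in> mcar (tensor_pre F n) \<Longrightarrow> mract (tensor_pre F n) x a \<in> mcar (tensor_pre F n)"
    and pre_mlact_closed: "x \<in> mcar (tensor_pre F n) \<Longrightarrow> mlact (tensor_pre F n) a x \<in> mcar (tensor_pre F n)"
    and ev_madd: "x \<in> mcar (tensor_pre F n) \<Longrightarrow> y \<in> mcar (tensor_pre F n) \<Longrightarrow>
      ev (madd (tensor_pre F n) x y) = ev x + ev y"
    and ev_mract: "x \<in> mcar (tensor_pre F n) \<Longrightarrow> ev (mract (tensor_pre F n) x a) = ev x * a"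
    and ev_mlact: "x \<in> mcar (tensor_pre F n) \<Longrightarrow> ev (mlact (tensor_pre F n) a x) = \<sigma> a * ev x"
    and mip_ev: "x \<in> mcar (tensor_pre F n) \<Longrightarrow> y \<in> mcar (tensor_pre F n) \<Longrightarrow>
      mip (tensor_pre F n) x y = adj (ev x) * ev y"
    and ex_ev_one: "\<exists>x\<in>mcar (tensor_pre F n). ev x = 1"
    and adj_sigma: "adj (\<sigma> a) = \<sigma> (adj a)"
begin

text \<open>The element of the tensor power that corresponds to \<open>b\<close> under
  \<open>ev\<close>, written as the functional "inner product with it".\<close>

definition tp :: "climfun \<Rightarrow> ('f list \<Rightarrow>\<^sub>0 climfun) \<Rightarrow> climfun" where
  "tp b = (\<lambda>x. if x \<in> mcar (tensor_pre F n) then adj (ev x) * b else 0)"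

lemma pre_ip_tensor_pre: "pre_ip (tensor_pre F n)"
proof
  show "0 \<le> Re (cl_app (mip (tensor_pre F n) x x) s)" if "x \<in> mcar (tensor_pre F n)" for x s
    using that by (simp add: mip_ev cl_rep)
qed (simp_all add: pre_madd_closed pre_mract_closed ev_madd ev_mract mip_ev distrib_left mult.assoc
    adj_mult adj_adj)

lemma canon_tp: "x \<in> mcar (tensor_pre F n) \<Longrightarrow> canon (tensor_pre F n) x = tp (ev x)"
  by (auto simp: canon_def tp_def mip_ev)

lemma ex_ev: "\<exists>x\<in>mcar (tensor_pre F n). ev x = b"
  using ex_ev_one by (metis ev_mract mult_1 pre_mract_closed)

lemma tp_eq_iff [simp]: "tp b = tp c \<longleftrightarrow> b = c"
  using ex_ev_one unfolding tp_def by (metis adj_one mult_1)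

text \<open>Pairing a representing sequence with a vector of value 1 shows that its values under
  \<open>ev\<close> converge, and their limit determines the functional. Conversely every
  \<open>b\<close> is already the value of a vector before completion.\<close>

lemma mcar_tensor_power: "mcar (tensor_power F n) = range tp"
proof safe
  interpret pre_ip "tensor_pre F n" by (rule pre_ip_tensor_pre)
  fix \<phi> assume "\<phi> \<in> mcar (tensor_power F n)"
  then obtain f where f: "represents (tensor_pre F n) f \<phi>"
    by (auto simp: tensor_power_def completion_carrier)
  have fc: "f k \<in> mcar (tensor_pre F n)" for k by (rule mcauchy_carrier[OF represents_mcauchy[OF f]])
  obtain e where e: "e \<in> mcar (tensor_pre F n)" "ev e = 1" using ex_ev_one by blast
  have ef: "(\<lambda>k. ev (f k)) \<longlonglongrightarrow> \<phi> e"
    using represents_lim[OF f e(1)] e fc by (simp add: mip_ev)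
  have "\<phi> x = adj (ev x) * \<phi> e" if "x \<in> mcar (tensor_pre F n)" for x
    using represents_lim[OF f that] tendsto_mult_left[OF ef, of "adj (ev x)"]
    by (simp add: mip_ev fc that LIMSEQ_unique)
  then have "\<phi> = tp (\<phi> e)"
    using f by (auto simp: tp_def represents_def)
  then show "\<phi> \<in> range tp" by blast
next
  interpret pre_ip "tensor_pre F n" by (rule pre_ip_tensor_pre)
  fix b
  obtain x where "x \<in> mcar (tensor_pre F n)" "ev x = b" using ex_ev by blast
  then show "tp b \<in> mcar (tensor_power F n)"
    unfolding tensor_power_def using canon_closed[of x] canon_tp[of x] by simp
qed

lemma mzero_tp: "mzero (tensor_power F n) = tp 0"
  by (auto simp: tensor_power_def completion_def tp_def)

lemma madd_tp: "madd (tensor_power F n) (tp b) (tp c) = tp (b + c)"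
  by (auto simp: tensor_power_def completion_def tp_def distrib_left)

lemma mract_tp: "mract (tensor_power F n) (tp b) a = tp (b * a)"
  by (auto simp: tensor_power_def completion_def tp_def mult.assoc)

lemma mlact_tp: "mlact (tensor_power F n) a (tp b) = tp (\<sigma> a * b)"
  by (auto simp: tensor_power_def completion_def tp_def ev_mlact pre_mlact_closed adj_mult
      adj_sigma adj_adj mult.assoc mult.commute mult.left_commute)

lemma mip_tp: "mip (tensor_power F n) (tp b) (tp c) = adj b * c"
proof -
  interpret pre_ip "tensor_pre F n" by (rule pre_ip_tensor_pre)
  obtain x y where "x \<in> mcar (tensor_pre F n)" "ev x = b" "y \<in> mcar (tensor_pre F n)" "ev y = c"
    using ex_ev by metis
  then show ?thesis
    using mip_canon_canon[of x y] canon_tp[of x] canon_tp[of y]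
    by (simp add: tensor_power_def mip_ev)
qed

lemma ev_mdiff: "x \<in> mcar (tensor_pre F n) \<Longrightarrow> y \<in> mcar (tensor_pre F n) \<Longrightarrow>
    ev (mdiff (tensor_pre F n) x y) = ev x - ev y"
  by (simp add: mdiff_def mscale_def ev_madd ev_mract pre_mract_closed)

lemma mnorm_tensor_pre: "x \<in> mcar (tensor_pre F n) \<Longrightarrow> mnorm (tensor_pre F n) x = norm (ev x)"
  by (simp add: mnorm_def mip_ev cstar_identity)

lemma mcar_step_pre: "f \<in> mcar (step_pre F n) \<longleftrightarrow> (\<exists>g. step_fun n g \<and> f = (\<lambda>p. tp (g p)))"
proof
  assume "f \<in> mcar (step_pre F n)"
  then have f: "finite (range f)" "range f \<subseteq> range tp"
    "\<And>v. {p \<in> space (leb_cube n). f p = v} \<in> sets (leb_cube n)"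
    "\<exists>r. \<forall>p. p \<notin> {1..n} \<rightarrow>\<^sub>E {0..<r} \<longrightarrow> f p = tp 0"
    by (auto simp: step_pre_def Let_def mcar_tensor_power mzero_tp)
  define g where "g p = the_inv tp (f p)" for p
  have inj: "inj tp" by (simp add: inj_def)
  have fg: "f p = tp (g p)" for p
    unfolding g_def using f(2) by (metis f_the_inv_into_f inj rangeI subsetD)
  have "range g = the_inv tp ` range f" by (auto simp: g_def)
  then have "finite (range g)" using f(1) by simp
  moreover have "{p \<in> space (leb_cube n). g p = v} \<in> sets (leb_cube n)" for v
    using f(3)[of "tp v"] by (simp add: fg)
  moreover have "\<exists>r. \<forall>p. p \<notin> {1..n} \<rightarrow>\<^sub>E {0..<r} \<longrightarrow> g p = 0"
    using f(4) by (simp add: fg)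
  ultimately have "step_fun n g" by (simp add: step_fun_def)
  then show "\<exists>g. step_fun n g \<and> f = (\<lambda>p. tp (g p))" using fg by blast
next
  assume "\<exists>g. step_fun n g \<and> f = (\<lambda>p. tp (g p))"
  then obtain g where g: "step_fun n g" and f: "f = (\<lambda>p. tp (g p))" by blast
  have "range f = tp ` range g" by (auto simp: f)
  then have "finite (range f)" using g by (simp add: step_fun_def)
  moreover have "{p \<in> space (leb_cube n). f p = v} \<in> sets (leb_cube n)" for v
    using step_fun_sets[OF g, of "\<lambda>b. tp b = v"] by (simp add: f)
  moreover have "\<exists>r. \<forall>p. p \<notin> {1..n} \<rightarrow>\<^sub>E {0..<r} \<longrightarrow> f p = tp 0"
    using g by (simp add: f step_fun_def)
  ultimately show "f \<in> mcar (step_pre F n)"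
    by (auto simp: step_pre_def Let_def mcar_tensor_power mzero_tp f)
qed

lemma step_mem [intro]: "step_fun n g \<Longrightarrow> (\<lambda>p. tp (g p)) \<in> mcar (step_pre F n)"
  by (auto simp: mcar_step_pre)

lemma step_madd: "madd (step_pre F n) (\<lambda>p. tp (f p)) (\<lambda>p. tp (g p)) = (\<lambda>p. tp (f p + g p))"
  by (simp add: step_pre_def Let_def madd_tp)

lemma step_mract: "mract (step_pre F n) (\<lambda>p. tp (f p)) a = (\<lambda>p. tp (f p * a))"
  by (simp add: step_pre_def Let_def mract_tp)

lemma step_mlact: "mlact (step_pre F n) a (\<lambda>p. tp (f p)) = (\<lambda>p. tp (\<sigma> a * f p))"
  by (simp add: step_pre_def Let_def mlact_tp)

lemma step_mip: "mip (step_pre F n) (\<lambda>p. tp (f p)) (\<lambda>p. tp (g p)) = step_ip n f g"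
  by (simp add: step_pre_def Let_def mip_tp step_ip_def)

lemma step_mdiff: "mdiff (step_pre F n) (\<lambda>p. tp (f p)) (\<lambda>p. tp (g p)) = (\<lambda>p. tp (f p - g p))"
  by (simp add: mdiff_def mscale_def step_madd step_mract)

lemma step_fun_plus: "step_fun n f \<Longrightarrow> step_fun n g \<Longrightarrow> step_fun n (\<lambda>p. f p + g p :: climfun)"
  by (rule step_fun_comp2[where h="(+)"]) simp_all

lemma step_fun_rmult: "step_fun n f \<Longrightarrow> step_fun n (\<lambda>p. f p * a :: climfun)"
  by (rule step_fun_comp[where h="\<lambda>x. x * a"]) simp_all

lemma step_fun_lmult: "step_fun n f \<Longrightarrow> step_fun n (\<lambda>p. a * f p :: climfun)"
  by (rule step_fun_comp[where h="\<lambda>x. a * x"]) simp_all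

lemma pre_ip_step_pre: "pre_ip (step_pre F n)"
proof
  fix x y z a and s :: real
  assume "x \<in> mcar (step_pre F n)"
  then obtain f where f: "step_fun n f" "x = (\<lambda>p. tp (f p))" by (auto simp: mcar_step_pre)
  show "mract (step_pre F n) x a \<in> mcar (step_pre F n)"
    using step_fun_rmult[OF f(1)] by (auto simp: f step_mract)
  show "0 \<le> Re (cl_app (mip (step_pre F n) x x) s)"
    using f by (simp add: step_mip Re_step_ip_self)
  assume "y \<in> mcar (step_pre F n)"
  then obtain g where g: "step_fun n g" "y = (\<lambda>p. tp (g p))" by (auto simp: mcar_step_pre)
  show "madd (step_pre F n) x y \<in> mcar (step_pre F n)"
    using step_fun_plus[OF f(1) g(1)] by (auto simp: f g step_madd)
  show "mip (step_pre F n) x (mract (step_pre F n) y a) = mip (step_pre F n) x y * a"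
    using f g by (simp add: step_mip step_mract step_ip_mult)
  show "adj (mip (step_pre F n) x y) = mip (step_pre F n) y x"
    using f g by (simp add: step_mip step_ip_adj)
  assume "z \<in> mcar (step_pre F n)"
  then obtain h where h: "step_fun n h" "z = (\<lambda>p. tp (h p))" by (auto simp: mcar_step_pre)
  show "mip (step_pre F n) x (madd (step_pre F n) y z) = mip (step_pre F n) x y + mip (step_pre F n) x z"
    using f g h by (simp add: step_mip step_madd step_ip_add)
qed

lemma mnorm_step_add:
  assumes f: "step_fun n f" and g: "step_fun n g"
  shows "mnorm (step_pre F n) (\<lambda>p. tp (f p + g p)) \<le>
    mnorm (step_pre F n) (\<lambda>p. tp (f p)) + mnorm (step_pre F n) (\<lambda>p. tp (g p))"
  by (rule pre_ip.mnorm_triangle[OF pre_ip_step_pre])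
    (simp_all add: step_mem step_mip step_ip_add step_fun_plus f g)

lemma pre_ip_sector: "pre_ip (sector F n)"
  unfolding sector_def by (rule pre_ip.pre_ip_completion[OF pre_ip_step_pre])

abbreviation stp :: "((nat \<Rightarrow> real) \<Rightarrow> climfun) \<Rightarrow> (climfun, 'f) particles" where
  "stp g \<equiv> canon (step_pre F n) (\<lambda>p. tp (g p))"

lemma stp_mem: "step_fun n g \<Longrightarrow> stp g \<in> mcar (sector F n)"
  unfolding sector_def by (intro pre_ip.canon_closed pre_ip_step_pre step_mem)

lemma stp_apply: "step_fun n f \<Longrightarrow> stp g (\<lambda>p. tp (f p)) = step_ip n f g"
  by (simp add: canon_def step_mem step_mip)

lemma sector_eqI:
  fixes \<phi> \<psi> :: "(climfun, 'f) particles"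
  assumes "\<And>x. x \<notin> mcar (step_pre F n) \<Longrightarrow> \<phi> x = 0" "\<And>x. x \<notin> mcar (step_pre F n) \<Longrightarrow> \<psi> x = 0"
    and "\<And>f. step_fun n f \<Longrightarrow> \<phi> (\<lambda>p. tp (f p)) = \<psi> (\<lambda>p. tp (f p))"
  shows "\<phi> = \<psi>"
proof (rule ext)
  show "\<phi> x = \<psi> x" for x
    using assms by (cases "x \<in> mcar (step_pre F n)") (auto simp: mcar_step_pre)
qed

lemma stp_eqI: "(\<And>p. f p = g p) \<Longrightarrow> stp f = stp g"
  by presburger

lemma mzero_stp: "mzero (sector F n) = stp (\<lambda>_. 0)"
  by (rule sector_eqI)
    (simp_all add: canon_def sector_def completion_def step_mem step_mip step_ip_zero_right)

lemma madd_stp: "step_fun n f \<Longrightarrow> step_fun n g \<Longrightarrow> madd (sector F n) (stp f) (stp g) = stp (\<lambda>p. f p + g p)"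
  unfolding sector_def by (simp add: pre_ip.canon_madd[OF pre_ip_step_pre] step_mem step_madd)

lemma mract_stp: "step_fun n f \<Longrightarrow> mract (sector F n) (stp f) a = stp (\<lambda>p. f p * a)"
  unfolding sector_def by (simp add: pre_ip.canon_mract[OF pre_ip_step_pre] step_mem step_mract)

lemma mlact_sector_apply:
  "step_fun n f \<Longrightarrow> mlact (sector F n) a \<phi> (\<lambda>p. tp (f p)) = \<phi> (\<lambda>p. tp (\<sigma> (adj a) * f p))"
  by (simp add: sector_def completion_def step_mem step_mlact)

lemma mlact_stp:
  assumes f: "step_fun n f"
  shows "mlact (sector F n) a (stp f) = stp (\<lambda>p. \<sigma> a * f p)"
proof (rule sector_eqI)
  fix g :: "(nat \<Rightarrow> real) \<Rightarrow> climfun" assume g: "step_fun n g"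
  then show "mlact (sector F n) a (stp f) (\<lambda>p. tp (g p)) = stp (\<lambda>p. \<sigma> a * f p) (\<lambda>p. tp (g p))"
    by (simp add: mlact_sector_apply stp_apply step_fun_lmult step_ip_def adj_mult adj_adj mult.assoc
        adj_sigma mult.left_commute)
qed (simp_all add: canon_def sector_def completion_def)

lemma mip_stp_left:
  "step_fun n f \<Longrightarrow> \<phi> \<in> mcar (sector F n) \<Longrightarrow> mip (sector F n) (stp f) \<phi> = \<phi> (\<lambda>p. tp (f p))"
  unfolding sector_def by (rule pre_ip.mip_canon_left[OF pre_ip_step_pre]) auto

lemma mip_stp: "step_fun n f \<Longrightarrow> step_fun n g \<Longrightarrow> mip (sector F n) (stp f) (stp g) = step_ip n f g"
  by (simp add: mip_stp_left stp_mem stp_apply)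

lemma sector_apply_mult:
  assumes f: "step_fun n f" and "\<phi> \<in> mcar (sector F n)"
  shows "\<phi> (\<lambda>p. tp (f p * a)) = adj a * \<phi> (\<lambda>p. tp (f p))"
  using pre_ip.completion_mract_arg[OF pre_ip_step_pre step_mem[OF f], of \<phi> a] assms
  by (simp add: sector_def step_mract)

lemma mult_ind_stp:
  assumes f: "step_fun n f" and D: "D \<inter> space (leb_cube n) \<in> sets (leb_cube n)"
  shows "mult_ind F n D (stp f) = stp (\<lambda>p. if p \<in> D then f p else 0)"
proof (rule sector_eqI)
  fix g :: "(nat \<Rightarrow> real) \<Rightarrow> climfun" assume g: "step_fun n g"
  have "(\<lambda>p. if p \<in> D then tp (g p) else mzero (tensor_power F n)) = (\<lambda>p. tp (if p \<in> D then g p else 0))"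
    by (auto simp: mzero_tp)
  then have "mult_ind F n D (stp f) (\<lambda>p. tp (g p)) = step_ip n (\<lambda>p. if p \<in> D then g p else 0) f"
    by (simp add: mult_ind_def step_mem[OF g] stp_apply[OF step_fun_restrict[OF g D]])
  also have "\<dots> = step_ip n g (\<lambda>p. if p \<in> D then f p else 0)"
    unfolding step_ip_def by (rule arg_cong[where f="Bochner_Integration.simple_bochner_integral (leb_cube n)"]) auto
  finally show "mult_ind F n D (stp f) (\<lambda>p. tp (g p)) = stp (\<lambda>p. if p \<in> D then f p else 0) (\<lambda>p. tp (g p))"
    by (simp add: stp_apply g)
qed (simp_all add: canon_def mult_ind_def)

lemma const_on_stp:
  assumes "Poly_Mapping.single w c \<in> mcar (tensor_pre F n)"
  shows "const_on F n D w c = stp (\<lambda>p. if p \<in> D then ev (Poly_Mapping.single w c) else 0)"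
  unfolding const_on_def canon_tp[OF assms] mzero_tp
  by (rule arg_cong[where f="canon (step_pre F n)"]) auto

end

section \<open>Tensor powers of the shift correspondence\<close>

text \<open>In the tensor product, x \<odot> y = 1 \<odot> xy, and here x acts on y by
  multiplication with its shift by 1. Pulling x rightwards through all the remaining factors
  therefore shifts it once for each of them, and the word collapses to a single function.\<close>

fun eval_word :: "climfun list \<Rightarrow> climfun" where
  "eval_word [] = 1"
| "eval_word (x # w) = cl_shift (real (length w)) x * eval_word w"

definition eval_tensor :: "(climfun list \<Rightarrow>\<^sub>0 climfun) \<Rightarrow> climfun" where
  "eval_tensor f = (\<Sum>w\<in>Poly_Mapping.keys f. eval_word w * Poly_Mapping.lookup f w)"

lemma eval_tensor_superset:
  "finite A \<Longrightarrow> Poly_Mapping.keys f \<subseteq> A \<Longrightarrow> eval_tensor f = (\<Sum>w\<in>A. eval_word w * Poly_Mapping.lookup f w)"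
  unfolding eval_tensor_def by (rule sum.mono_neutral_left) (auto simp: in_keys_iff)

lemma eval_tensor_add: "eval_tensor (f + g) = eval_tensor f + eval_tensor g"
proof -
  let ?A = "Poly_Mapping.keys f \<union> Poly_Mapping.keys g"
  have "eval_tensor (f + g) = (\<Sum>w\<in>?A. eval_word w * Poly_Mapping.lookup (f + g) w)"
    by (rule eval_tensor_superset) (simp_all add: keys_add)
  also have "\<dots> = (\<Sum>w\<in>?A. eval_word w * Poly_Mapping.lookup f w) + (\<Sum>w\<in>?A. eval_word w * Poly_Mapping.lookup g w)"
    by (simp add: lookup_add distrib_left sum.distrib)
  also have "\<dots> = eval_tensor f + eval_tensor g"
    by (simp add: eval_tensor_superset[symmetric])
  finally show ?thesis .
qed

lemma eval_tensor_0 [simp]: "eval_tensor 0 = 0"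
  by (simp add: eval_tensor_def)

lemma eval_tensor_sum: "eval_tensor (sum h A) = (\<Sum>a\<in>A. eval_tensor (h a))"
  by (induction A rule: infinite_finite_induct) (simp_all add: eval_tensor_add)

lemma eval_tensor_single [simp]: "eval_tensor (Poly_Mapping.single w c) = eval_word w * c"
  by (subst eval_tensor_superset[of "{w}"]) (simp_all add: lookup_single)

lemma lookup_map: "g 0 = 0 \<Longrightarrow> Poly_Mapping.lookup (Poly_Mapping.map g f) k = g (Poly_Mapping.lookup f k)"
  by (simp add: Poly_Mapping.map.rep_eq when_def)

lemma keys_map_subset: "Poly_Mapping.keys (Poly_Mapping.map g f) \<subseteq> Poly_Mapping.keys f"
  by (auto simp: in_keys_iff Poly_Mapping.map.rep_eq when_def)

lemma eval_tensor_map_mult: "eval_tensor (Poly_Mapping.map (\<lambda>c. c * a) f) = eval_tensor f * a"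
  by (subst eval_tensor_superset[of "Poly_Mapping.keys f"])
    (simp_all add: keys_map_subset lookup_map eval_tensor_def sum_distrib_right mult.assoc)

lemma eval_word_append: "eval_word (v @ u) = cl_shift (real (length u)) (eval_word v) * eval_word u"
  by (induction v) (simp_all add: cl_shift_mult cl_shift_one cl_shift_shift add.commute mult.assoc)

lemma eval_word_replicate_one [simp]: "eval_word (replicate n 1) = 1"
  by (induction n) (simp_all add: cl_shift_one)

text \<open>The coefficient \<open>a\<close> is arbitrary in the induction because the recursion
  replaces it by the inner product of the two leading letters with \<open>a\<close> in
  between.\<close>

lemma word_ip_shift:
  "length v = length w \<Longrightarrow>
    word_ip shift_corr a v w = adj (eval_word v) * cl_shift (real (length w)) a * eval_word w"
proof (induction v w arbitrary: a rule: list_induct2)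
  case (Cons x v y w)
  have "word_ip shift_corr a (x # v) (y # w) =
      adj (eval_word v) * cl_shift (real (length w)) (adj x * (cl_shift 1 a * y)) * eval_word w"
    using Cons.IH by (simp add: shift_corr_def)
  then show ?case
    using Cons.hyps by (simp add: cl_shift_mult cl_shift_shift cl_shift_adj adj_mult mult_ac add.commute)
qed simp

lemma eval_tensor_word_single:
  "eval_tensor (word_single shift_corr v a w c) = cl_shift (real (length w)) (eval_word v * a) * eval_word w * c"
proof (cases w)
  case (Cons x u)
  then show ?thesis
    by (simp add: shift_corr_def eval_word_append cl_shift_mult cl_shift_shift mult_ac add.commute)
qed (simp add: mult_ac)

lemma keys_word_single:
  assumes "u \<in> Poly_Mapping.keys (word_single shift_corr v a w c)"
  shows "length u = length v + length w"
proof (cases w)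
  case (Cons x u')
  then show ?thesis using assms by (simp split: if_splits)
qed (use assms in \<open>simp split: if_splits\<close>)

lemma mcar_tensor_pre_shift:
  "f \<in> mcar (tensor_pre shift_corr n) \<longleftrightarrow> (\<forall>w\<in>Poly_Mapping.keys f. length w = n)"
  by (simp add: tensor_pre_def shift_corr_def)

lemma sum_mem_tensor_pre_shift:
  "(\<And>a. a \<in> A \<Longrightarrow> h a \<in> mcar (tensor_pre shift_corr n)) \<Longrightarrow> sum h A \<in> mcar (tensor_pre shift_corr n)"
  unfolding mcar_tensor_pre_shift using keys_sum[of h A] by blast

lemma adj_sum: "adj (sum h A) = (\<Sum>a\<in>A. adj (h a :: 'b::unital_cstar_algebra))"
  by (induction A rule: infinite_finite_induct) (simp_all add: adj_add)

interpretation sh: scalar_power shift_corr n eval_tensor "cl_shift (real n)" for n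
proof
  fix x y a
  assume x: "x \<in> mcar (tensor_pre shift_corr n)"
  show "mract (tensor_pre shift_corr n) x a \<in> mcar (tensor_pre shift_corr n)"
    using x keys_map_subset unfolding mcar_tensor_pre_shift by (fastforce simp: tensor_pre_def)
  show "mlact (tensor_pre shift_corr n) a x \<in> mcar (tensor_pre shift_corr n)"
    using x sum_mem_tensor_pre_shift[of "Poly_Mapping.keys x" "\<lambda>w. word_single shift_corr [] a w (Poly_Mapping.lookup x w)"]
      keys_word_single[of _ "[]"]
    by (simp add: mcar_tensor_pre_shift) (simp add: tensor_pre_def)
  show "eval_tensor (mract (tensor_pre shift_corr n) x a) = eval_tensor x * a"
    by (simp add: tensor_pre_def eval_tensor_map_mult)
  show "eval_tensor (mlact (tensor_pre shift_corr n) a x) = cl_shift (real n) a * eval_tensor x"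
    using x unfolding mcar_tensor_pre_shift
    by (simp add: tensor_pre_def eval_tensor_sum eval_tensor_word_single eval_tensor_def[of x] sum_distrib_left mult_ac)
  assume y: "y \<in> mcar (tensor_pre shift_corr n)"
  show "madd (tensor_pre shift_corr n) x y \<in> mcar (tensor_pre shift_corr n)"
    using x y keys_add[of x y] unfolding mcar_tensor_pre_shift by (auto simp: tensor_pre_def)
  show "eval_tensor (madd (tensor_pre shift_corr n) x y) = eval_tensor x + eval_tensor y"
    by (simp add: tensor_pre_def eval_tensor_add)
  have "mip (tensor_pre shift_corr n) x y = (\<Sum>v\<in>Poly_Mapping.keys x. \<Sum>w\<in>Poly_Mapping.keys y.
      adj (eval_word v * Poly_Mapping.lookup x v) * (eval_word w * Poly_Mapping.lookup y w))"
    using x y unfolding mcar_tensor_pre_shift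
    by (simp add: tensor_pre_def word_ip_shift cl_shift_one adj_mult mult_ac)
  then show "mip (tensor_pre shift_corr n) x y = adj (eval_tensor x) * eval_tensor y"
    by (simp add: eval_tensor_def adj_sum sum_product)
next
  show "\<exists>x\<in>mcar (tensor_pre shift_corr n). eval_tensor x = 1"
    by (rule bexI[of _ "Poly_Mapping.single (replicate n 1) 1"]) (simp_all add: mcar_tensor_pre_shift)
  show "adj (cl_shift (real n) a) = cl_shift (real n) (adj a)" for a
    by (simp add: cl_shift_adj)
qed

interpretation steps: pre_ip "step_pre shift_corr n" for n
  by (rule sh.pre_ip_step_pre)

interpretation sector: pre_ip "sector shift_corr n" for n
  by (rule sh.pre_ip_sector)

abbreviation shift_tp :: "nat \<Rightarrow> climfun \<Rightarrow> (climfun, climfun) tensors" where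
  "shift_tp n \<equiv> scalar_power.tp shift_corr n eval_tensor"

text \<open>The left factor passes n letters on its way to the right and is shifted by n. The shift
  is additive and contractive, which yields the estimate needed to extend the product to the
  completions.\<close>

lemma tensor_mult_tp:
  "tensor_mult shift_corr m n (shift_tp m b) (shift_tp n c) = shift_tp (m + n) (cl_shift (real n) b * c)"
proof -
  obtain x where x: "x \<in> mcar (tensor_pre shift_corr m)" "eval_tensor x = b" using sh.ex_ev by blast
  obtain y where y: "y \<in> mcar (tensor_pre shift_corr n)" "eval_tensor y = c" using sh.ex_ev by blast
  define h where "h f g = (\<Sum>v\<in>Poly_Mapping.keys f. \<Sum>w\<in>Poly_Mapping.keys g.
      word_single shift_corr v (Poly_Mapping.lookup f v) w (Poly_Mapping.lookup g w))" for f g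
  have closed: "h f g \<in> mcar (tensor_pre shift_corr (m + n))"
    if "f \<in> mcar (tensor_pre shift_corr m)" "g \<in> mcar (tensor_pre shift_corr n)" for f g
    unfolding h_def using that
    by (intro sum_mem_tensor_pre_shift) (auto simp: mcar_tensor_pre_shift dest: keys_word_single)
  have evh: "eval_tensor (h f g) = cl_shift (real n) (eval_tensor f) * eval_tensor g"
    if "g \<in> mcar (tensor_pre shift_corr n)" for f g
  proof -
    have "eval_tensor (h f g) = (\<Sum>v\<in>Poly_Mapping.keys f. \<Sum>w\<in>Poly_Mapping.keys g.
        cl_shift (real n) (eval_word v * Poly_Mapping.lookup f v) * (eval_word w * Poly_Mapping.lookup g w))"
      using that unfolding h_def mcar_tensor_pre_shift
      by (simp add: eval_tensor_sum eval_tensor_word_single mult_ac)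
    also have "\<dots> = (\<Sum>v\<in>Poly_Mapping.keys f. cl_shift (real n) (eval_word v * Poly_Mapping.lookup f v)) * eval_tensor g"
      by (simp add: eval_tensor_def sum_product)
    also have "(\<Sum>v\<in>Poly_Mapping.keys f. cl_shift (real n) (eval_word v * Poly_Mapping.lookup f v)) =
        cl_shift (real n) (eval_tensor f)"
    proof -
      have "cl_shift (real n) (sum k A) = (\<Sum>v\<in>A. cl_shift (real n) (k v))" for k :: "climfun list \<Rightarrow> climfun" and A
        by (induction A rule: infinite_finite_induct) (simp_all add: cl_shift_zero cl_shift_add)
      then show ?thesis by (simp add: eval_tensor_def)
    qed
    finally show ?thesis .
  qed
  have "extend2 (tensor_pre shift_corr m) (tensor_pre shift_corr n) (tensor_pre shift_corr (m + n)) h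
      (canon (tensor_pre shift_corr m) x) (canon (tensor_pre shift_corr n) y) =
      canon (tensor_pre shift_corr (m + n)) (h x y)"
  proof (rule extend2_canon[OF sh.pre_ip_tensor_pre sh.pre_ip_tensor_pre sh.pre_ip_tensor_pre closed])
    fix f f' g g'
    assume f: "f \<in> mcar (tensor_pre shift_corr m)" "f' \<in> mcar (tensor_pre shift_corr m)"
      and g: "g \<in> mcar (tensor_pre shift_corr n)" "g' \<in> mcar (tensor_pre shift_corr n)"
    note cl = pre_ip.mdiff_closed[OF sh.pre_ip_tensor_pre]
    have "eval_tensor (mdiff (tensor_pre shift_corr (m + n)) (h f g) (h f' g')) =
        cl_shift (real n) (eval_tensor f - eval_tensor f') * eval_tensor g + cl_shift (real n) (eval_tensor f') * (eval_tensor g - eval_tensor g')"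
      by (simp add: sh.ev_mdiff closed f g evh cl_shift_diff algebra_simps)
    also have "norm \<dots> \<le> norm (cl_shift (real n) (eval_tensor f - eval_tensor f')) * norm (eval_tensor g) +
        norm (cl_shift (real n) (eval_tensor f')) * norm (eval_tensor g - eval_tensor g')"
      by (rule order_trans[OF norm_triangle_ineq]) (intro add_mono norm_mult_ineq)
    also have "\<dots> \<le> norm (eval_tensor f - eval_tensor f') * norm (eval_tensor g) + norm (eval_tensor f') * norm (eval_tensor g - eval_tensor g')"
      by (intro add_mono mult_right_mono norm_cl_shift_le) auto
    finally show "mnorm (tensor_pre shift_corr (m + n)) (mdiff (tensor_pre shift_corr (m + n)) (h f g) (h f' g')) \<le>
        mnorm (tensor_pre shift_corr m) (mdiff (tensor_pre shift_corr m) f f') * mnorm (tensor_pre shift_corr n) g +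
        mnorm (tensor_pre shift_corr m) f' * mnorm (tensor_pre shift_corr n) (mdiff (tensor_pre shift_corr n) g g')"
      by (simp add: sh.mnorm_tensor_pre sh.ev_mdiff cl closed f g)
  qed (use x y in simp_all)
  then show ?thesis
    unfolding tensor_mult_def h_def[abs_def] using x y closed[OF x(1) y(1)] evh[OF y(1), of x]
    by (simp add: sh.canon_tp h_def)
qed

section \<open>Tonelli's theorem for functions of two blocks of coordinates\<close>

lemma distr_shift_leb_cube:
  "distr (PiM {n + 1..n + m} (\<lambda>_. lborel)) (leb_cube m) (\<lambda>p. \<lambda>i\<in>{1..m}. p (n + i) - t) = leb_cube m"
proof (rule lb.PiM_eqI)
  fix A :: "nat \<Rightarrow> real set"
  assume A: "\<And>i. i \<in> {1..m} \<Longrightarrow> A i \<in> sets lborel"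
  let ?T = "\<lambda>p. \<lambda>i\<in>{1..m}. p (n + i) - t" and ?J = "{n + 1..n + m}"
  let ?B = "\<lambda>j. (\<lambda>x. - t + x) -` A (j - n)"
  have T: "?T \<in> measurable (PiM ?J (\<lambda>_. lborel)) (leb_cube m)"
    by (rule measurable_restrict) measurable
  have vB: "?B j \<in> sets lborel" if "j \<in> ?J" for j
  proof -
    have "j - n \<in> {1..m}" using that by auto
    then have "A (j - n) \<in> sets borel" using A by simp
    then have "(\<lambda>x. - t + x) -` A (j - n) \<inter> space borel \<in> sets borel"
      by (intro measurable_sets[of _ borel borel]) auto
    then show ?thesis by simp
  qed
  have trans: "emeasure lborel ((\<lambda>x. - t + x) -` X) = emeasure lborel X" if "X \<in> sets lborel" for X
    using that by (subst lborel_distr_plus[of "- t", symmetric], subst emeasure_distr) auto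
  have eq: "?T -` (Pi\<^sub>E {1..m} A) \<inter> space (PiM ?J (\<lambda>_. lborel)) = Pi\<^sub>E ?J ?B"
  proof (intro set_eqI iffI)
    fix p assume p: "p \<in> ?T -` (Pi\<^sub>E {1..m} A) \<inter> space (PiM ?J (\<lambda>_. lborel))"
    then have 1: "p (n + i) - t \<in> A i" if "i \<in> {1..m}" for i
      using that by (auto dest!: PiE_mem[of _ _ _ i])
    have "p j \<in> ?B j" if "j \<in> ?J" for j
    proof -
      have "j - n \<in> {1..m}" "n + (j - n) = j" using that by auto
      then show ?thesis using 1[of "j - n"] by simp
    qed
    with p show "p \<in> Pi\<^sub>E ?J ?B" by (auto simp: space_PiM PiE_iff)
  next
    fix p assume p: "p \<in> Pi\<^sub>E ?J ?B"
    have "p (n + i) - t \<in> A i" if "i \<in> {1..m}" for i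
      using PiE_mem[OF p, of "n + i"] that by simp
    with p show "p \<in> ?T -` (Pi\<^sub>E {1..m} A) \<inter> space (PiM ?J (\<lambda>_. lborel))"
      by (auto simp: space_PiM PiE_iff)
  qed
  have "emeasure (distr (PiM ?J (\<lambda>_. lborel)) (leb_cube m) ?T) (Pi\<^sub>E {1..m} A) =
      emeasure (PiM ?J (\<lambda>_. lborel)) (Pi\<^sub>E ?J ?B)"
    unfolding eq[symmetric] by (rule emeasure_distr[OF T sets_PiM_I_finite]) (use A in auto)
  also have "\<dots> = (\<Prod>j\<in>?J. emeasure lborel (?B j))"
    by (rule lb.emeasure_PiM) (use vB in auto)
  also have "\<dots> = (\<Prod>i\<in>{1..m}. emeasure lborel (A i))"
    by (rule prod.reindex_bij_witness[where i="\<lambda>i. n + i" and j="\<lambda>j. j - n"])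
      (use A trans in \<open>auto simp: Suc_le_eq\<close>)
  finally show "emeasure (distr (PiM ?J (\<lambda>_. lborel)) (leb_cube m) ?T) (Pi\<^sub>E {1..m} A) =
      (\<Prod>i\<in>{1..m}. emeasure lborel (A i))" .
qed simp_all

lemma measurable_upper: "(\<lambda>p. \<lambda>i\<in>{1..m}. p (n + i) - t) \<in> measurable (leb_cube (m + n)) (leb_cube m)"
  by (rule measurable_restrict) measurable

lemma measurable_lower: "(\<lambda>p. restrict p {1..n}) \<in> measurable (leb_cube (m + n)) (leb_cube n)"
  by (rule measurable_restrict_subset) auto

text \<open>The two factors depend on disjoint blocks of coordinates, the upper one renumbered and
  translated by t. Integrating out the upper block first leaves a constant, because renumbering and
  translation preserve Lebesgue measure.\<close>

lemma nn_integral_split: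
  assumes A [measurable]: "A \<in> borel_measurable (leb_cube m)" and C [measurable]: "C \<in> borel_measurable (leb_cube n)"
  shows "(\<integral>\<^sup>+p. A (\<lambda>i\<in>{1..m}. p (n + i) - t) * C (restrict p {1..n}) \<partial>leb_cube (m + n)) =
    (\<integral>\<^sup>+p. A p \<partial>leb_cube m) * (\<integral>\<^sup>+p. C p \<partial>leb_cube n)"
proof -
  let ?T = "\<lambda>p. \<lambda>i\<in>{1..m}. p (n + i) - t" and ?J = "{n + 1..n + m}"
  let ?f = "\<lambda>p. A (?T p) * C (restrict p {1..n})"
  have IJ: "{1..m + n} = {1..n} \<union> ?J" by auto
  have T: "?T \<in> measurable (PiM ?J (\<lambda>_. lborel)) (leb_cube m)"
    by (rule measurable_restrict) measurable
  have f: "?f \<in> borel_measurable (leb_cube (m + n))"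
    using measurable_compose[OF measurable_upper A] measurable_compose[OF measurable_lower C] by simp
  have "(\<integral>\<^sup>+p. ?f p \<partial>leb_cube (m + n)) =
      (\<integral>\<^sup>+x. (\<integral>\<^sup>+y. ?f (merge {1..n} ?J (x, y)) \<partial>PiM ?J (\<lambda>_. lborel)) \<partial>leb_cube n)"
    unfolding IJ by (rule lb.product_nn_integral_fold[OF _ _ _ f[unfolded IJ]]) auto
  also have "\<dots> = (\<integral>\<^sup>+x. (\<integral>\<^sup>+y. A (?T y) * C x \<partial>PiM ?J (\<lambda>_. lborel)) \<partial>leb_cube n)"
  proof (intro nn_integral_cong)
    fix x y assume x: "x \<in> space (leb_cube n)"
    have "?T (merge {1..n} ?J (x, y)) = ?T y" by (auto simp: merge_def fun_eq_iff)
    moreover have "restrict (merge {1..n} ?J (x, y)) {1..n} = x"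
      using x by (auto simp: merge_def fun_eq_iff space_PiM PiE_iff extensional_def)
    ultimately show "?f (merge {1..n} ?J (x, y)) = A (?T y) * C x" by simp
  qed
  also have "\<dots> = (\<integral>\<^sup>+x. (\<integral>\<^sup>+y. A (?T y) \<partial>PiM ?J (\<lambda>_. lborel)) * C x \<partial>leb_cube n)"
    by (intro nn_integral_cong nn_integral_multc measurable_compose[OF T A])
  also have "(\<integral>\<^sup>+y. A (?T y) \<partial>PiM ?J (\<lambda>_. lborel)) = (\<integral>\<^sup>+p. A p \<partial>leb_cube m)"
    by (rule nn_integral_distr[OF T, of A, unfolded distr_shift_leb_cube, OF A, symmetric])
  also have "(\<integral>\<^sup>+x. (\<integral>\<^sup>+p. A p \<partial>leb_cube m) * C x \<partial>leb_cube n) =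
      (\<integral>\<^sup>+p. A p \<partial>leb_cube m) * (\<integral>\<^sup>+p. C p \<partial>leb_cube n)"
    by (rule nn_integral_cmult[OF C])
  finally show ?thesis .
qed

section \<open>Products of step functions\<close>

definition particle_fun :: "real \<Rightarrow> nat \<Rightarrow> nat \<Rightarrow> ((nat \<Rightarrow> real) \<Rightarrow> climfun) \<Rightarrow> ((nat \<Rightarrow> real) \<Rightarrow> climfun) \<Rightarrow>
    (nat \<Rightarrow> real) \<Rightarrow> climfun" where
  "particle_fun t m n f g p = (if p \<in> {1..m + n} \<rightarrow>\<^sub>E {0..}
    then cl_shift (real n) (f (\<lambda>i\<in>{1..m}. p (n + i) - t)) * g (restrict p {1..n}) else 0)"

lemma Collect_values:
  "{p \<in> S. h (f (T p)) (g (R p)) = v} = (\<Union>w\<in>range f. \<Union>u\<in>range g \<inter> {u. h w u = v}.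
    {p \<in> S. f (T p) = w} \<inter> {p \<in> S. g (R p) = u})"
  by auto

lemma step_fun_particle_fun:
  assumes f: "step_fun m f" and g: "step_fun n g"
  shows "step_fun (m + n) (particle_fun t m n f g)"
  unfolding step_fun_def
proof (intro conjI allI)
  let ?T = "\<lambda>p. \<lambda>i\<in>{1..m}. p (n + i) - t" and ?R = "\<lambda>p. restrict p {1..n}"
  let ?B = "{1..m + n} \<rightarrow>\<^sub>E {0::real..}" and ?L = "leb_cube (m + n)"
  have "range (particle_fun t m n f g) \<subseteq> insert 0 ((\<lambda>(x, y). cl_shift (real n) x * y) ` (range f \<times> range g))"
    by (auto simp: particle_fun_def)
  moreover have "finite \<dots>" using f g by (simp add: step_fun_def)
  ultimately show "finite (range (particle_fun t m n f g))" by (rule finite_subset)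
  fix v
  have B: "?B \<in> sets ?L" by (rule sets_PiM_I_finite) auto
  have 1: "{p \<in> space ?L. f (?T p) = w} \<in> sets ?L" for w
  proof -
    have "{p \<in> space ?L. f (?T p) = w} = ?T -` {q \<in> space (leb_cube m). f q = w} \<inter> space ?L"
      using measurable_space[OF measurable_upper] by auto
    also have "\<dots> \<in> sets ?L"
      using f by (intro measurable_sets[OF measurable_upper]) (simp add: step_fun_def)
    finally show ?thesis .
  qed
  have 2: "{p \<in> space ?L. g (?R p) = w} \<in> sets ?L" for w
  proof -
    have "{p \<in> space ?L. g (?R p) = w} = ?R -` {q \<in> space (leb_cube n). g q = w} \<inter> space ?L"
      using measurable_space[OF measurable_lower] by auto
    also have "\<dots> \<in> sets ?L"
      using g by (intro measurable_sets[OF measurable_lower]) (simp add: step_fun_def)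
    finally show ?thesis .
  qed
  let ?P = "{p \<in> space ?L. cl_shift (real n) (f (?T p)) * g (?R p) = v}"
  have "?P = (\<Union>w\<in>range f. \<Union>u\<in>range g \<inter> {u. cl_shift (real n) w * u = v}.
      {p \<in> space ?L. f (?T p) = w} \<inter> {p \<in> space ?L. g (?R p) = u})"
    by (rule Collect_values[where h="\<lambda>w u. cl_shift (real n) w * u"])
  also have "\<dots> \<in> sets ?L"
    using f g by (intro sets.finite_UN sets.Int 1 2) (auto simp: step_fun_def)
  finally have P: "?P \<in> sets ?L" .
  have "{p \<in> space ?L. particle_fun t m n f g p = v} = (?P \<inter> ?B) \<union> (if v = 0 then space ?L - ?B else {})"
    by (cases "v = 0") (auto simp: particle_fun_def simp del: restrict_apply)
  also have "\<dots> \<in> sets ?L"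
    by (rule sets.Un[OF sets.Int[OF P B]]) (use sets.compl_sets[OF B] in auto)
  finally show "{p \<in> space ?L. particle_fun t m n f g p = v} \<in> sets ?L" .
next
  obtain r1 where r1: "\<And>p. p \<notin> {1..m} \<rightarrow>\<^sub>E {0..<r1} \<Longrightarrow> f p = 0" using f by (auto simp: step_fun_def)
  obtain r2 where r2: "\<And>p. p \<notin> {1..n} \<rightarrow>\<^sub>E {0..<r2} \<Longrightarrow> g p = 0" using g by (auto simp: step_fun_def)
  \<comment> \<open>The upper coordinates are lowered by t before \<open>f\<close> sees them, hence
    the bound r1 + t for them; the lower ones stay below r2.\<close>
  have "p \<in> {1..m + n} \<rightarrow>\<^sub>E {0..<max (r1 + t) r2}" if "particle_fun t m n f g p \<noteq> 0" for p
  proof -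
    let ?q = "\<lambda>i\<in>{1..m}. p (n + i) - t" and ?r = "restrict p {1..n}"
    have p: "p \<in> {1..m + n} \<rightarrow>\<^sub>E {0..}" and nz: "f ?q \<noteq> 0" "g ?r \<noteq> 0"
      using that by (auto simp: particle_fun_def cl_shift_zero split: if_splits)
    have q: "?q \<in> {1..m} \<rightarrow>\<^sub>E {0..<r1}" and r: "?r \<in> {1..n} \<rightarrow>\<^sub>E {0..<r2}"
      using nz r1 r2 by blast+
    have "p i < max (r1 + t) r2" if i: "i \<in> {1..m + n}" for i
    proof (cases "i \<le> n")
      case True
      then show ?thesis using PiE_mem[OF r, of i] i by (simp add: less_max_iff_disj)
    next
      case False
      then have "i - n \<in> {1..m}" "n + (i - n) = i" using i by auto
      then have "p i - t < r1" using PiE_mem[OF q, of "i - n"] by simp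
      then show ?thesis by (simp add: less_max_iff_disj)
    qed
    then show ?thesis using p by (auto simp: PiE_iff)
  qed
  then show "\<exists>r. \<forall>p. p \<notin> {1..m + n} \<rightarrow>\<^sub>E {0..<r} \<longrightarrow> particle_fun t m n f g p = 0" by blast
qed

abbreviation (input) step_norm :: "nat \<Rightarrow> ((nat \<Rightarrow> real) \<Rightarrow> climfun) \<Rightarrow> real" where
  "step_norm n f \<equiv> mnorm (step_pre shift_corr n) (\<lambda>p. shift_tp n (f p))"

text \<open>At a point s the left factor is evaluated at s + n, because of the shift, and the right
  factor at s. Tonelli's theorem makes the squared L2 norms at these two points multiply, and each
  is at most the square of the module norm.\<close>

lemma mnorm_particle_fun_le:
  assumes f: "step_fun m f" and g: "step_fun n g"
  shows "step_norm (m + n) (particle_fun t m n f g) \<le> step_norm m f * step_norm n g"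
proof (rule steps.mnorm_leI)
  let ?T = "\<lambda>p. \<lambda>i\<in>{1..m}. p (n + i) - t" and ?R = "\<lambda>p. restrict p {1..n}"
  let ?sq = "\<lambda>f s p. (cmod (cl_app (f p) s))\<^sup>2"
  show "(\<lambda>p. shift_tp (m + n) (particle_fun t m n f g p)) \<in> mcar (step_pre shift_corr (m + n))"
    by (rule sh.step_mem[OF step_fun_particle_fun[OF f g]])
  show "0 \<le> step_norm m f * step_norm n g"
    by (simp add: mnorm_def)
  fix s :: real assume s: "s \<ge> 0"
  have nn: "(\<integral>\<^sup>+p. ennreal (?sq h u p) \<partial>leb_cube k) = ennreal (Re (cl_app (step_ip k h h) u))"
    if "step_fun k h" for k h u
    unfolding Re_step_ip_self(1)[OF that]
    by (rule nn_integral_eq_integral[OF Re_step_ip_self(2)[OF that]]) simp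
  have "ennreal (Re (cl_app (step_ip (m + n) (particle_fun t m n f g) (particle_fun t m n f g)) s)) =
      (\<integral>\<^sup>+p. ennreal (?sq (particle_fun t m n f g) s p) \<partial>leb_cube (m + n))"
    by (rule nn[OF step_fun_particle_fun[OF f g], symmetric])
  \<comment> \<open>Only an inequality, since \<open>particle_fun\<close> is cut off to points with
    nonnegative coordinates.\<close>
  also have "\<dots> \<le> (\<integral>\<^sup>+p. ennreal (?sq f (s + real n) (?T p)) * ennreal (?sq g s (?R p)) \<partial>leb_cube (m + n))"
    by (intro nn_integral_mono)
      (simp add: particle_fun_def cl_rep cl_app_shift s norm_mult power_mult_distrib ennreal_mult')
  also have "\<dots> = ennreal (Re (cl_app (step_ip m f f) (s + real n))) * ennreal (Re (cl_app (step_ip n g g) s))"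
    unfolding nn[OF f, symmetric] nn[OF g, symmetric]
    by (rule nn_integral_split)
      (intro measurable_compose[OF borel_measurable_integrable measurable_ennreal] Re_step_ip_self(2) f g)+
  also have "\<dots> = ennreal (Re (cl_app (step_ip m f f) (s + real n)) * Re (cl_app (step_ip n g g) s))"
    by (rule ennreal_mult[symmetric]) (simp_all add: Re_step_ip_self(1) f g)
  finally have "Re (cl_app (step_ip (m + n) (particle_fun t m n f g) (particle_fun t m n f g)) s) \<le>
      Re (cl_app (step_ip m f f) (s + real n)) * Re (cl_app (step_ip n g g) s)"
    by (subst (asm) ennreal_le_iff) (simp_all add: Re_step_ip_self(1) f g)
  also have "\<dots> \<le> (step_norm m f)\<^sup>2 * (step_norm n g)\<^sup>2"
    using steps.Re_mip_le_mnorm[of m "\<lambda>p. shift_tp m (f p)" "s + real n"]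
      steps.Re_mip_le_mnorm[of n "\<lambda>p. shift_tp n (g p)" s]
    by (intro mult_mono) (simp_all add: sh.step_mip Re_step_ip_self(1) f g)
  finally show "Re (cl_app (mip (step_pre shift_corr (m + n)) (\<lambda>p. shift_tp (m + n) (particle_fun t m n f g p))
      (\<lambda>p. shift_tp (m + n) (particle_fun t m n f g p))) s) \<le> (step_norm m f * step_norm n g)\<^sup>2"
    by (simp add: sh.step_mip power_mult_distrib)
qed

lemma step_fun_diff: "step_fun n f \<Longrightarrow> step_fun n g \<Longrightarrow> step_fun n (\<lambda>p. f p - g p :: climfun)"
  by (rule step_fun_comp2[where h="(-)"]) simp_all

lemma particle_mult_stp:
  assumes f: "step_fun m f" and g: "step_fun n g"
  shows "particle_mult shift_corr t m n (canon (step_pre shift_corr m) (\<lambda>p. shift_tp m (f p)))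
      (canon (step_pre shift_corr n) (\<lambda>p. shift_tp n (g p))) =
    canon (step_pre shift_corr (m + n)) (\<lambda>p. shift_tp (m + n) (particle_fun t m n f g p))"
proof -
  let ?h = "\<lambda>f g p. if p \<in> {1..m + n} \<rightarrow>\<^sub>E {0..}
      then tensor_mult shift_corr m n (f (\<lambda>i\<in>{1..m}. p (n + i) - t)) (g (restrict p {1..n}))
      else mzero (tensor_power shift_corr (m + n))"
  have h: "?h (\<lambda>p. shift_tp m (f p)) (\<lambda>p. shift_tp n (g p)) = (\<lambda>p. shift_tp (m + n) (particle_fun t m n f g p))" for f g
    by (auto simp: particle_fun_def tensor_mult_tp sh.mzero_tp fun_eq_iff)
  have "extend2 (step_pre shift_corr m) (step_pre shift_corr n) (step_pre shift_corr (m + n)) ?h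
      (canon (step_pre shift_corr m) (\<lambda>p. shift_tp m (f p))) (canon (step_pre shift_corr n) (\<lambda>p. shift_tp n (g p))) =
      canon (step_pre shift_corr (m + n)) (?h (\<lambda>p. shift_tp m (f p)) (\<lambda>p. shift_tp n (g p)))"
  proof (rule extend2_canon[OF sh.pre_ip_step_pre sh.pre_ip_step_pre sh.pre_ip_step_pre])
    fix x y assume "x \<in> mcar (step_pre shift_corr m)" "y \<in> mcar (step_pre shift_corr n)"
    then obtain f g where f: "step_fun m f" "x = (\<lambda>p. shift_tp m (f p))" and g: "step_fun n g" "y = (\<lambda>p. shift_tp n (g p))"
      by (auto simp: sh.mcar_step_pre)
    show "?h x y \<in> mcar (step_pre shift_corr (m + n))"
      unfolding f(2) g(2) h by (rule sh.step_mem[OF step_fun_particle_fun[OF f(1) g(1)]])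
  next
    fix x x' y y'
    assume "x \<in> mcar (step_pre shift_corr m)" "x' \<in> mcar (step_pre shift_corr m)"
      "y \<in> mcar (step_pre shift_corr n)" "y' \<in> mcar (step_pre shift_corr n)"
    then obtain f f' g g' where f: "step_fun m f" "x = (\<lambda>p. shift_tp m (f p))"
      and f': "step_fun m f'" "x' = (\<lambda>p. shift_tp m (f' p))"
      and g: "step_fun n g" "y = (\<lambda>p. shift_tp n (g p))" and g': "step_fun n g'" "y' = (\<lambda>p. shift_tp n (g' p))"
      unfolding sh.mcar_step_pre by blast
    note df = step_fun_diff[OF f(1) f'(1)] and dg = step_fun_diff[OF g(1) g'(1)]
    \<comment> \<open>The product rule behind the bound required by
      \<open>extend2_canon\<close>.\<close>
    have "(\<lambda>p. shift_tp (m + n) (particle_fun t m n f g p - particle_fun t m n f' g' p)) =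
        (\<lambda>p. shift_tp (m + n) (particle_fun t m n (\<lambda>p. f p - f' p) g p + particle_fun t m n f' (\<lambda>p. g p - g' p) p))"
      by (auto simp: particle_fun_def cl_shift_diff algebra_simps fun_eq_iff)
    then have "step_norm (m + n) (\<lambda>p. particle_fun t m n f g p - particle_fun t m n f' g' p) \<le>
        step_norm (m + n) (particle_fun t m n (\<lambda>p. f p - f' p) g) + step_norm (m + n) (particle_fun t m n f' (\<lambda>p. g p - g' p))"
      using sh.mnorm_step_add[OF step_fun_particle_fun[OF df g(1)] step_fun_particle_fun[OF f'(1) dg]] by simp
    also have "\<dots> \<le> step_norm m (\<lambda>p. f p - f' p) * step_norm n g + step_norm m f' * step_norm n (\<lambda>p. g p - g' p)"
      by (intro add_mono mnorm_particle_fun_le df dg f'(1) g(1))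
    finally show "mnorm (step_pre shift_corr (m + n)) (mdiff (step_pre shift_corr (m + n)) (?h x y) (?h x' y')) \<le>
        mnorm (step_pre shift_corr m) (mdiff (step_pre shift_corr m) x x') * mnorm (step_pre shift_corr n) y +
        mnorm (step_pre shift_corr m) x' * mnorm (step_pre shift_corr n) (mdiff (step_pre shift_corr n) y y')"
      unfolding f(2) f'(2) g(2) g'(2) h by (simp only: sh.step_mdiff)
  qed (use f g in auto)
  then show ?thesis unfolding particle_mult_def h .
qed

section \<open>The Fock module and time ordered words\<close>

abbreviation shift_sector :: "nat \<Rightarrow> (climfun, (climfun, climfun) particles) corr" where
  "shift_sector \<equiv> sector shift_corr"

abbreviation shift_stp :: "nat \<Rightarrow> ((nat \<Rightarrow> real) \<Rightarrow> climfun) \<Rightarrow> (climfun, climfun) particles" where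
  "shift_stp n g \<equiv> canon (step_pre shift_corr n) (\<lambda>p. shift_tp n (g p))"

abbreviation shift_fock :: "(climfun, nat \<Rightarrow> (climfun, climfun) particles) corr" where
  "shift_fock \<equiv> fock shift_corr"

text \<open>Finite blocks of the Fock inner product are semi-inner products on families of
  components that satisfy no summability condition. Their Cauchy-Schwarz inequality controls blocks
  of a series before its convergence is known.\<close>

lemma pre_ip_partial:
  "pre_ip \<lparr>mcar = {x. \<forall>n. x n \<in> mcar (shift_sector n)}, mzero = mzero shift_fock, madd = madd shift_fock, mlact = mlact shift_fock,
    mract = mract shift_fock, mip = (\<lambda>x y. \<Sum>n\<in>A. mip (shift_sector n) (x n) (y n))\<rparr>"
proof -
  have "0 \<le> Re (cl_app (\<Sum>n\<in>A. mip (shift_sector n) (x n) (x n)) s)" if "\<And>n. x n \<in> mcar (shift_sector n)" for x s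
  proof -
    have "cl_app (\<Sum>n\<in>A. h n) s = (\<Sum>n\<in>A. cl_app (h n) s)" for h :: "nat \<Rightarrow> climfun"
      by (induction A rule: infinite_finite_induct) (simp_all add: cl_rep)
    then show ?thesis
      using sector.mip_pos[OF that] by (simp add: sum_nonneg)
  qed
  then show ?thesis
    by unfold_locales
      (simp_all add: fock_def sector.madd_closed sector.mract_closed
        sector.mip_add sector.mip_mract
        sector.mip_adj sum.distrib sum_distrib_right adj_sum)
qed

lemma fock_carrier:
  "x \<in> mcar shift_fock \<longleftrightarrow> (\<forall>n. x n \<in> mcar (shift_sector n)) \<and> summable (\<lambda>n. mip (shift_sector n) (x n) (x n))"
  by (simp add: fock_def)

text \<open>The diagonal series converge in the norm of the function algebra, but possibly not
  absolutely, so comparing norms term by term would not do. Cauchy-Schwarz for the whole block from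
  m to n gives the Cauchy criterion for the mixed series.\<close>

lemma fock_summable:
  assumes x: "x \<in> mcar shift_fock" and y: "y \<in> mcar shift_fock"
  shows "summable (\<lambda>n. mip (shift_sector n) (x n) (y n))"
  unfolding summable_Cauchy
proof (intro allI impI)
  fix e :: real assume e: "e > 0"
  obtain M where M: "\<And>m n. m \<ge> M \<Longrightarrow> norm (\<Sum>k\<in>{m..<n}. mip (shift_sector k) (x k) (x k)) < e"
    using x e unfolding fock_carrier summable_Cauchy by meson
  obtain N where N: "\<And>m n. m \<ge> N \<Longrightarrow> norm (\<Sum>k\<in>{m..<n}. mip (shift_sector k) (y k) (y k)) < e"
    using y e unfolding fock_carrier summable_Cauchy by meson
  have "norm (\<Sum>k\<in>{m..<n}. mip (shift_sector k) (x k) (y k)) < e" if m: "m \<ge> max M N" for m n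
  proof -
    have "norm (\<Sum>k\<in>{m..<n}. mip (shift_sector k) (x k) (y k)) \<le>
        sqrt (norm (\<Sum>k\<in>{m..<n}. mip (shift_sector k) (x k) (x k))) * sqrt (norm (\<Sum>k\<in>{m..<n}. mip (shift_sector k) (y k) (y k)))"
      using pre_ip.Cauchy_Schwarz[OF pre_ip_partial[of "{m..<n}"], of x y] x y
      by (simp add: mnorm_def fock_carrier)
    also have "\<dots> < sqrt e * sqrt e"
      using M[of m n] N[of m n] m e by (intro mult_strict_mono') auto
    finally show ?thesis using e by simp
  qed
  then show "\<exists>N. \<forall>m\<ge>N. \<forall>n. norm (\<Sum>k\<in>{m..<n}. mip (shift_sector k) (x k) (y k)) < e" by blast
qed

lemma fock_ops:
  "madd shift_fock = (\<lambda>x y n. madd (shift_sector n) (x n) (y n))" "mract shift_fock = (\<lambda>x a n. mract (shift_sector n) (x n) a)"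
  "mlact shift_fock = (\<lambda>a x n. mlact (shift_sector n) a (x n))" "mip shift_fock x y = suminf (\<lambda>n. mip (shift_sector n) (x n) (y n))"
  "mzero shift_fock = (\<lambda>n. mzero (shift_sector n))"
  by (simp_all add: fock_def)

lemma fock_component: "x \<in> mcar shift_fock \<Longrightarrow> x n \<in> mcar (shift_sector n)"
  by (simp add: fock_carrier)

lemma Re_fock_mip:
  assumes x: "x \<in> mcar shift_fock"
  shows "(\<lambda>n. Re (cl_app (mip (shift_sector n) (x n) (x n)) s)) sums Re (cl_app (mip shift_fock x x) s)"
  unfolding fock_ops
  by (rule bounded_linear.sums[OF bounded_linear_compose[OF bounded_linear_Re bounded_linear_cl_app]])
    (rule summable_sums[OF fock_summable[OF x x]])

lemma pre_ip_fock: "pre_ip shift_fock"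
proof
  fix x y z a and s :: real
  assume x: "x \<in> mcar shift_fock"
  note xc = fock_component[OF x]
  show "mract shift_fock x a \<in> mcar shift_fock"
    unfolding fock_carrier fock_ops
  proof (intro conjI allI)
    have "mip (shift_sector n) (mract (shift_sector n) (x n) a) (mract (shift_sector n) (x n) a) = adj a * mip (shift_sector n) (x n) (x n) * a" for n
      by (simp add: sector.mip_mract sector.mip_mract_left
          sector.mract_closed xc)
    then show "summable (\<lambda>n. mip (shift_sector n) (mract (shift_sector n) (x n) a) (mract (shift_sector n) (x n) a))"
      using fock_summable[OF x x] by (simp add: summable_mult summable_mult2)
  qed (simp add: sector.mract_closed xc)
  show "0 \<le> Re (cl_app (mip shift_fock x x) s)"
    by (rule sums_le[OF _ sums_zero Re_fock_mip[OF x]]) (rule sector.mip_pos[OF xc])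
  assume y: "y \<in> mcar shift_fock"
  note yc = fock_component[OF y]
  show "madd shift_fock x y \<in> mcar shift_fock"
    unfolding fock_carrier fock_ops
  proof (intro conjI allI)
    have "mip (shift_sector n) (madd (shift_sector n) (x n) (y n)) (madd (shift_sector n) (x n) (y n)) =
        mip (shift_sector n) (x n) (x n) + mip (shift_sector n) (x n) (y n) + (mip (shift_sector n) (y n) (x n) + mip (shift_sector n) (y n) (y n))" for n
      by (simp add: sector.mip_add sector.mip_add_left
          sector.madd_closed xc yc)
    then show "summable (\<lambda>n. mip (shift_sector n) (madd (shift_sector n) (x n) (y n)) (madd (shift_sector n) (x n) (y n)))"
      using fock_summable x y by (simp add: summable_add)
  qed (simp add: sector.madd_closed xc yc)
  show "mip shift_fock x (mract shift_fock y a) = mip shift_fock x y * a"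
    unfolding fock_ops using fock_summable[OF x y]
    by (simp add: sector.mip_mract xc yc suminf_mult2)
  show "adj (mip shift_fock x y) = mip shift_fock y x"
    unfolding fock_ops using bounded_linear.suminf[OF bounded_linear_adj fock_summable[OF x y]]
    by (simp add: sector.mip_adj xc yc)
  assume z: "z \<in> mcar shift_fock"
  note zc = fock_component[OF z]
  show "mip shift_fock x (madd shift_fock y z) = mip shift_fock x y + mip shift_fock x z"
    unfolding fock_ops
    using suminf_add[OF fock_summable[OF x y] fock_summable[OF x z]]
    by (simp add: sector.mip_add xc yc zc)
qed

interpretation fock: pre_ip shift_fock
  by (rule pre_ip_fock)

lemma mnorm_component_le:
  assumes x: "x \<in> mcar shift_fock"
  shows "mnorm (shift_sector n) (x n) \<le> mnorm shift_fock x"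
proof (rule sector.mnorm_leI[OF fock_component[OF x]])
  show "0 \<le> mnorm shift_fock x" by (simp add: mnorm_def)
  fix s :: real
  have "Re (cl_app (mip (shift_sector n) (x n) (x n)) s) \<le> Re (cl_app (mip shift_fock x x) s)"
    using sum_le_suminf[OF sums_summable[OF Re_fock_mip[OF x, of s]], of "{n}"]
      sector.mip_pos[OF fock_component[OF x]] sums_unique[OF Re_fock_mip[OF x, of s]]
    by simp
  then show "Re (cl_app (mip (shift_sector n) (x n) (x n)) s) \<le> (mnorm shift_fock x)\<^sup>2"
    using fock.Re_mip_le_mnorm[of x s] by linarith
qed

section \<open>Time simplices and their volumes\<close>

definition time_simplex :: "nat \<Rightarrow> real \<Rightarrow> (nat \<Rightarrow> real) set" where
  "time_simplex n T = {p \<in> ord_simplex n. n \<ge> 1 \<longrightarrow> p n < T}"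

lemma ord_simplex_less: "p \<in> ord_simplex n \<Longrightarrow> 1 \<le> i \<Longrightarrow> i < j \<Longrightarrow> j \<le> n \<Longrightarrow> p i < p j"
  by (auto simp: ord_simplex_def intro: strict_mono_onD)

lemma ord_simplex_ext: "p \<in> ord_simplex n \<Longrightarrow> p \<in> {1..n} \<rightarrow>\<^sub>E {0..}"
  by (simp add: ord_simplex_def)

lemma time_simplex_less:
  assumes p: "p \<in> time_simplex n T" and i: "i \<in> {1..n}"
  shows "0 \<le> p i" "p i < T"
proof -
  have o: "p \<in> ord_simplex n" and pn: "p n < T" using p i by (auto simp: time_simplex_def)
  show "0 \<le> p i" using PiE_mem[OF ord_simplex_ext[OF o] i] by simp
  show "p i < T"
    using ord_simplex_less[OF o, of i n] i pn by (cases "i = n") auto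
qed

lemma time_simplex_box: "time_simplex n T \<subseteq> {1..n} \<rightarrow>\<^sub>E {0..<T}"
proof
  fix p assume p: "p \<in> time_simplex n T"
  then have "p \<in> extensional {1..n}" by (auto simp: time_simplex_def ord_simplex_def PiE_iff)
  then show "p \<in> {1..n} \<rightarrow>\<^sub>E {0..<T}" using time_simplex_less[OF p] by (auto simp: PiE_iff)
qed

lemma ord_simplex_sets: "ord_simplex n \<in> sets (leb_cube n)"
proof -
  have "ord_simplex n = ({1..n} \<rightarrow>\<^sub>E {0..}) \<inter>
      {p \<in> space (leb_cube n). \<forall>i\<in>{1..n}. \<forall>j\<in>{1..n}. i < j \<longrightarrow> p i < p j}"
    by (auto simp: ord_simplex_def strict_mono_on_def space_PiM PiE_iff extensional_def)
  also have "\<dots> \<in> sets (leb_cube n)"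
  proof (rule sets.Int)
    show "({1..n} \<rightarrow>\<^sub>E {0..}) \<in> sets (leb_cube n)" by (rule sets_PiM_I_finite) auto
    have "{p \<in> space (leb_cube n). i < j \<longrightarrow> p i < p j} \<in> sets (leb_cube n)" if "i \<in> {1..n}" "j \<in> {1..n}" for i j
      using that by measurable
    then show "{p \<in> space (leb_cube n). \<forall>i\<in>{1..n}. \<forall>j\<in>{1..n}. i < j \<longrightarrow> p i < p j} \<in> sets (leb_cube n)"
      by (intro sets.sets_Collect_finite_All) auto
  qed
  finally show ?thesis .
qed

lemma upper_sets: "n \<ge> 1 \<Longrightarrow> {p. T \<le> p n} \<inter> space (leb_cube n) \<in> sets (leb_cube n)"
proof -
  assume n: "n \<ge> 1"
  then have [measurable]: "(\<lambda>p. p n) \<in> borel_measurable (leb_cube n)"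
    using measurable_component_singleton[of n "{1..n}" "\<lambda>_. lborel :: real measure"] by simp
  have "{p \<in> space (leb_cube n). T \<le> p n} \<in> sets (leb_cube n)" by measurable
  moreover have "{p. T \<le> p n} \<inter> space (leb_cube n) = {p \<in> space (leb_cube n). T \<le> p n}" by auto
  ultimately show ?thesis by simp
qed

lemma time_simplex_sets: "time_simplex n T \<in> sets (leb_cube n)"
proof (cases "n = 0")
  case True
  then show ?thesis using ord_simplex_sets[of 0] by (simp add: time_simplex_def)
next
  case False
  have "time_simplex n T = ord_simplex n - {p. T \<le> p n} \<inter> space (leb_cube n)"
    using False sets.sets_into_space[OF ord_simplex_sets[of n]] by (auto simp: time_simplex_def)
  then show ?thesis using ord_simplex_sets upper_sets[of n T] False by auto
qed

text \<open>With no coordinates there is a single point and the time bound is void. The vacuum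
  component thus has mass 1 at every time, also at time 0.\<close>

lemma time_simplex_0: "time_simplex 0 T = {\<lambda>_. undefined}"
  by (auto simp: time_simplex_def ord_simplex_def strict_mono_on_def)

lemma time_simplex_Suc_0: "time_simplex (Suc 0) T = {1..Suc 0} \<rightarrow>\<^sub>E {0..<T}"
proof (rule antisym[OF time_simplex_box], rule subsetI)
  fix p :: "nat \<Rightarrow> real" assume p: "p \<in> {1..Suc 0} \<rightarrow>\<^sub>E {0..<T}"
  have "p \<in> {1..Suc 0} \<rightarrow>\<^sub>E {0..}"
    by (rule subsetD[OF PiE_mono p]) auto
  moreover have "strict_mono_on {1..Suc 0} p"
    by (rule strict_mono_onI) auto
  ultimately show "p \<in> time_simplex (Suc 0) T"
    using PiE_mem[OF p, of "Suc 0"] by (simp add: time_simplex_def ord_simplex_def)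
qed

lemma measure_time_simplex_0 [simp]: "measure (leb_cube 0) (time_simplex 0 T) = 1"
  by (simp add: time_simplex_0 measure_def)

lemma measure_time_simplex_1: "T \<ge> 0 \<Longrightarrow> measure (leb_cube (Suc 0)) (time_simplex (Suc 0) T) = T"
  unfolding time_simplex_Suc_0 measure_def by (subst lb.emeasure_PiM) auto

text \<open>Integrate over the largest time y last: the remaining times form a point of
  \<open>time_simplex n y\<close>, and the bound y^n / n! integrates to the next one. The factorial
  is what makes the components summable.\<close>

lemma emeasure_time_simplex_le:
  assumes "T \<ge> 0"
  shows "emeasure (leb_cube n) (time_simplex n T) \<le> ennreal (T ^ n / fact n)"
  using assms
proof (induction n arbitrary: T)
  case 0
  then show ?case by (simp add: time_simplex_0)
next
  case (Suc n)
  have I: "{1..Suc n} = insert (Suc n) {1..n}" by auto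
  have m: "indicator (time_simplex (Suc n) T) \<in> borel_measurable (PiM (insert (Suc n) {1..n}) (\<lambda>_. lborel))"
    using time_simplex_sets[of "Suc n" T] unfolding I by (rule borel_measurable_indicator)
  have "emeasure (leb_cube (Suc n)) (time_simplex (Suc n) T) = (\<integral>\<^sup>+p. indicator (time_simplex (Suc n) T) p \<partial>leb_cube (Suc n))"
    by (rule nn_integral_indicator[OF time_simplex_sets, symmetric])
  also have "\<dots> = (\<integral>\<^sup>+y. (\<integral>\<^sup>+x. indicator (time_simplex (Suc n) T) (x(Suc n := y)) \<partial>leb_cube n) \<partial>lborel)"
    unfolding I by (rule lb.product_nn_integral_insert_rev[OF _ _ m]) auto
  also have "\<dots> \<le> (\<integral>\<^sup>+y. (\<integral>\<^sup>+x. indicator {0..T} y * indicator (time_simplex n y) x \<partial>leb_cube n) \<partial>lborel)"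
  proof (intro nn_integral_mono)
    fix x y assume x: "x \<in> space (leb_cube n)"
    show "indicator (time_simplex (Suc n) T) (x(Suc n := y)) \<le> (indicator {0..T} y * indicator (time_simplex n y) x :: ennreal)"
    proof (cases "x(Suc n := y) \<in> time_simplex (Suc n) T")
      case True
      let ?z = "x(Suc n := y)"
      have o: "?z \<in> ord_simplex (Suc n)" using True by (simp add: time_simplex_def)
      have "y \<in> {0..T}" using time_simplex_less[OF True, of "Suc n"] by simp
      moreover have "x \<in> time_simplex n y"
      proof -
        have "x i \<ge> 0" if "i \<in> {1..n}" for i using time_simplex_less(1)[OF True, of i] that by simp
        then have "x \<in> {1..n} \<rightarrow>\<^sub>E {0..}" using x by (auto simp: space_PiM PiE_iff)
        moreover have "strict_mono_on {1..n} x"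
        proof (rule strict_mono_onI)
          fix i j assume "i \<in> {1..n}" "j \<in> {1..n}" "i < j"
          then show "x i < x j" using ord_simplex_less[OF o, of i j] by simp
        qed
        moreover have "x n < y" if "n \<ge> 1" using ord_simplex_less[OF o, of n "Suc n"] that by simp
        ultimately show ?thesis by (simp add: time_simplex_def ord_simplex_def)
      qed
      ultimately show ?thesis using True by simp
    qed simp
  qed
  also have "\<dots> = (\<integral>\<^sup>+y. indicator {0..T} y * emeasure (leb_cube n) (time_simplex n y) \<partial>lborel)"
    by (simp only: nn_integral_cmult_indicator[OF time_simplex_sets])
  also have "\<dots> \<le> (\<integral>\<^sup>+y. ennreal (y ^ n / fact n) * indicator {0..T} y \<partial>lborel)"
    using Suc.IH by (intro nn_integral_mono) (simp split: split_indicator)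
  also have "\<dots> = ennreal (T ^ Suc n / fact (Suc n) - 0 ^ Suc n / fact (Suc n))"
  proof (rule nn_integral_FTC_Icc[where F="\<lambda>y. y ^ Suc n / fact (Suc n)"])
    fix y :: real
    have "((\<lambda>y. y ^ Suc n / fact (Suc n)) has_real_derivative real (Suc n) * y ^ (Suc n - Suc 0) / fact (Suc n))
        (at y)"
      by (rule DERIV_cdivide[OF DERIV_pow])
    moreover have "real (Suc n) * y ^ (Suc n - Suc 0) / fact (Suc n) = y ^ n / fact n"
      by (simp only: fact_Suc of_nat_mult) simp
    ultimately show "((\<lambda>y. y ^ Suc n / fact (Suc n)) has_real_derivative y ^ n / fact n) (at y)"
      by (simp del: fact_Suc power_Suc)
  qed (use Suc.prems in \<open>auto simp del: fact_Suc\<close>)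
  finally show ?case by simp
qed

lemma measure_time_simplex_le: "T \<ge> 0 \<Longrightarrow> measure (leb_cube n) (time_simplex n T) \<le> T ^ n / fact n"
  unfolding measure_def by (rule enn2real_leI[OF _ emeasure_time_simplex_le]) auto

section \<open>Words as sequences of step functions\<close>

text \<open>The invariant of words. The constant \<open>c\<close> is the same for all points and all
  particle numbers, which expresses that at infinity the vector is \<open>c\<close> times the unit.
  The bound, likewise uniform in the particle number, places the sequence in the Fock
  module.\<close>

definition asymp_const :: "real \<Rightarrow> (nat \<Rightarrow> (nat \<Rightarrow> real) \<Rightarrow> climfun) \<Rightarrow> complex \<Rightarrow> bool" where
  "asymp_const T Y c \<longleftrightarrow> (\<forall>N. step_fun N (Y N)) \<and> (\<forall>N p. p \<notin> time_simplex N T \<longrightarrow> Y N p = 0) \<and>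
    (\<exists>K. \<forall>N p. norm (Y N p) \<le> K) \<and> (\<forall>N. \<forall>p\<in>time_simplex N T. cl_inf (Y N p) = c)"

definition step_seq :: "(nat \<Rightarrow> (nat \<Rightarrow> real) \<Rightarrow> climfun) \<Rightarrow> nat \<Rightarrow> (climfun, climfun) particles" where
  "step_seq Y = (\<lambda>N. shift_stp N (Y N))"

abbreviation shift_system :: "(climfun, nat \<Rightarrow> (climfun, climfun) particles) product_system" where
  "shift_system \<equiv> time_ordered_system shift_corr"

abbreviation shift_word :: "(climfun \<times> real) list \<Rightarrow> climfun \<Rightarrow> nat \<Rightarrow> (climfun, climfun) particles" where
  "shift_word \<equiv> unit_word shift_system (time_ordered_unit shift_corr 1)"

lemma shift_system_ops:
  "mip (ps_mem shift_system t) = mip shift_fock" "madd (ps_mem shift_system t) = madd shift_fock" "mract (ps_mem shift_system t) = mract shift_fock"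
  "mlact (ps_mem shift_system t) = mlact shift_fock" "mzero (ps_mem shift_system t) = mzero shift_fock"
  by (simp_all add: time_ordered_system_def time_ordered_fock_def)

text \<open>The uniform bound and the volume of the simplex give the majorant K^2 T^N / N!, a
  multiple of the exponential series.\<close>

lemma asymp_const_fock:
  assumes Y: "asymp_const T Y c" and T: "T \<ge> 0"
  shows "step_seq Y \<in> mcar shift_fock"
proof -
  have Ys: "step_fun N (Y N)" for N using Y by (simp add: asymp_const_def)
  obtain K where K: "\<And>N p. norm (Y N p) \<le> K" using Y by (auto simp: asymp_const_def)
  have K0: "0 \<le> K" using order_trans[OF norm_ge_zero K] .
  have bound: "norm (step_ip N (Y N) (Y N)) \<le> K\<^sup>2 * (T ^ N / fact N)" for N
  proof -
    let ?C = "K\<^sup>2 * (T ^ N / fact N)"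
    have C: "?C \<ge> 0" using T by simp
    have "mnorm (step_pre shift_corr N) (\<lambda>p. shift_tp N (Y N p)) \<le> sqrt ?C"
    proof (rule steps.mnorm_leI)
      fix s :: real
      have "Re (cl_app (step_ip N (Y N) (Y N)) s) = (\<integral>p. (cmod (cl_app (Y N p) s))\<^sup>2 \<partial>leb_cube N)"
        by (rule Re_step_ip_self(1)[OF Ys])
      also have "\<dots> \<le> (\<integral>p. K\<^sup>2 * indicator (time_simplex N T) p \<partial>leb_cube N)"
      proof (rule integral_mono[OF Re_step_ip_self(2)[OF Ys]])
        have "emeasure (leb_cube N) (time_simplex N T) < \<infinity>"
          using emeasure_time_simplex_le[OF T, of N] by (simp add: le_less_trans[OF _ ennreal_less_top])
        then show "integrable (leb_cube N) (\<lambda>p. K\<^sup>2 * indicator (time_simplex N T) p)"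
          using time_simplex_sets by (intro integrable_mult_right integrable_real_indicator)
        fix p
        have "(cmod (cl_app (Y N p) s))\<^sup>2 \<le> K\<^sup>2"
          using order_trans[OF cl_norm_ge K] by (intro power_mono) auto
        moreover have "p \<notin> time_simplex N T \<Longrightarrow> Y N p = 0" using Y by (simp add: asymp_const_def)
        ultimately show "(cmod (cl_app (Y N p) s))\<^sup>2 \<le> K\<^sup>2 * indicator (time_simplex N T) p"
          by (auto simp: cl_rep split: split_indicator)
      qed
      also have "\<dots> = K\<^sup>2 * measure (leb_cube N) (time_simplex N T)"
        using sets.sets_into_space[OF time_simplex_sets] by (simp add: Int_absorb2)
      also have "\<dots> \<le> ?C" by (intro mult_left_mono measure_time_simplex_le T) simp
      finally show "Re (cl_app (mip (step_pre shift_corr N) (\<lambda>p. shift_tp N (Y N p)) (\<lambda>p. shift_tp N (Y N p))) s) \<le> (sqrt ?C)\<^sup>2"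
        using C by (simp add: sh.step_mip)
    qed (use C Ys in auto)
    then have "(mnorm (step_pre shift_corr N) (\<lambda>p. shift_tp N (Y N p)))\<^sup>2 \<le> ?C"
      using C by (metis mnorm_def norm_ge_zero real_sqrt_ge_zero real_sqrt_le_iff real_sqrt_pow2)
    then show ?thesis by (simp add: mnorm_def sh.step_mip)
  qed
  have "summable (\<lambda>N. K\<^sup>2 * (T ^ N / fact N))"
    using summable_exp[of T] by (intro summable_mult) (simp add: field_simps)
  then have "summable (\<lambda>N. step_ip N (Y N) (Y N))"
    by (rule summable_comparison_test'[where N=0]) (rule bound)
  then show ?thesis
    by (simp add: fock_carrier step_seq_def sh.stp_mem Ys sh.mip_stp)
qed

lemma asymp_const_mem:
  assumes Y: "asymp_const T Y c" and T: "T \<ge> 0"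
  shows "step_seq Y \<in> mcar (ps_mem shift_system T)"
proof -
  have Ys: "step_fun N (Y N)" for N using Y by (simp add: asymp_const_def)
  have Y0: "p \<notin> time_simplex N T \<Longrightarrow> Y N p = 0" for N p using Y by (simp add: asymp_const_def)
  have "ord_simplex n \<inter> space (leb_cube n) \<in> sets (leb_cube n)" for n
    using ord_simplex_sets by auto
  then have "mult_ind shift_corr n (ord_simplex n) (step_seq Y n) = shift_stp n (\<lambda>p. if p \<in> ord_simplex n then Y n p else 0)" for n
    unfolding step_seq_def by (rule sh.mult_ind_stp[OF Ys])
  also have "shift_stp n (\<lambda>p. if p \<in> ord_simplex n then Y n p else 0) = step_seq Y n" for n
    unfolding step_seq_def by (rule sh.stp_eqI) (use Y0 in \<open>auto simp: time_simplex_def\<close>)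
  finally have "step_seq Y = (\<lambda>n. mult_ind shift_corr n (ord_simplex n) (step_seq Y n))" by auto
  then have "step_seq Y \<in> mcar (time_ordered_fock shift_corr)"
    using asymp_const_fock[OF Y T] by (simp add: time_ordered_fock_def)
  moreover have "mult_ind shift_corr n {p. T \<le> p n} (step_seq Y n) = mzero (shift_sector n)" if n: "n \<ge> 1" for n
  proof -
    have "mult_ind shift_corr n {p. T \<le> p n} (step_seq Y n) = shift_stp n (\<lambda>p. if p \<in> {p. T \<le> p n} then Y n p else 0)"
      unfolding step_seq_def by (rule sh.mult_ind_stp[OF Ys upper_sets[OF n]])
    also have "\<dots> = shift_stp n (\<lambda>_. 0)"
      by (rule sh.stp_eqI) (use Y0 n in \<open>auto simp: time_simplex_def\<close>)
    finally show ?thesis by (simp add: sh.mzero_stp)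
  qed
  ultimately show ?thesis by (simp add: time_ordered_system_def)
qed

text \<open>The components of \<open_unit>: see \<open>mlact_unit_fun\<close>, by which this is the
  unit at time t multiplied by \<open>a\<close> from the left; \<open>a\<close> passes n letters 1
  and is shifted by n.\<close>

definition unit_fun :: "climfun \<Rightarrow> real \<Rightarrow> nat \<Rightarrow> (nat \<Rightarrow> real) \<Rightarrow> climfun" where
  "unit_fun a t n p = (if p \<in> time_simplex n t then cl_shift (real n) a else 0)"

definition emb_fun :: "climfun \<Rightarrow> nat \<Rightarrow> (nat \<Rightarrow> real) \<Rightarrow> climfun" where
  "emb_fun a n p = (if n = 0 \<and> p \<in> time_simplex 0 0 then a else 0)"

lemma step_fun_unit_fun: "step_fun n (unit_fun a t n)"
  unfolding unit_fun_def by (rule step_fun_const[OF time_simplex_sets time_simplex_box])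

lemma time_ordered_unit_unit_fun: "time_ordered_unit shift_corr 1 t = step_seq (unit_fun 1 t)"
proof
  fix n
  have "time_ordered_unit shift_corr 1 t n = const_on shift_corr n (time_simplex n t) (replicate n 1) 1"
    by (simp add: time_ordered_unit_def time_simplex_def)
  also have "\<dots> = shift_stp n (\<lambda>p. if p \<in> time_simplex n t then eval_tensor (Poly_Mapping.single (replicate n 1) 1) else 0)"
    by (rule sh.const_on_stp) (simp add: mcar_tensor_pre_shift)
  also have "\<dots> = shift_stp n (unit_fun 1 t n)"
    by (rule sh.stp_eqI) (simp add: unit_fun_def cl_shift_one)
  finally show "time_ordered_unit shift_corr 1 t n = step_seq (unit_fun 1 t) n"
    by (simp add: step_seq_def)
qed

lemma mlact_unit_fun: "mlact shift_fock a (step_seq (unit_fun 1 t)) = step_seq (unit_fun a t)"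
proof
  fix n
  have "mlact shift_fock a (step_seq (unit_fun 1 t)) n = shift_stp n (\<lambda>p. cl_shift (real n) a * unit_fun 1 t n p)"
    by (simp add: fock_ops step_seq_def sh.mlact_stp step_fun_unit_fun)
  also have "\<dots> = step_seq (unit_fun a t) n"
    unfolding step_seq_def by (rule sh.stp_eqI) (simp add: unit_fun_def cl_shift_one)
  finally show "mlact shift_fock a (step_seq (unit_fun 1 t)) n = step_seq (unit_fun a t) n" .
qed

lemma ps_emb_emb_fun: "ps_emb shift_system a = step_seq (emb_fun a)"
proof
  fix n
  show "ps_emb shift_system a n = step_seq (emb_fun a) n"
  proof (cases "n = 0")
    case True
    have "ps_emb shift_system a 0 = const_on shift_corr 0 (time_simplex 0 0) [] a"
      by (simp add: time_ordered_system_def time_simplex_def)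
    also have "\<dots> = shift_stp 0 (\<lambda>p. if p \<in> time_simplex 0 0 then eval_tensor (Poly_Mapping.single [] a) else 0)"
      by (rule sh.const_on_stp) (simp add: mcar_tensor_pre_shift)
    also have "eval_tensor (Poly_Mapping.single [] a) = a" by simp
    finally show ?thesis using True by (simp add: step_seq_def emb_fun_def[abs_def])
  next
    case False
    then show ?thesis
      by (simp add: time_ordered_system_def step_seq_def emb_fun_def[abs_def] sh.mzero_stp)
  qed
qed

text \<open>Left factors have the form of a coefficient times the unit, because words are built by
  multiplying with such vectors from the left.\<close>

definition mul_fun :: "climfun \<Rightarrow> real \<Rightarrow> real \<Rightarrow> (nat \<Rightarrow> (nat \<Rightarrow> real) \<Rightarrow> climfun) \<Rightarrow>
    nat \<Rightarrow> (nat \<Rightarrow> real) \<Rightarrow> climfun" where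
  "mul_fun a t T Y N p = (\<Sum>m\<le>N. particle_fun T m (N - m) (unit_fun a t m) (Y (N - m)) p)"

lemma step_fun_zero: "step_fun n (\<lambda>_. 0)"
  using step_fun_const[of "{}" n 0 0] by simp

lemma step_fun_sum: "(\<And>m. m \<in> A \<Longrightarrow> step_fun n (Z m)) \<Longrightarrow> step_fun n (\<lambda>p. \<Sum>m\<in>A. Z m p :: climfun)"
proof (induction A rule: infinite_finite_induct)
  case (insert x A)
  have "step_fun n (\<lambda>p. Z x p + (\<Sum>m\<in>A. Z m p))"
    by (rule step_fun_comp2[where h="(+)"]) (use insert in auto)
  then show ?case using insert by simp
qed (simp_all add: step_fun_zero)

lemma step_ip_sum:
  "step_fun n f \<Longrightarrow> (\<And>m. m \<in> A \<Longrightarrow> step_fun n (Z m)) \<Longrightarrow>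
    step_ip n f (\<lambda>p. \<Sum>m\<in>A. Z m p) = (\<Sum>m\<in>A. step_ip n f (Z m))"
proof (induction A rule: infinite_finite_induct)
  case (insert x A)
  then show ?case by (simp add: step_ip_add[OF _ _ step_fun_sum])
qed (simp_all add: step_ip_zero_right)

lemma step_fun_mul_fun_term: "m \<le> N \<Longrightarrow> step_fun (N - m) (Y (N - m)) \<Longrightarrow> step_fun N (particle_fun T m (N - m) (unit_fun a t m) (Y (N - m)))"
  using step_fun_particle_fun[OF step_fun_unit_fun[of m a t], of "N - m" "Y (N - m)" T] by simp

lemma ps_mult_mul_fun:
  assumes Y: "\<And>N. step_fun N (Y N)"
  shows "ps_mult shift_system t T (step_seq (unit_fun a t)) (step_seq Y) = step_seq (mul_fun a t T Y)"
proof
  fix N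
  have "particle_mult shift_corr T m (N - m) (step_seq (unit_fun a t) m) (step_seq Y (N - m)) =
      shift_stp N (particle_fun T m (N - m) (unit_fun a t m) (Y (N - m)))" if "m \<le> N" for m
    using particle_mult_stp[OF step_fun_unit_fun[of m a t] Y[of "N - m"], of T] that by (simp add: step_seq_def)
  then have "ps_mult shift_system t T (step_seq (unit_fun a t)) (step_seq Y) N =
      (\<lambda>f. \<Sum>m\<le>N. shift_stp N (particle_fun T m (N - m) (unit_fun a t m) (Y (N - m))) f)"
    by (simp add: time_ordered_system_def)
  also have "\<dots> = step_seq (mul_fun a t T Y) N"
  proof (rule sh.sector_eqI)
    fix f :: "(nat \<Rightarrow> real) \<Rightarrow> climfun" assume f: "step_fun N f"
    show "(\<Sum>m\<le>N. shift_stp N (particle_fun T m (N - m) (unit_fun a t m) (Y (N - m))) (\<lambda>p. shift_tp N (f p))) =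
        step_seq (mul_fun a t T Y) N (\<lambda>p. shift_tp N (f p))"
      unfolding step_seq_def mul_fun_def
      using step_ip_sum[OF f, of "{..N}" "\<lambda>m. particle_fun T m (N - m) (unit_fun a t m) (Y (N - m))"] step_fun_mul_fun_term Y
      by (simp add: sh.stp_apply f)
  qed (simp_all add: canon_def step_seq_def)
  finally show "ps_mult shift_system t T (step_seq (unit_fun a t)) (step_seq Y) N = step_seq (mul_fun a t T Y) N" .
qed

text \<open>\<open>m\<close> is the number of particles of \<open>p\<close> in the time interval \<open>[T, t + T)\<close>.\<close>

definition splits :: "real \<Rightarrow> real \<Rightarrow> nat \<Rightarrow> nat \<Rightarrow> (nat \<Rightarrow> real) \<Rightarrow> bool" where
  "splits t T N m p \<longleftrightarrow> m \<le> N \<and> p \<in> {1..N} \<rightarrow>\<^sub>E {0..} \<and>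
    (\<lambda>i\<in>{1..m}. p (N - m + i) - T) \<in> time_simplex m t \<and> restrict p {1..N - m} \<in> time_simplex (N - m) T"

text \<open>If both m and a larger k were possible, coordinate N - k + 1 would be among the lower
  ones for m, hence below T, and the first of the upper ones for k, hence at least T.\<close>

lemma splits_unique:
  assumes "splits t T N m p" "splits t T N k p"
  shows "m = k"
proof -
  have False if m: "splits t T N m p" and k: "splits t T N k p" and mk: "m < k" for m k
  proof -
    let ?i = "N - k + 1"
    have kN: "k \<le> N" using k by (simp add: splits_def)
    have "restrict p {1..N - m} \<in> time_simplex (N - m) T" using m by (simp add: splits_def)
    from time_simplex_less(2)[OF this, of ?i] have "p ?i < T" using mk kN by simp
    moreover have "(\<lambda>i\<in>{1..k}. p (N - k + i) - T) \<in> time_simplex k t" using k unfolding splits_def by blast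
    from time_simplex_less(1)[OF this, of 1] have "p ?i \<ge> T" using mk by simp
    ultimately show False by simp
  qed
  then show ?thesis using assms by (metis linorder_neqE_nat)
qed

lemma splits_time_simplex:
  assumes m: "splits t T N m p" and T: "T \<ge> 0" and t: "t \<ge> 0"
  shows "p \<in> time_simplex N (t + T)"
proof -
  let ?q = "\<lambda>i\<in>{1..m}. p (N - m + i) - T" and ?r = "restrict p {1..N - m}"
  have mN: "m \<le> N" and p: "p \<in> {1..N} \<rightarrow>\<^sub>E {0..}" and q: "?q \<in> time_simplex m t" and r: "?r \<in> time_simplex (N - m) T"
    using m by (auto simp: splits_def)
  have low: "p i < T" if "i \<in> {1..N - m}" for i using time_simplex_less(2)[OF r that] that by simp
  have up: "T \<le> p i" "p i < t + T" if "i \<in> {N - m + 1..N}" for i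
  proof -
    have i: "i - (N - m) \<in> {1..m}" "N - m + (i - (N - m)) = i" using that mN by auto
    show "T \<le> p i" "p i < t + T" using time_simplex_less[OF q i(1)] i by simp_all
  qed
  have "strict_mono_on {1..N} p"
  proof (rule strict_mono_onI)
    fix i j assume ij: "i \<in> {1..N}" "j \<in> {1..N}" "i < j"
    consider "j \<le> N - m" | "i \<le> N - m" "j > N - m" | "i > N - m" by linarith
    then show "p i < p j"
    proof cases
      case 1
      then show ?thesis
        using ord_simplex_less[of ?r "N - m" i j] r ij by (simp add: time_simplex_def)
    next
      case 2
      then show ?thesis using low[of i] up(1)[of j] ij by simp
    next
      case 3
      then have "N - m + (i - (N - m)) = i" "N - m + (j - (N - m)) = j"
        "1 \<le> i - (N - m)" "i - (N - m) < j - (N - m)" "j - (N - m) \<le> m" using ij mN by auto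
      then show ?thesis
        using ord_simplex_less[of ?q m "i - (N - m)" "j - (N - m)"] q by (simp add: time_simplex_def)
    qed
  qed
  moreover have "p N < t + T" if "N \<ge> 1"
  proof (cases "m = 0")
    case True
    then show ?thesis using low[of N] that t by simp
  next
    case False
    then show ?thesis using up(2)[of N] mN by simp
  qed
  ultimately show ?thesis using p by (simp add: time_simplex_def ord_simplex_def)
qed

lemma time_simplex_splits:
  assumes p: "p \<in> time_simplex N (t + T)"
  shows "\<exists>m. splits t T N m p"
proof -
  \<comment> \<open>The number of particles before time T. The disjunct i = 0 keeps the set nonempty
    and stands for the case that there are none.\<close>
  define n where "n = Max {i \<in> {0..N}. i = 0 \<or> p i < T}"
  have n: "n \<in> {i \<in> {0..N}. i = 0 \<or> p i < T}" unfolding n_def by (rule Max_in) auto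
  have nmax: "i \<le> n" if "i \<in> {0..N}" "p i < T" for i
    unfolding n_def using that by (intro Max_ge) auto
  have o: "p \<in> ord_simplex N" using p by (simp add: time_simplex_def)
  note lt = ord_simplex_less[OF o] and ext = ord_simplex_ext[OF o]
  have nN: "n \<le> N" using n by simp
  have up: "T \<le> p i" if "i \<in> {n + 1..N}" for i using nmax[of i] that by force
  have pN: "p N - T < t" if "Suc 0 \<le> N - n"
  proof -
    have "N \<in> {1..N}" using that by auto
    from time_simplex_less(2)[OF p this] show ?thesis by simp
  qed
  have "(\<lambda>i\<in>{1..N - n}. p (n + i) - T) \<in> time_simplex (N - n) t"
    using up pN nN
    by (auto simp: time_simplex_def ord_simplex_def strict_mono_on_def PiE_iff intro!: lt)
  moreover have "restrict p {1..n} \<in> time_simplex n T"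
    using n nN PiE_mem[OF ext] by (auto simp: time_simplex_def ord_simplex_def strict_mono_on_def PiE_iff intro!: lt)
  ultimately have "splits t T N (N - n) p"
    using nN ext by (simp add: splits_def)
  then show ?thesis ..
qed

text \<open>At a given point exactly one summand of the product survives. The shift by m inside the
  left factor and the shift by N - m from the tensor product add up to N, so the leading coefficient
  enters just as it does in a left action on N particles.\<close>

lemma mul_fun_splits:
  assumes m: "splits t T N m p" and Y: "\<And>N p. p \<notin> time_simplex N T \<Longrightarrow> Y N p = 0"
  shows "mul_fun a t T Y N p = cl_shift (real N) a * Y (N - m) (restrict p {1..N - m})"
proof -
  have mN: "m \<le> N" using m by (simp add: splits_def)
  have "particle_fun T k (N - k) (unit_fun a t k) (Y (N - k)) p = 0" if "k \<le> N" "k \<noteq> m" for k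
  proof -
    have "\<not> splits t T N k p" using splits_unique[OF m] that by blast
    then show ?thesis using that Y by (auto simp: particle_fun_def unit_fun_def splits_def cl_shift_zero simp del: restrict_apply)
  qed
  then have "mul_fun a t T Y N p = particle_fun T m (N - m) (unit_fun a t m) (Y (N - m)) p"
    unfolding mul_fun_def using mN by (subst sum.mono_neutral_right[of _ "{m}"]) auto
  also have "\<dots> = cl_shift (real (N - m)) (cl_shift (real m) a) * Y (N - m) (restrict p {1..N - m})"
  proof -
    have "p \<in> {1..m + (N - m)} \<rightarrow>\<^sub>E {0..}" "(\<lambda>i\<in>{1..m}. p (N - m + i) - T) \<in> time_simplex m t"
      using m unfolding splits_def by auto
    then show ?thesis unfolding particle_fun_def unit_fun_def by (simp only: if_True)
  qed
  also have "cl_shift (real (N - m)) (cl_shift (real m) a) = cl_shift (real N) a"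
    using mN by (simp add: cl_shift_shift of_nat_diff)
  finally show ?thesis .
qed

lemma mul_fun_no_splits:
  assumes "\<And>m. \<not> splits t T N m p" and Y: "\<And>N p. p \<notin> time_simplex N T \<Longrightarrow> Y N p = 0"
  shows "mul_fun a t T Y N p = 0"
  unfolding mul_fun_def
proof (rule sum.neutral, rule ballI)
  fix k assume "k \<in> {..N}"
  then show "particle_fun T k (N - k) (unit_fun a t k) (Y (N - k)) p = 0"
    using assms(1)[of k] Y by (auto simp: particle_fun_def unit_fun_def splits_def cl_shift_zero simp del: restrict_apply)
qed

lemma asymp_const_mul_fun:
  assumes Y: "asymp_const T Y c" and T: "T \<ge> 0" and t: "t \<ge> 0"
  shows "asymp_const (t + T) (mul_fun a t T Y) (cl_inf a * c)"
  unfolding asymp_const_def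
proof (intro conjI allI impI ballI)
  have Ys: "step_fun N (Y N)" for N using Y by (simp add: asymp_const_def)
  have Y0: "p \<notin> time_simplex N T \<Longrightarrow> Y N p = 0" for N p using Y by (simp add: asymp_const_def)
  show "step_fun N (mul_fun a t T Y N)" for N
    unfolding mul_fun_def[abs_def] by (rule step_fun_sum) (simp add: step_fun_mul_fun_term Ys)
  show "mul_fun a t T Y N p = 0" if "p \<notin> time_simplex N (t + T)" for N p
    using mul_fun_no_splits[of t T N p Y] splits_time_simplex[OF _ T t] that Y0 by blast
  show "cl_inf (mul_fun a t T Y N p) = cl_inf a * c" if p: "p \<in> time_simplex N (t + T)" for N p
  proof -
    obtain m where m: "splits t T N m p" using time_simplex_splits[OF p] by blast
    then have "restrict p {1..N - m} \<in> time_simplex (N - m) T" by (simp add: splits_def)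
    then have "cl_inf (Y (N - m) (restrict p {1..N - m})) = c" using Y by (simp add: asymp_const_def)
    then show ?thesis by (simp add: mul_fun_splits[OF m Y0] cl_inf_mult cl_inf_shift)
  qed
  obtain K where K: "\<And>N p. norm (Y N p) \<le> K" using Y by (auto simp: asymp_const_def)
  have K0: "0 \<le> K" using order_trans[OF norm_ge_zero K] .
  \<comment> \<open>The defining sum has N + 1 terms, but at most one is nonzero at p; hence a bound
    that does not grow with N.\<close>
  have "norm (mul_fun a t T Y N p) \<le> norm a * K" for N p
  proof (cases "\<exists>m. splits t T N m p")
    case True
    then obtain m where m: "splits t T N m p" by blast
    have "norm (cl_shift (real N) a * Y (N - m) (restrict p {1..N - m})) \<le> norm a * K"
      by (rule order_trans[OF norm_mult_ineq]) (intro mult_mono norm_cl_shift_le K; simp)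
    then show ?thesis by (simp add: mul_fun_splits[OF m Y0])
  next
    case False
    then show ?thesis using mul_fun_no_splits[of t T N p Y] Y0 K0 by simp
  qed
  then show "\<exists>K. \<forall>N p. norm (mul_fun a t T Y N p) \<le> K" by blast
qed

lemma time_simplex_zero: "time_simplex N 0 = (if N = 0 then {\<lambda>_. undefined} else {})"
  using time_simplex_less[of _ N 0 N] by (force simp: time_simplex_0)

lemma asymp_const_emb_fun: "asymp_const 0 (emb_fun a) (cl_inf a)"
proof -
  have "step_fun n (emb_fun a n)" for n
    using step_fun_const[OF time_simplex_sets time_simplex_box, of 0 0 a]
    by (cases "n = 0") (simp_all add: emb_fun_def[abs_def] step_fun_zero)
  moreover have "norm (emb_fun a n p) \<le> norm a" for n p by (simp add: emb_fun_def)
  ultimately show ?thesis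
    unfolding asymp_const_def by (auto simp: emb_fun_def time_simplex_zero split: if_splits)
qed

text \<open>The right factor is the vacuum at time 0, so all N particles belong to the left one.
  This identifies one-letter words with multiples of the unit.\<close>

lemma mul_fun_emb_fun: "t \<ge> 0 \<Longrightarrow> mul_fun a t 0 (emb_fun 1) = unit_fun a t"
proof (intro ext)
  fix N p
  assume t: "t \<ge> 0"
  have E0: "q \<notin> time_simplex n 0 \<Longrightarrow> emb_fun 1 n q = 0" for n q using asymp_const_emb_fun[of 1] by (simp add: asymp_const_def)
  show "mul_fun a t 0 (emb_fun 1) N p = unit_fun a t N p"
  proof (cases "p \<in> time_simplex N t")
    case True
    then have ext: "p \<in> {1..N} \<rightarrow>\<^sub>E {0..}" by (simp add: time_simplex_def ord_simplex_def)
    then have "(\<lambda>i\<in>{1..N}. p (N - N + i) - 0) = p" by (auto simp: PiE_iff extensional_def)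
    moreover have r0: "restrict p {} = (\<lambda>_. undefined)" by (auto simp: restrict_def)
    ultimately have m: "splits t 0 N N p" using True ext by (simp add: splits_def time_simplex_0)
    show ?thesis using True by (simp add: mul_fun_splits[OF m E0] unit_fun_def emb_fun_def time_simplex_0 r0)
  next
    case False
    then have "\<not> splits t 0 N m p" for m using splits_time_simplex[of t 0 N m p] t by auto
    then show ?thesis using False mul_fun_no_splits[of t 0 N p "emb_fun 1" a] E0 by (simp add: unit_fun_def)
  qed
qed

lemma asymp_const_unit_fun: "t \<ge> 0 \<Longrightarrow> asymp_const t (unit_fun a t) (cl_inf a)"
  using asymp_const_mul_fun[OF asymp_const_emb_fun[of 1], of t a] by (simp add: mul_fun_emb_fun)

lemma unit_word_asymp_const:
  "\<forall>(a, s)\<in>set ps. s > 0 \<Longrightarrow> \<exists>Y c. asymp_const (sum_list (map snd ps)) Y c \<and>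
    shift_word ps a0 = step_seq Y"
proof (induction ps)
  case Nil
  then show ?case using asymp_const_emb_fun[of a0] ps_emb_emb_fun[of a0] by auto
next
  case (Cons x ps)
  obtain a t where x: "x = (a, t)" by (cases x)
  have t: "t \<ge> 0" using Cons.prems x by auto
  have T: "sum_list (map snd ps) \<ge> 0"
    using Cons.prems by (intro sum_list_nonneg) force
  obtain Y c where Y: "asymp_const (sum_list (map snd ps)) Y c"
    and w: "shift_word ps a0 = step_seq Y"
    using Cons by auto
  have "shift_word (x # ps) a0 =
      step_seq (mul_fun a t (sum_list (map snd ps)) Y)"
    using Y by (simp add: x w shift_system_ops time_ordered_unit_unit_fun mlact_unit_fun ps_mult_mul_fun asymp_const_def)
  then show ?case using asymp_const_mul_fun[OF Y T t, of a] by (auto simp: x)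
qed

lemma unit_word_single:
  "t \<ge> 0 \<Longrightarrow> shift_word [(a, t)] 1 = step_seq (unit_fun a t)"
  using asymp_const_emb_fun[of 1]
  by (simp add: shift_system_ops time_ordered_unit_unit_fun mlact_unit_fun ps_emb_emb_fun ps_mult_mul_fun mul_fun_emb_fun asymp_const_def)

section \<open>Left and right actions on the generated subsystem\<close>

lemma mult_frac_less: "K \<ge> 0 \<Longrightarrow> e > 0 \<Longrightarrow> K * (e / (K + 1)) < (e::real)"
  by (simp add: field_simps)

text \<open>An operator \<open>L\<close> on step functions with adjoint \<open>L'\<close> acts on
  functionals by composition with \<open>L'\<close>; the result is represented by \<open>L\<close>
  applied to a representing sequence. The final estimate is kept pointwise in s so that it can be
  summed over particle numbers.\<close>

lemma sector_map:
  assumes phi: "\<phi> \<in> mcar (shift_sector n)"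
    and L: "\<And>f. step_fun n f \<Longrightarrow> step_fun n (L f)" and L': "\<And>f. step_fun n f \<Longrightarrow> step_fun n (L' f)"
    and diff: "\<And>f g p. L (\<lambda>p. f p - g p) p = L f p - L g p"
    and bound: "\<And>f p s. cmod (cl_app (L f p) s) \<le> C * cmod (cl_app (f p) s)" and C: "C \<ge> 0"
    and sym: "\<And>f g. step_fun n f \<Longrightarrow> step_fun n g \<Longrightarrow> step_ip n (L' f) g = step_ip n f (L g)"
    and psi: "\<And>f. step_fun n f \<Longrightarrow> \<psi> (\<lambda>p. shift_tp n (f p)) = \<phi> (\<lambda>p. shift_tp n (L' f p))"
    and psi0: "\<And>x. x \<notin> mcar (step_pre shift_corr n) \<Longrightarrow> \<psi> x = 0"
  shows "\<psi> \<in> mcar (shift_sector n)"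
    and "Re (cl_app (mip (shift_sector n) \<psi> \<psi>) s) \<le> C\<^sup>2 * Re (cl_app (mip (shift_sector n) \<phi> \<phi>) s)"
proof -
  obtain f where f: "represents (step_pre shift_corr n) f \<phi>"
    using phi by (auto simp: sector_def steps.completion_carrier)
  note F = steps.represents_mcauchy[OF f]
  have "\<forall>k. \<exists>g. step_fun n g \<and> f k = (\<lambda>p. shift_tp n (g p))"
    using steps.mcauchy_carrier[OF F] by (simp add: sh.mcar_step_pre)
  then obtain g where g: "\<And>k. step_fun n (g k)" and fg: "\<And>k. f k = (\<lambda>p. shift_tp n (g k p))" by metis
  have Re_le: "Re (cl_app (step_ip n (L h) (L h)) s) \<le> C\<^sup>2 * Re (cl_app (step_ip n h h) s)" if h: "step_fun n h" for h s
    unfolding Re_step_ip_self(1)[OF h] Re_step_ip_self(1)[OF L[OF h]] integral_mult_right_zero[symmetric]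
  proof (rule integral_mono[OF Re_step_ip_self(2)[OF L[OF h]]])
    show "integrable (leb_cube n) (\<lambda>p. C\<^sup>2 * (cmod (cl_app (h p) s))\<^sup>2)"
      by (intro integrable_mult_right Re_step_ip_self(2) h)
    show "(cmod (cl_app (L h p) s))\<^sup>2 \<le> C\<^sup>2 * (cmod (cl_app (h p) s))\<^sup>2" for p
      unfolding power_mult_distrib[symmetric] by (rule power_mono[OF bound]) simp
  qed
  have norm_le: "mnorm (step_pre shift_corr n) (\<lambda>p. shift_tp n (L h p)) \<le> C * mnorm (step_pre shift_corr n) (\<lambda>p. shift_tp n (h p))"
    if h: "step_fun n h" for h
  proof (rule steps.mnorm_leI)
    fix s :: real
    have "Re (cl_app (step_ip n h h) s) \<le> (mnorm (step_pre shift_corr n) (\<lambda>p. shift_tp n (h p)))\<^sup>2"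
      using steps.Re_mip_le_mnorm[of n "\<lambda>p. shift_tp n (h p)" s] by (simp only: sh.step_mip)
    then have "Re (cl_app (step_ip n (L h) (L h)) s) \<le> C\<^sup>2 * (mnorm (step_pre shift_corr n) (\<lambda>p. shift_tp n (h p)))\<^sup>2"
      by (intro order_trans[OF Re_le[OF h] mult_left_mono]) simp_all
    then show "Re (cl_app (mip (step_pre shift_corr n) (\<lambda>p. shift_tp n (L h p)) (\<lambda>p. shift_tp n (L h p))) s)
        \<le> (C * mnorm (step_pre shift_corr n) (\<lambda>p. shift_tp n (h p)))\<^sup>2"
      by (simp add: sh.step_mip power_mult_distrib)
  qed (use C L[OF h] in auto)
  let ?f = "\<lambda>k p. shift_tp n (L (g k) p)"
  have "mcauchy (step_pre shift_corr n) ?f"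
  proof (rule steps.mcauchyI[where C=C, OF _ steps.mcauchyD[OF F]])
    fix j k
    have "mdiff (step_pre shift_corr n) (?f j) (?f k) = (\<lambda>p. shift_tp n (L (\<lambda>p. g j p - g k p) p))"
      by (simp add: sh.step_mdiff diff)
    then show "mnorm (step_pre shift_corr n) (mdiff (step_pre shift_corr n) (?f j) (?f k)) \<le>
        C * mnorm (step_pre shift_corr n) (mdiff (step_pre shift_corr n) (f j) (f k))"
      using norm_le[OF step_fun_diff[OF g g], of j k] by (simp add: fg sh.step_mdiff)
  qed (use g L C in auto)
  moreover have "(\<lambda>k. mip (step_pre shift_corr n) y (?f k)) \<longlonglongrightarrow> \<psi> y"
    if "y \<in> mcar (step_pre shift_corr n)" for y
  proof -
    obtain h where h: "step_fun n h" "y = (\<lambda>p. shift_tp n (h p))" using \<open>y \<in> _\<close> by (auto simp: sh.mcar_step_pre)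
    show ?thesis
      using steps.represents_lim[OF f sh.step_mem[OF L'[OF h(1)]]]
      by (simp add: h psi fg sh.step_mip sym g)
  qed
  ultimately have rep: "represents (step_pre shift_corr n) ?f \<psi>"
    using psi0 by (simp add: represents_def)
  then show "\<psi> \<in> mcar (shift_sector n)" by (auto simp: sector_def steps.completion_carrier)
  have T: "bounded_linear (\<lambda>f. Re (cl_app f s))"
    by (rule bounded_linear_compose[OF bounded_linear_Re bounded_linear_cl_app])
  have "(\<lambda>k. Re (cl_app (step_ip n (L (g k)) (L (g k))) s)) \<longlonglongrightarrow> Re (cl_app (mip (shift_sector n) \<psi> \<psi>) s)"
    using bounded_linear.tendsto[OF T steps.mip_completion[OF rep rep]] by (simp add: sector_def sh.step_mip)
  moreover have "(\<lambda>k. C\<^sup>2 * Re (cl_app (step_ip n (g k) (g k)) s)) \<longlonglongrightarrow> C\<^sup>2 * Re (cl_app (mip (shift_sector n) \<phi> \<phi>) s)"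
    using tendsto_mult_left[OF bounded_linear.tendsto[OF T steps.mip_completion[OF f f]]]
    by (simp add: sector_def sh.step_mip fg)
  ultimately show "Re (cl_app (mip (shift_sector n) \<psi> \<psi>) s) \<le> C\<^sup>2 * Re (cl_app (mip (shift_sector n) \<phi> \<phi>) s)"
    using Re_le[OF g] by (intro LIMSEQ_le) auto
qed

lemma sum_Re_mip:
  assumes "\<And>n. x n \<in> mcar (shift_sector n)"
  shows "Re (cl_app (\<Sum>n\<in>A. mip (shift_sector n) (x n) (x n)) s) = (\<Sum>n\<in>A. Re (cl_app (mip (shift_sector n) (x n) (x n)) s))"
  by (induction A rule: infinite_finite_induct) (simp_all add: cl_rep)

text \<open>Between nonnegative functions a pointwise inequality is an inequality of norms, also for
  sums over blocks. The Cauchy criterion therefore passes from \<open>x\<close> to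
  \<open>y\<close>.\<close>

lemma fock_map:
  assumes x: "x \<in> mcar shift_fock" and y: "\<And>n. y n \<in> mcar (shift_sector n)" and C: "C \<ge> 0"
    and le: "\<And>n s. Re (cl_app (mip (shift_sector n) (y n) (y n)) s) \<le> C\<^sup>2 * Re (cl_app (mip (shift_sector n) (x n) (x n)) s)"
  shows "y \<in> mcar shift_fock" and "mnorm shift_fock y \<le> C * mnorm shift_fock x"
proof -
  have norm_le: "norm (\<Sum>n\<in>A. mip (shift_sector n) (y n) (y n)) \<le> C\<^sup>2 * norm (\<Sum>n\<in>A. mip (shift_sector n) (x n) (x n))" for A
  proof (rule cl_norm_le)
    fix s :: real
    let ?P = "\<lambda>x. \<Sum>n\<in>A. mip (shift_sector n) (x n) (x n)"
    have "cmod (cl_app (?P y) s) = Re (cl_app (?P y) s)"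
    proof -
      have r: "cl_app (?P y) s = complex_of_real (Re (cl_app (?P y) s))" 
        using pre_ip.cl_app_mip_self[OF pre_ip_partial[of A], of y s] y by simp
      have "0 \<le> Re (cl_app (?P y) s)"
        using pre_ip.mip_pos[OF pre_ip_partial[of A], of y s] y by simp
      then show ?thesis by (subst r) (simp only: norm_of_real abs_of_nonneg)
    qed
    also have "\<dots> \<le> C\<^sup>2 * Re (cl_app (?P x) s)"
      unfolding sum_Re_mip[OF y] sum_Re_mip[OF fock_component[OF x]] sum_distrib_left
      by (rule sum_mono) (rule le)
    also have "\<dots> \<le> C\<^sup>2 * norm (?P x)"
      by (intro mult_left_mono order_trans[OF complex_Re_le_cmod cl_norm_ge]) simp
    finally show "cmod (cl_app (?P y) s) \<le> C\<^sup>2 * norm (?P x)" .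
  qed
  have "summable (\<lambda>n. mip (shift_sector n) (y n) (y n))"
    unfolding summable_Cauchy
  proof (intro allI impI)
    fix e :: real assume e: "e > 0"
    then have "e / (C\<^sup>2 + 1) > 0" by (simp add: add_nonneg_pos)
    then obtain N where N: "\<And>m n. m \<ge> N \<Longrightarrow> norm (\<Sum>k\<in>{m..<n}. mip (shift_sector k) (x k) (x k)) < e / (C\<^sup>2 + 1)"
      using x unfolding fock_carrier summable_Cauchy by meson
    have "norm (\<Sum>k\<in>{m..<n}. mip (shift_sector k) (y k) (y k)) < e" if "m \<ge> N" for m n
    proof -
      have "norm (\<Sum>k\<in>{m..<n}. mip (shift_sector k) (y k) (y k)) \<le> C\<^sup>2 * (e / (C\<^sup>2 + 1))"
        by (rule order_trans[OF norm_le mult_left_mono[OF less_imp_le[OF N[OF that]]]]) simp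
      also have "\<dots> < e" using e by (intro mult_frac_less) simp_all
      finally show ?thesis .
    qed
    then show "\<exists>N. \<forall>m\<ge>N. \<forall>n. norm (\<Sum>k\<in>{m..<n}. mip (shift_sector k) (y k) (y k)) < e" by blast
  qed
  with y show yf: "y \<in> mcar shift_fock" by (simp add: fock_carrier)
  show "mnorm shift_fock y \<le> C * mnorm shift_fock x"
  proof (rule fock.mnorm_leI[OF yf])
    show "0 \<le> C * mnorm shift_fock x" using C by (simp add: mnorm_def)
    fix s :: real
    have "Re (cl_app (mip shift_fock y y) s) \<le> C\<^sup>2 * Re (cl_app (mip shift_fock x x) s)"
      by (rule sums_le[OF le Re_fock_mip[OF yf] sums_mult[OF Re_fock_mip[OF x]]])
    also have "\<dots> \<le> (C * mnorm shift_fock x)\<^sup>2"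
      unfolding power_mult_distrib
      by (intro mult_left_mono fock.Re_mip_le_mnorm) simp
    finally show "Re (cl_app (mip shift_fock y y) s) \<le> (C * mnorm shift_fock x)\<^sup>2" .
  qed
qed

lemma mult_ind_apply:
  "step_fun n f \<Longrightarrow> mult_ind shift_corr n D \<phi> (\<lambda>p. shift_tp n (f p)) = \<phi> (\<lambda>p. shift_tp n (if p \<in> D then f p else 0))"
proof -
  assume f: "step_fun n f"
  have "(\<lambda>p. if p \<in> D then shift_tp n (f p) else mzero (tensor_power shift_corr n)) =
      (\<lambda>p. shift_tp n (if p \<in> D then f p else 0))" by (auto simp: sh.mzero_tp)
  then show ?thesis by (simp add: mult_ind_def sh.step_mem[OF f])
qed

lemma mult_ind_outside: "y \<notin> mcar (step_pre shift_corr n) \<Longrightarrow> mult_ind shift_corr n D \<phi> y = 0"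
  by (simp add: mult_ind_def)

lemma mlact_sector_outside: "y \<notin> mcar (step_pre shift_corr n) \<Longrightarrow> mlact (shift_sector n) a \<phi> y = 0"
  by (simp add: sector_def completion_def)

text \<open>The time ordered Fock module is defined as an image under indicator functions;
  contractivity of these places it inside the Fock module.\<close>

lemma fock_mult_ind:
  assumes x: "x \<in> mcar shift_fock" and D: "\<And>n. D n \<in> sets (leb_cube n)"
  shows "(\<lambda>n. mult_ind shift_corr n (D n) (x n)) \<in> mcar shift_fock"
proof -
  have D': "D n \<inter> space (leb_cube n) \<in> sets (leb_cube n)" for n using D by auto
  have sm: "mult_ind shift_corr n (D n) (x n) \<in> mcar (shift_sector n) \<and>
      Re (cl_app (mip (shift_sector n) (mult_ind shift_corr n (D n) (x n)) (mult_ind shift_corr n (D n) (x n))) s) \<le>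
      1\<^sup>2 * Re (cl_app (mip (shift_sector n) (x n) (x n)) s)" for n s
  proof -
    let ?L = "\<lambda>f p. if p \<in> D n then f p else 0 :: climfun"
    have sym: "step_ip n (?L f) g = step_ip n f (?L g)" for f g
      unfolding step_ip_def
      by (rule arg_cong[where f="Bochner_Integration.simple_bochner_integral (leb_cube n)"]) auto
    have R: "step_fun n (?L f)" if "step_fun n f" for f by (rule step_fun_restrict[OF that D'])
    show ?thesis
      by (intro conjI sector_map[OF fock_component[OF x], where L="?L" and L'="?L" and C=1])
        (auto simp: sym mult_ind_apply cl_rep R mult_ind_outside)
  qed
  then show ?thesis by (intro fock_map(1)[OF x, of _ 1]) auto
qed

lemma fock_mlact:
  assumes x: "x \<in> mcar shift_fock"
  shows "mlact shift_fock a x \<in> mcar shift_fock" and "mnorm shift_fock (mlact shift_fock a x) \<le> norm a * mnorm shift_fock x"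
proof -
  have sm: "mlact (shift_sector n) a (x n) \<in> mcar (shift_sector n) \<and>
      Re (cl_app (mip (shift_sector n) (mlact (shift_sector n) a (x n)) (mlact (shift_sector n) a (x n))) s) \<le>
      (norm a)\<^sup>2 * Re (cl_app (mip (shift_sector n) (x n) (x n)) s)" for n s
  proof -
    let ?L = "\<lambda>f p. cl_shift (real n) a * f p :: climfun"
    let ?L' = "\<lambda>f p. cl_shift (real n) (adj a) * f p :: climfun"
    have sym: "step_ip n (?L' f) g = step_ip n f (?L g)" for f g
      unfolding step_ip_def
      by (simp add: adj_mult cl_shift_adj adj_adj mult_ac)
    have bound: "cmod (cl_app (?L f p) s) \<le> norm a * cmod (cl_app (f p) s)" for f p s
      using order_trans[OF cl_norm_ge norm_cl_shift_le, of "real n" a s]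
      by (simp add: cl_rep norm_mult mult_right_mono)
    show ?thesis
      by (intro conjI sector_map[OF fock_component[OF x], where L="?L" and L'="?L'" and C="norm a"])
        (auto simp: sym bound sh.mlact_sector_apply sh.step_fun_lmult right_diff_distrib mlact_sector_outside)
  qed
  show "mlact shift_fock a x \<in> mcar shift_fock" "mnorm shift_fock (mlact shift_fock a x) \<le> norm a * mnorm shift_fock x"
    using fock_map[OF x, of "mlact shift_fock a x" "norm a"] sm by (auto simp: fock_ops)
qed

lemma shift_system_subset_fock: "x \<in> mcar (ps_mem shift_system t) \<Longrightarrow> x \<in> mcar shift_fock"
  by (auto simp: time_ordered_system_def time_ordered_fock_def intro!: fock_mult_ind ord_simplex_sets)

lemma mult_ind_mlact:
  "mult_ind shift_corr n D (mlact (shift_sector n) a \<phi>) = mlact (shift_sector n) a (mult_ind shift_corr n D \<phi>)"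
  if "D \<inter> space (leb_cube n) \<in> sets (leb_cube n)"
proof (rule sh.sector_eqI)
  fix f :: "(nat \<Rightarrow> real) \<Rightarrow> climfun" assume f: "step_fun n f"
  have "(\<lambda>p. shift_tp n (cl_shift (real n) (adj a) * (if p \<in> D then f p else 0))) =
      (\<lambda>p. shift_tp n (if p \<in> D then cl_shift (real n) (adj a) * f p else 0))" by auto
  then show "mult_ind shift_corr n D (mlact (shift_sector n) a \<phi>) (\<lambda>p. shift_tp n (f p)) =
      mlact (shift_sector n) a (mult_ind shift_corr n D \<phi>) (\<lambda>p. shift_tp n (f p))"
    by (simp add: mult_ind_apply f sh.mlact_sector_apply step_fun_restrict[OF f that] sh.step_fun_lmult)
qed (simp_all add: mult_ind_def sector_def completion_def)

lemma mult_ind_mract: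
  "mult_ind shift_corr n D (mract (shift_sector n) \<phi> a) = mract (shift_sector n) (mult_ind shift_corr n D \<phi>) a"
  by (auto simp: mult_ind_def sector_def completion_def)

lemma shift_system_mlact_closed:
  assumes x: "x \<in> mcar (ps_mem shift_system t)"
  shows "mlact shift_fock a x \<in> mcar (ps_mem shift_system t)"
proof -
  obtain y where y: "y \<in> mcar shift_fock" and xy: "x = (\<lambda>n. mult_ind shift_corr n (ord_simplex n) (y n))"
    and v: "\<And>n. n \<ge> 1 \<Longrightarrow> mult_ind shift_corr n {p. t \<le> p n} (x n) = mzero (shift_sector n)"
    using x by (auto simp: time_ordered_system_def time_ordered_fock_def)
  have o: "ord_simplex n \<inter> space (leb_cube n) \<in> sets (leb_cube n)" for n
    using ord_simplex_sets by auto
  have "mlact shift_fock a x = (\<lambda>n. mult_ind shift_corr n (ord_simplex n) (mlact shift_fock a y n))"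
    by (simp add: fock_ops xy mult_ind_mlact[OF o])
  then have "mlact shift_fock a x \<in> mcar (time_ordered_fock shift_corr)"
    using fock_mlact(1)[OF y, of a] by (simp add: time_ordered_fock_def)
  moreover have "mult_ind shift_corr n {p. t \<le> p n} (mlact shift_fock a x n) = mzero (shift_sector n)" if n: "n \<ge> 1" for n
    using v[OF n] by (simp add: fock_ops mult_ind_mlact[OF upper_sets[OF n]])
      (simp add: sector_def completion_def fun_eq_iff)
  ultimately show ?thesis by (simp add: time_ordered_system_def)
qed

lemma shift_system_mract_closed:
  assumes x: "x \<in> mcar (ps_mem shift_system t)"
  shows "mract shift_fock x a \<in> mcar (ps_mem shift_system t)"
proof -
  obtain y where y: "y \<in> mcar shift_fock" and xy: "x = (\<lambda>n. mult_ind shift_corr n (ord_simplex n) (y n))"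
    and v: "\<And>n. n \<ge> 1 \<Longrightarrow> mult_ind shift_corr n {p. t \<le> p n} (x n) = mzero (shift_sector n)"
    using x by (auto simp: time_ordered_system_def time_ordered_fock_def)
  have "mract shift_fock x a = (\<lambda>n. mult_ind shift_corr n (ord_simplex n) (mract shift_fock y a n))"
    by (simp add: fock_ops xy mult_ind_mract)
  then have "mract shift_fock x a \<in> mcar (time_ordered_fock shift_corr)"
    using fock.mract_closed[OF y, of a] by (simp add: time_ordered_fock_def)
  moreover have "mult_ind shift_corr n {p. t \<le> p n} (mract shift_fock x a n) = mzero (shift_sector n)" if n: "n \<ge> 1" for n
    using v[OF n] by (simp add: fock_ops mult_ind_mract)
      (simp add: sector_def completion_def fun_eq_iff)
  ultimately show ?thesis by (simp add: time_ordered_system_def)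
qed

section \<open>The generated subsystem as a bimodule\<close>

abbreviation unit_subsystem :: "(climfun, nat \<Rightarrow> (climfun, climfun) particles) product_system" where
  "unit_subsystem \<equiv> generated_subsystem shift_system (time_ordered_unit shift_corr 1)"

definition unit_words :: "real \<Rightarrow> (nat \<Rightarrow> (climfun, climfun) particles) set" where
  "unit_words t = {shift_word ps a0 | ps a0.
    (\<forall>(a, s)\<in>set ps. s > 0) \<and> sum_list (map snd ps) = t}"

lemma unit_subsystem_ops:
  "mip (ps_mem unit_subsystem t) = mip shift_fock" "madd (ps_mem unit_subsystem t) = madd shift_fock" "mract (ps_mem unit_subsystem t) = mract shift_fock"
  "mlact (ps_mem unit_subsystem t) = mlact shift_fock" "mzero (ps_mem unit_subsystem t) = mzero shift_fock"
  by (simp_all add: generated_subsystem_def shift_system_ops)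

lemma mdiff_shift_system: "mdiff (ps_mem shift_system t) = mdiff shift_fock" and mscale_shift_system: "mscale (ps_mem shift_system t) = mscale shift_fock"
  and mnorm_shift_system: "mnorm (ps_mem shift_system t) = mnorm shift_fock"
  by (simp_all add: mdiff_def[abs_def] mscale_def[abs_def] mnorm_def[abs_def] shift_system_ops)

lemma unit_subsystem_carrier:
  "t > 0 \<Longrightarrow> x \<in> mcar (ps_mem unit_subsystem t) \<longleftrightarrow> x \<in> mcar (ps_mem shift_system t) \<and>
    (\<forall>e>0. \<exists>y\<in>mspan (ps_mem shift_system t) (unit_words t). mnorm shift_fock (mdiff shift_fock x y) < e)"
  by (simp add: generated_subsystem_def mclosure_def unit_words_def mdiff_shift_system mnorm_shift_system)

lemma mspan_asymp_const:
  assumes "y \<in> mspan (ps_mem shift_system t) (unit_words t)"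
  shows "\<exists>Y c. asymp_const t Y c \<and> y = step_seq Y"
  using assms
proof induction
  case zero
  have "asymp_const t (\<lambda>_ _. 0) 0" by (auto simp: asymp_const_def step_fun_zero)
  moreover have "mzero (ps_mem shift_system t) = step_seq (\<lambda>_ _. 0)"
    by (simp add: shift_system_ops fock_ops step_seq_def sh.mzero_stp)
  ultimately show ?case by blast
next
  case (step x y l)
  obtain Y c where Y: "asymp_const t Y c" "y = step_seq Y" using step.IH by blast
  obtain X d where X: "asymp_const t X d" "x = step_seq X"
    using step.hyps(1) unit_word_asymp_const unfolding unit_words_def by blast
  define Z where "Z N p = X N p * cscale l 1 + Y N p" for N p
  have Xs: "step_fun N (X N)" and Ys: "step_fun N (Y N)" for N using X Y by (simp_all add: asymp_const_def)
  note Xl = sh.step_fun_rmult[OF Xs]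
  have "madd (ps_mem shift_system t) (mscale (ps_mem shift_system t) l x) y = step_seq Z"
  proof
    fix n
    have "mract (shift_sector n) (step_seq X n) (cscale l 1) = shift_stp n (\<lambda>p. X n p * cscale l 1)"
      unfolding step_seq_def by (rule sh.mract_stp[OF Xs])
    moreover have "madd (shift_sector n) (shift_stp n (\<lambda>p. X n p * cscale l 1)) (step_seq Y n) = step_seq Z n"
      unfolding step_seq_def Z_def[abs_def] by (rule sh.madd_stp[OF Xl Ys])
    ultimately show "madd (ps_mem shift_system t) (mscale (ps_mem shift_system t) l x) y n = step_seq Z n"
      by (simp add: shift_system_ops mscale_def fock_ops X Y)
  qed
  moreover have "asymp_const t Z (d * l + c)"
  proof -
    obtain K1 K2 where K1: "\<And>N p. norm (X N p) \<le> K1" and K2: "\<And>N p. norm (Y N p) \<le> K2"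
      using X(1) Y(1) unfolding asymp_const_def by blast
    have "norm (Z N p) \<le> K1 * norm (cscale l (1::climfun)) + K2" for N p
      unfolding Z_def
      by (rule order_trans[OF norm_triangle_ineq],
          intro add_mono K2 order_trans[OF norm_mult_ineq] mult_right_mono K1) simp
    moreover have "step_fun N (Z N)" for N
      unfolding Z_def[abs_def] by (rule sh.step_fun_plus[OF Xl Ys])
    ultimately show ?thesis
      using X(1) Y(1) unfolding asymp_const_def by (auto simp: Z_def cl_inf_add cl_inf_mult cl_inf_cscale)
  qed
  ultimately show ?case by blast
qed

lemma step_seq_cong: "(\<And>N p. Y N p = Z N p) \<Longrightarrow> step_seq Y = step_seq Z"
  by presburger

text \<open>Right multiplication touches the innermost coefficient, while words grow on the left.
  The induction therefore follows the step functions of both words together: those of the second are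
  those of the first times \<open>b\<close>.\<close>

lemma mract_word:
  assumes "\<forall>(a, s)\<in>set ps. s > 0"
  shows "mract shift_fock (shift_word ps a0) b =
    shift_word ps (a0 * b)"
proof -
  have "\<exists>Y. (\<exists>c. asymp_const (sum_list (map snd ps)) Y c) \<and>
      shift_word ps a0 = step_seq Y \<and>
      shift_word ps (a0 * b) = step_seq (\<lambda>N p. Y N p * b)"
    using assms
  proof (induction ps)
    case Nil
    have "step_seq (emb_fun (a0 * b)) = step_seq (\<lambda>N p. emb_fun a0 N p * b)"
      by (rule step_seq_cong) (simp add: emb_fun_def)
    then show ?case using asymp_const_emb_fun[of a0] ps_emb_emb_fun by auto
  next
    case (Cons x ps)
    obtain a t where x: "x = (a, t)" by (cases x)
    have t: "t \<ge> 0" using Cons.prems x by auto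
    let ?T = "sum_list (map snd ps)"
    have T: "?T \<ge> 0"
      using Cons.prems by (intro sum_list_nonneg) force
    obtain Y c where Y: "asymp_const ?T Y c"
      and w: "shift_word ps a0 = step_seq Y"
      and wb: "shift_word ps (a0 * b) = step_seq (\<lambda>N p. Y N p * b)"
      using Cons by auto
    have Ys: "step_fun N (Y N)" for N using Y by (simp add: asymp_const_def)
    have "shift_word (x # ps) a0 = step_seq (mul_fun a t ?T Y)"
      by (simp add: x w shift_system_ops time_ordered_unit_unit_fun mlact_unit_fun ps_mult_mul_fun Ys)
    moreover have "shift_word (x # ps) (a0 * b) =
        step_seq (mul_fun a t ?T (\<lambda>N p. Y N p * b))"
      by (simp add: x wb shift_system_ops time_ordered_unit_unit_fun mlact_unit_fun ps_mult_mul_fun sh.step_fun_rmult Ys)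
    moreover have "step_seq (mul_fun a t ?T (\<lambda>N p. Y N p * b)) = step_seq (\<lambda>N p. mul_fun a t ?T Y N p * b)"
      by (rule step_seq_cong) (simp add: mul_fun_def sum_distrib_right particle_fun_def mult.assoc if_distrib[of "\<lambda>x. x * b"] cong: if_cong)
    ultimately show ?case using asymp_const_mul_fun[OF Y T t, of a] by (auto simp: x)
  qed
  then obtain Y c where Y: "asymp_const (sum_list (map snd ps)) Y c"
      "shift_word ps a0 = step_seq Y"
      "shift_word ps (a0 * b) = step_seq (\<lambda>N p. Y N p * b)" by blast
  have "mract shift_fock (step_seq Y) b = step_seq (\<lambda>N p. Y N p * b)"
    using Y(1) by (simp add: fock_ops step_seq_def sh.mract_stp asymp_const_def)
  then show ?thesis using Y by simp
qed

text \<open>By \<open>mul_fun_splits\<close> the leading coefficient appears at N particles as a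
  factor shifted by N, exactly as a left action does; multiplicativity of the shift merges the
  two.\<close>

lemma mlact_word:
  assumes "\<forall>(a, s)\<in>set ((a, t) # ps). s > 0"
  shows "mlact shift_fock b (shift_word ((a, t) # ps) a0) =
    shift_word ((b * a, t) # ps) a0"
proof -
  let ?T = "sum_list (map snd ps)"
  obtain Y c where Y: "asymp_const ?T Y c"
    and w: "shift_word ps a0 = step_seq Y"
    using unit_word_asymp_const[of ps a0] assms by auto
  have Ys: "step_fun N (Y N)" for N using Y by (simp add: asymp_const_def)
  have Y0: "p \<notin> time_simplex N ?T \<Longrightarrow> Y N p = 0" for N p using Y by (simp add: asymp_const_def)
  have Ms: "step_fun N (mul_fun a t ?T Y N)" for N
    unfolding mul_fun_def[abs_def] by (rule step_fun_sum) (simp add: step_fun_mul_fun_term Ys)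
  have W: "shift_word ((a, t) # ps) a0 = step_seq (mul_fun a t ?T Y)" for a
    by (simp add: w shift_system_ops time_ordered_unit_unit_fun mlact_unit_fun ps_mult_mul_fun Ys)
  have "mlact shift_fock b (step_seq (mul_fun a t ?T Y)) = step_seq (\<lambda>N p. cl_shift (real N) b * mul_fun a t ?T Y N p)"
    by (simp add: fock_ops step_seq_def sh.mlact_stp Ms)
  also have "\<dots> = step_seq (mul_fun (b * a) t ?T Y)"
  proof (rule step_seq_cong)
    fix N p
    show "cl_shift (real N) b * mul_fun a t ?T Y N p = mul_fun (b * a) t ?T Y N p"
    proof (cases "\<exists>m. splits t ?T N m p")
      case True
      then obtain m where m: "splits t ?T N m p" by blast
      show ?thesis by (simp add: mul_fun_splits[OF m Y0] cl_shift_mult mult.assoc)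
    next
      case False
      then show ?thesis by (simp add: mul_fun_no_splits[OF _ Y0])
    qed
  qed
  finally show ?thesis by (simp only: W)
qed

lemma mspan_mract:
  assumes "y \<in> mspan (ps_mem shift_system t) (unit_words t)"
  shows "mract shift_fock y b \<in> mspan (ps_mem shift_system t) (unit_words t)"
  using assms
proof induction
  case zero
  have "mract shift_fock (mzero (ps_mem shift_system t)) b = mzero (ps_mem shift_system t)"
    by (simp add: shift_system_ops fock_ops sector_def completion_def)
  then show ?case using mspan.zero[of "ps_mem shift_system t"] by simp
next
  case (step x y l)
  have "mract shift_fock x b \<in> unit_words t"
    using step.hyps(1) mract_word unfolding unit_words_def by blast
  from mspan.step[OF this step.IH, of l]
  show ?case
    by (simp add: shift_system_ops mscale_def fock_ops sector_def completion_def algebra_simps)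
qed

lemma mspan_mlact:
  assumes "y \<in> mspan (ps_mem shift_system t) (unit_words t)" and t: "t > 0"
  shows "mlact shift_fock b y \<in> mspan (ps_mem shift_system t) (unit_words t)"
  using assms(1)
proof induction
  case zero
  have "mlact shift_fock b (mzero (ps_mem shift_system t)) = mzero (ps_mem shift_system t)"
    by (auto simp: shift_system_ops fock_ops sector_def completion_def)
  then show ?case using mspan.zero[of "ps_mem shift_system t"] by simp
next
  case (step x y l)
  obtain ps a0 where ps: "\<forall>(a, s)\<in>set ps. s > 0" "sum_list (map snd ps) = t"
    and x: "x = shift_word ps a0"
    using step.hyps(1) unfolding unit_words_def by blast
  \<comment> \<open>Positive total time excludes the empty word, which has no leading coefficient to
    absorb \<open>b\<close>.\<close>
  obtain a s ps' where ps': "ps = (a, s) # ps'"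
    using ps(2) t by (cases ps) auto
  have "mlact shift_fock b x = shift_word ((b * a, s) # ps') a0"
    unfolding x ps' by (rule mlact_word) (use ps(1) ps' in simp)
  moreover have "(\<forall>(a, s)\<in>set ((b * a, s) # ps'). s > 0) \<and> sum_list (map snd ((b * a, s) # ps')) = t"
    using ps ps' by auto
  ultimately have "mlact shift_fock b x \<in> unit_words t" unfolding unit_words_def by blast
  note mspan.step[OF this step.IH, of l]
  moreover have "madd (ps_mem shift_system t) (mscale (ps_mem shift_system t) l (mlact shift_fock b x)) (mlact shift_fock b y) =
      mlact shift_fock b (madd (ps_mem shift_system t) (mscale (ps_mem shift_system t) l x) y)"
    by (simp add: shift_system_ops mscale_def fock_ops sector_def completion_def fun_eq_iff)
  ultimately show ?case by simp
qed

text \<open>A bounded additive operation that preserves the span of the words preserves its closure.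
  Left and right multiplication are the two instances.\<close>

lemma unit_subsystem_map:
  assumes t: "t > 0" and x: "x \<in> mcar (ps_mem unit_subsystem t)" and C: "C \<ge> 0"
    and mem: "\<And>y. y \<in> mcar (ps_mem shift_system t) \<Longrightarrow> h y \<in> mcar (ps_mem shift_system t)"
    and span: "\<And>y. y \<in> mspan (ps_mem shift_system t) (unit_words t) \<Longrightarrow>
      h y \<in> mspan (ps_mem shift_system t) (unit_words t)"
    and diff: "\<And>y. mdiff shift_fock (h x) (h y) = h (mdiff shift_fock x y)"
    and bound: "\<And>y. y \<in> mcar shift_fock \<Longrightarrow> mnorm shift_fock (h y) \<le> C * mnorm shift_fock y"
  shows "h x \<in> mcar (ps_mem unit_subsystem t)"
  unfolding unit_subsystem_carrier[OF t]
proof (intro conjI allI impI)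
  have xm: "x \<in> mcar (ps_mem shift_system t)" using x by (simp add: unit_subsystem_carrier[OF t])
  then show "h x \<in> mcar (ps_mem shift_system t)" by (rule mem)
  fix e :: real assume e: "e > 0"
  then have "e / (C + 1) > 0" using C by (simp add: add_nonneg_pos)
  then obtain y where y: "y \<in> mspan (ps_mem shift_system t) (unit_words t)"
      "mnorm shift_fock (mdiff shift_fock x y) < e / (C + 1)"
    using x unfolding unit_subsystem_carrier[OF t] by blast
  have "y \<in> mcar shift_fock" using mspan_asymp_const[OF y(1)] asymp_const_fock t by (metis less_imp_le)
  then have "mnorm shift_fock (mdiff shift_fock (h x) (h y)) \<le> C * mnorm shift_fock (mdiff shift_fock x y)"
    unfolding diff by (intro bound fock.mdiff_closed shift_system_subset_fock[OF xm])
  also have "\<dots> \<le> C * (e / (C + 1))" using y(2) C by (intro mult_left_mono) auto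
  also have "\<dots> < e" by (rule mult_frac_less[OF C e])
  finally show "\<exists>y\<in>mspan (ps_mem shift_system t) (unit_words t). mnorm shift_fock (mdiff shift_fock (h x) y) < e"
    using span[OF y(1)] by blast
qed

lemma unit_subsystem_mract:
  assumes t: "t > 0" and x: "x \<in> mcar (ps_mem unit_subsystem t)"
  shows "mract shift_fock x b \<in> mcar (ps_mem unit_subsystem t)"
proof (rule unit_subsystem_map[OF t x, where C="norm b"])
  show "mdiff shift_fock (mract shift_fock x b) (mract shift_fock y b) = mract shift_fock (mdiff shift_fock x y) b" for y
    by (simp add: mdiff_def mscale_def fock_ops sector_def completion_def algebra_simps)
  show "mnorm shift_fock (mract shift_fock y b) \<le> norm b * mnorm shift_fock y" if "y \<in> mcar shift_fock" for y
    using fock.mnorm_mract_le[OF that, of b] by (simp add: mult.commute)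
qed (simp_all add: shift_system_mract_closed mspan_mract)

lemma unit_subsystem_mlact:
  assumes t: "t > 0" and x: "x \<in> mcar (ps_mem unit_subsystem t)"
  shows "mlact shift_fock b x \<in> mcar (ps_mem unit_subsystem t)"
proof (rule unit_subsystem_map[OF t x, where C="norm b"])
  show "mdiff shift_fock (mlact shift_fock b x) (mlact shift_fock b y) = mlact shift_fock b (mdiff shift_fock x y)" for y
    by (simp add: mdiff_def mscale_def fock_ops sector_def completion_def fun_eq_iff)
qed (simp_all add: shift_system_mlact_closed mspan_mlact t fock_mlact)

lemma unit_in_unit_subsystem:
  assumes t: "t > 0"
  shows "step_seq (unit_fun 1 t) \<in> mcar (ps_mem unit_subsystem t)"
  unfolding unit_subsystem_carrier[OF t]
proof (intro conjI allI impI)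
  let ?x = "step_seq (unit_fun 1 t)"
  have n: "asymp_const t (unit_fun 1 t) 1" using asymp_const_unit_fun[of t 1] t by simp
  show "?x \<in> mcar (ps_mem shift_system t)" using asymp_const_mem[OF n] t by simp
  have f: "?x \<in> mcar shift_fock" using asymp_const_fock[OF n] t by simp
  have "shift_word [(1, t)] 1 \<in> unit_words t"
    unfolding unit_words_def
    by (intro CollectI exI[of _ "[(1, t)]"] exI[of _ 1]) (simp add: t)
  then have "?x \<in> unit_words t" using unit_word_single[of t 1] t by simp
  from mspan.step[OF this mspan.zero, of "ps_mem shift_system t" 1]
  have "?x \<in> mspan (ps_mem shift_system t) (unit_words t)"
    by (simp add: shift_system_ops mscale_def fock_ops sector_def completion_def)
  moreover have "mnorm shift_fock (mdiff shift_fock ?x ?x) = 0"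
    by (rule fock.mnorm_mdiff_self[OF f])
  ultimately show "\<exists>y\<in>mspan (ps_mem shift_system t) (unit_words t). mnorm shift_fock (mdiff shift_fock ?x y) < e" if "e > 0" for e
    using that by (intro bexI[of _ ?x]) auto
qed

section \<open>Absence of central unit vectors\<close>

abbreviation unit_vec :: "real \<Rightarrow> nat \<Rightarrow> (climfun, climfun) particles" where
  "unit_vec t \<equiv> step_seq (unit_fun 1 t)"

lemma asymp_const_unit_vec: "t \<ge> 0 \<Longrightarrow> asymp_const t (unit_fun 1 t) 1"
  using asymp_const_unit_fun[of t 1] by simp

text \<open>Since \<open>cl_inf\<close> is a character invariant under the shift, the vector \<open>step_seq Y\<close> cannot be
  distinguished from \<open>c\<close> times the unit at infinity.\<close>

lemma cl_inf_component_nice: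
  assumes Y: "asymp_const t Y c" and t: "t \<ge> 0" and phi: "\<phi> \<in> mcar (shift_sector n)"
  shows "cl_inf (mip (shift_sector n) (step_seq Y n) \<phi>) = cnj c * cl_inf (mip (shift_sector n) (unit_vec t n) \<phi>)"
proof -
  have Ys: "step_fun n (Y n)" using Y by (simp add: asymp_const_def)
  obtain f where f: "represents (step_pre shift_corr n) f \<phi>"
    using phi by (auto simp: sector_def steps.completion_carrier)
  have "\<forall>k. \<exists>g. step_fun n g \<and> f k = (\<lambda>p. shift_tp n (g p))"
    using steps.mcauchy_carrier[OF steps.represents_mcauchy[OF f]] by (simp add: sh.mcar_step_pre)
  then obtain g where g: "\<And>k. step_fun n (g k)" and fg: "\<And>k. f k = (\<lambda>p. shift_tp n (g k p))" by metis
  have lim: "(\<lambda>k. cl_inf (step_ip n h (g k))) \<longlonglongrightarrow> cl_inf (mip (shift_sector n) (shift_stp n h) \<phi>)" if h: "step_fun n h" for h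
    using bounded_linear.tendsto[OF bounded_linear_cl_inf steps.represents_lim[OF f sh.step_mem[OF h]]]
    by (simp add: fg sh.step_mip sh.mip_stp_left[OF h phi])
  have inf: "cl_inf (adj (Y n p) * b) = cnj c * cl_inf (adj (unit_fun 1 t n p) * b)" for p b
    using Y asymp_const_unit_vec[OF t] by (cases "p \<in> time_simplex n t") (simp_all add: asymp_const_def cl_inf_mult cl_inf_adj)
  have "cl_inf (step_ip n (Y n) (g k)) = cnj c * cl_inf (step_ip n (unit_fun 1 t n) (g k))" for k
    by (simp only: step_ip_linear(1)[OF bounded_linear_cl_inf Ys g] inf integral_mult_right_zero
        step_ip_linear(1)[OF bounded_linear_cl_inf step_fun_unit_fun g])
  then have "(\<lambda>k. cl_inf (step_ip n (Y n) (g k))) \<longlonglongrightarrow> cnj c * cl_inf (mip (shift_sector n) (unit_vec t n) \<phi>)"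
    using tendsto_mult_left[OF lim[OF step_fun_unit_fun[of n 1 t]], of "cnj c"] by (simp add: step_seq_def)
  with lim[OF Ys] show ?thesis by (auto simp: step_seq_def intro: LIMSEQ_unique)
qed

lemma cl_inf_nice:
  assumes Y: "asymp_const t Y c" and t: "t \<ge> 0" and x: "x \<in> mcar shift_fock"
  shows "cl_inf (mip shift_fock (step_seq Y) x) = cnj c * cl_inf (mip shift_fock (unit_vec t) x)"
proof -
  have sums: "(\<lambda>n. cl_inf (mip (shift_sector n) (z n) (x n))) sums cl_inf (mip shift_fock z x)" if "z \<in> mcar shift_fock" for z
    unfolding fock_ops
    by (rule bounded_linear.sums[OF bounded_linear_cl_inf summable_sums[OF fock_summable[OF that x]]])
  have "(\<lambda>n. cl_inf (mip (shift_sector n) (step_seq Y n) (x n))) sums (cnj c * cl_inf (mip shift_fock (unit_vec t) x))"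
    using sums_mult[OF sums[OF asymp_const_fock[OF asymp_const_unit_vec[OF t] t]], of "cnj c"]
    by (simp add: cl_inf_component_nice[OF Y t fock_component[OF x]])
  with sums[OF asymp_const_fock[OF Y t]] show ?thesis by (rule sums_unique2)
qed

text \<open>Since \<open>c\<close> is common to all particle numbers, the pairings at infinity
  differ only by the volume of the simplex, which is 1 for no particle and t for one.\<close>

lemma cl_inf_step_ip_unit_vec:
  assumes Y: "asymp_const t Y c" and t: "t \<ge> 0"
  shows "cl_inf (mip (shift_sector n) (unit_vec t n) (step_seq Y n)) = c * measure (leb_cube n) (time_simplex n t)"
proof -
  have Ys: "step_fun n (Y n)" using Y by (simp add: asymp_const_def)
  have "cl_inf (adj (unit_fun 1 t n p) * Y n p) = c * indicator (time_simplex n t) p" for p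
    using Y asymp_const_unit_vec[OF t] by (cases "p \<in> time_simplex n t") (simp_all add: asymp_const_def cl_inf_mult cl_inf_adj)
  then have "cl_inf (step_ip n (unit_fun 1 t n) (Y n)) = (\<integral>p. c * indicator (time_simplex n t) p \<partial>leb_cube n)"
    by (simp only: step_ip_linear(1)[OF bounded_linear_cl_inf step_fun_unit_fun Ys])
  also have "\<dots> = c * (\<integral>p. complex_of_real (indicator (time_simplex n t) p) \<partial>leb_cube n)"
    by (simp only: integral_mult_right_zero of_real_indicator)
  also have "\<dots> = c * measure (leb_cube n) (time_simplex n t)"
    using sets.sets_into_space[OF time_simplex_sets] by (simp add: Int_absorb2 del: of_real_indicator)
  finally show ?thesis by (simp add: step_seq_def sh.mip_stp step_fun_unit_fun Ys)
qed

text \<open>On the n-particle part of the unit, multiplying by \<open>a\<close> from the left equals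
  multiplying by its shift by n from the right, and right factors leave the inner product.\<close>

lemma mip_unit_fun_component:
  assumes "\<phi> \<in> mcar (shift_sector n)"
  shows "mip (shift_sector n) (step_seq (unit_fun a t) n) \<phi> = adj (cl_shift (real n) a) * mip (shift_sector n) (unit_vec t n) \<phi>"
proof -
  have "(\<lambda>p. shift_tp n (unit_fun a t n p)) = (\<lambda>p. shift_tp n (unit_fun 1 t n p * cl_shift (real n) a))"
    by (auto simp: unit_fun_def cl_shift_one)
  then show ?thesis
    by (simp add: step_seq_def sh.mip_stp_left step_fun_unit_fun sh.step_fun_rmult assms sh.sector_apply_mult)
qed

lemma unit_subsystem_subset_fock: "t > 0 \<Longrightarrow> x \<in> mcar (ps_mem unit_subsystem t) \<Longrightarrow> x \<in> mcar shift_fock"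
  using unit_subsystem_carrier shift_system_subset_fock by blast

text \<open>The hypothesis \<open>central\<close> is the equation between a\<omega> and \<omega>a,
  paired with the unit and with the action moved to the unit. It involves only the components
  \<open>w n\<close>.\<close>

lemma no_vacuum_like_vector:
  assumes t: "t > 0" and om: "\<omega> \<in> mcar (ps_mem unit_subsystem t)" and one: "mip shift_fock \<omega> \<omega> = 1"
    and central: "\<And>a. mip shift_fock (step_seq (unit_fun a t)) \<omega> = mip shift_fock (unit_vec t) \<omega> * adj a"
  shows False
proof -
  have t0: "t \<ge> 0" using t by simp
  have omf: "\<omega> \<in> mcar shift_fock" by (rule unit_subsystem_subset_fock[OF t om])
  note oc = fock_component[OF omf]
  have xf: "step_seq (unit_fun a t) \<in> mcar shift_fock" for a by (rule asymp_const_fock[OF asymp_const_unit_fun[OF t0] t0])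
  have near: "\<exists>Y c. asymp_const t Y c \<and> mnorm shift_fock (mdiff shift_fock \<omega> (step_seq Y)) < e" if "e > 0" for e
    using om that mspan_asymp_const unfolding unit_subsystem_carrier[OF t] by metis
  define w where "w n = mip (shift_sector n) (unit_vec t n) (\<omega> n)" for n
  have sw: "summable w" unfolding w_def by (rule fock_summable[OF xf omf])
  have mw: "mip shift_fock (unit_vec t) \<omega> = suminf w" by (simp add: fock_ops w_def[abs_def])

  \<comment> \<open>Approximate \<omega> to within 1/2. If the pairing with the unit vanished at
    infinity, so would the pairing with the approximant, and \<omega> would have pairing 1 with a
    vector of norm below 1/2.\<close>
  have "cl_inf (suminf w) \<noteq> 0"
  proof
    assume z: "cl_inf (suminf w) = 0"
    obtain Y c where Y: "asymp_const t Y c" and d: "mnorm shift_fock (mdiff shift_fock \<omega> (step_seq Y)) < 1 / 2"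
      using near[of "1 / 2"] by auto
    note yf = asymp_const_fock[OF Y t0]
    have "cl_inf (mip shift_fock \<omega> (step_seq Y)) = 0"
      using cl_inf_nice[OF Y t0 omf] z fock.mip_adj[OF yf omf] by (metis cl_inf_adj complex_cnj_zero mult_zero_right mw)
    then have "cl_inf (mip shift_fock \<omega> (mdiff shift_fock \<omega> (step_seq Y))) = 1"
      by (simp add: fock.mip_mdiff omf yf one cl_inf_diff)
    then have "1 \<le> norm (mip shift_fock \<omega> (mdiff shift_fock \<omega> (step_seq Y)))"
      using cmod_cl_inf_le[of "mip shift_fock \<omega> (mdiff shift_fock \<omega> (step_seq Y))"] by simp
    also have "\<dots> \<le> mnorm shift_fock \<omega> * mnorm shift_fock (mdiff shift_fock \<omega> (step_seq Y))"
      by (rule fock.Cauchy_Schwarz) (simp_all add: omf yf fock.mdiff_closed)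
    also have "mnorm shift_fock \<omega> = 1" by (simp add: mnorm_def one)
    finally show False using d by simp
  qed

  moreover have "cl_inf (w 1) = t * cl_inf (w 0)"
  proof -
    \<comment> \<open>A bound for the linear form that sends \<omega> to w_1 - t w_0 at infinity.
      The form vanishes on approximants, so its value at \<omega> is at most \<open>C\<close> times
      the distance to them.\<close>
    define C where "C = mnorm (shift_sector 1) (unit_vec t 1) + t * mnorm (shift_sector 0) (unit_vec t 0)"
    have C: "C \<ge> 0" using t0 by (simp add: C_def mnorm_def)
    have le: "cmod (cl_inf (w 1) - t * cl_inf (w 0)) \<le> C * e" if e: "e > 0" for e
    proof -
      obtain Y c where Y: "asymp_const t Y c" and d: "mnorm shift_fock (mdiff shift_fock \<omega> (step_seq Y)) < e"
        using near[OF e] by auto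
      note yf = asymp_const_fock[OF Y t0]
      let ?D = "mdiff shift_fock \<omega> (step_seq Y)"
      have df: "?D \<in> mcar shift_fock" by (rule fock.mdiff_closed[OF omf yf])
      define r where "r n = cl_inf (mip (shift_sector n) (unit_vec t n) (?D n))" for n
      have Dn: "?D n = mdiff (shift_sector n) (\<omega> n) (step_seq Y n)" for n
        by (simp add: mdiff_def mscale_def fock_ops)
      have wr: "cl_inf (w n) = c * measure (leb_cube n) (time_simplex n t) + r n" for n
        using cl_inf_step_ip_unit_vec[OF Y t0, of n]
        by (simp add: cl_inf_diff r_def w_def Dn sector.mip_mdiff fock_component xf omf yf)
      have rn: "cmod (r n) \<le> mnorm (shift_sector n) (unit_vec t n) * e" for n
      proof -
        have "cmod (r n) \<le> norm (mip (shift_sector n) (unit_vec t n) (?D n))" unfolding r_def by (rule cmod_cl_inf_le)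
        also have "\<dots> \<le> mnorm (shift_sector n) (unit_vec t n) * mnorm (shift_sector n) (?D n)"
          by (rule sector.Cauchy_Schwarz[OF fock_component[OF xf] fock_component[OF df]])
        also have "\<dots> \<le> mnorm (shift_sector n) (unit_vec t n) * e"
          using order_trans[OF mnorm_component_le[OF df, of n] less_imp_le[OF d]]
          by (intro mult_left_mono) (simp_all add: mnorm_def)
        finally show ?thesis .
      qed
      \<comment> \<open>The contributions c t and t c of the approximant cancel; only the error
        terms remain.\<close>
      have "cl_inf (w 1) - t * cl_inf (w 0) = r 1 - t * r 0"
        using measure_time_simplex_1[OF t0] measure_time_simplex_0[of t] by (simp only: wr One_nat_def) (simp add: algebra_simps)
      also have "cmod \<dots> \<le> cmod (r 1) + t * cmod (r 0)"
        using norm_triangle_ineq4[of "r 1" "t * r 0"] t0 by (simp add: norm_mult)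
      also have "\<dots> \<le> mnorm (shift_sector 1) (unit_vec t 1) * e + t * (mnorm (shift_sector 0) (unit_vec t 0) * e)"
        by (intro add_mono rn mult_left_mono t0)
      finally show ?thesis by (simp add: C_def algebra_simps)
    qed
    have "cmod (cl_inf (w 1) - t * cl_inf (w 0)) \<le> 0"
    proof (rule field_le_epsilon)
      fix e :: real assume e: "e > 0"
      then have "cmod (cl_inf (w 1) - t * cl_inf (w 0)) \<le> C * (e / (C + 1))"
        using C by (intro le) (simp add: add_nonneg_pos)
      then show "cmod (cl_inf (w 1) - t * cl_inf (w 0)) \<le> 0 + e"
        using mult_frac_less[OF C e] by simp
    qed
    then show ?thesis by simp
  qed

  moreover have w0: "w m = 0" if m: "m \<ge> 1" for m
  proof (rule cl_eqI)
    fix s :: real assume s: "s \<ge> 0"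
    obtain a where a: "\<And>u. u \<ge> 0 \<Longrightarrow> cl_app a u = complex_of_real (max 0 (1 - 2 * \<bar>u - (s + real m)\<bar>))"
      using ex_climfun_bump[of "s + real m"] s by auto
    have "(\<lambda>n. mip (shift_sector n) (step_seq (unit_fun a t) n) (\<omega> n)) sums mip shift_fock (step_seq (unit_fun a t)) \<omega>"
      unfolding fock_ops by (rule summable_sums[OF fock_summable[OF xf omf]])
    moreover have "mip (shift_sector n) (step_seq (unit_fun a t) n) (\<omega> n) = adj (cl_shift (real n) a) * w n" for n
      unfolding w_def by (rule mip_unit_fun_component[OF oc])
    ultimately have "(\<lambda>n. adj (cl_shift (real n) a) * w n) sums (suminf w * adj a)"
      by (simp only: central[of a] mw)
    from bounded_linear.sums[OF bounded_linear_cl_app[of s] this]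
    have "(\<lambda>n. cl_app (adj (cl_shift (real n) a) * w n) s) sums cl_app (suminf w * adj a) s" .
    \<comment> \<open>The tent is centred at s + m, so \<open>m \<ge> 1\<close> makes it vanish at
      s. For m = 0 this side would not vanish, and w_0 indeed survives.\<close>
    moreover have "cl_app (suminf w * adj a) s = 0"
      using a[OF s] m by (simp add: cl_rep)
    moreover have "cl_app (adj (cl_shift (real n) a) * w n) s = (if n = m then cl_app (w m) s else 0)" for n
    proof (cases "n = m")
      case False
      then have "n + 1 \<le> m \<or> m + 1 \<le> n" by linarith
      then have "real (n + 1) \<le> real m \<or> real (m + 1) \<le> real n" by (simp only: of_nat_le_iff)
      then have "\<bar>real n - real m\<bar> \<ge> 1" by auto
      then show ?thesis using False a[of "s + real n"] s by (simp add: cl_rep cl_app_shift)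
    qed (use a[of "s + real m"] s in \<open>simp add: cl_rep cl_app_shift\<close>)
    ultimately have "(\<lambda>n. if n = m then cl_app (w m) s else 0) sums 0" by simp
    then have "cl_app (w m) s = 0" using sums_single[of m "\<lambda>_. cl_app (w m) s"] sums_unique2 by metis
    then show "cl_app (w m) s = cl_app 0 s" by (simp add: cl_rep)
  qed
  \<comment> \<open>Now w_0 is nonzero at infinity, although t w_0 = w_1 = 0 there.\<close>
  have "suminf w = w 0"
    using suminf_finite[of "{0}" w] w0 by force
  ultimately show False using w0[of 1] t by simp
qed

lemma mip_left_action:
  assumes x: "x \<in> mcar shift_fock" and t: "t \<ge> 0"
  shows "mip shift_fock (unit_vec t) (mlact shift_fock (adj a) x) = mip shift_fock (step_seq (unit_fun a t)) x"
proof -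
  have "mip (shift_sector n) (unit_vec t n) (mlact (shift_sector n) (adj a) (x n)) = mip (shift_sector n) (step_seq (unit_fun a t) n) (x n)" for n
  proof -
    have "mlact (shift_sector n) (adj a) (x n) \<in> mcar (shift_sector n)"
      using fock_component[OF fock_mlact(1)[OF x], of "adj a" n] by (simp add: fock_ops)
    moreover have "(\<lambda>p. shift_tp n (cl_shift (real n) a * unit_fun 1 t n p)) = (\<lambda>p. shift_tp n (unit_fun a t n p))"
      by (auto simp: unit_fun_def cl_shift_one)
    ultimately show ?thesis
      by (simp add: step_seq_def sh.mip_stp_left step_fun_unit_fun fock_component[OF x] sh.mlact_sector_apply adj_adj)
  qed
  then show ?thesis by (simp add: fock_ops)
qed

lemma no_weakly_central_unit_vector:
  assumes t: "t > 0" and om: "\<omega> \<in> mcar (ps_mem unit_subsystem t)" and one: "mip shift_fock \<omega> \<omega> = 1"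
    and central: "\<And>a. mip shift_fock (unit_vec t) (mlact shift_fock a \<omega>) = mip shift_fock (unit_vec t) (mract shift_fock \<omega> a)"
  shows False
proof (rule no_vacuum_like_vector[OF t om one])
  have omf: "\<omega> \<in> mcar shift_fock" by (rule unit_subsystem_subset_fock[OF t om])
  have xf: "unit_vec t \<in> mcar shift_fock" using asymp_const_fock[OF asymp_const_unit_vec[of t]] t by simp
  show "mip shift_fock (step_seq (unit_fun a t)) \<omega> = mip shift_fock (unit_vec t) \<omega> * adj a" for a
    using mip_left_action[OF omf, of t a] central[of "adj a"] t
    by (simp add: fock.mip_mract[OF xf omf])
qed

section \<open>The vacuum of a time ordered system over an arbitrary correspondence\<close>

text \<open>Words of length 0 reduce to the empty word, so this tensor power is the algebra with its
  own left action, whatever the correspondence. The calculus of step functions thus applies to the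
  sector in which the vacuum lives.\<close>

lemma scalar_power_zero: "scalar_power G 0 (\<lambda>f. Poly_Mapping.lookup f []) (\<lambda>a. a)"
proof -
  have car: "mcar (tensor_pre G 0) = {f. Poly_Mapping.keys f \<subseteq> {[]}}"
    by (auto simp: tensor_pre_def)
  have eq: "\<exists>c. f = Poly_Mapping.single [] c" if "f \<in> mcar (tensor_pre G 0)" for f
    using that unfolding car
    by (intro exI[of _ "Poly_Mapping.lookup f []"] poly_mapping_eqI)
      (auto simp: lookup_single when_def in_keys_iff)
  show ?thesis
  proof
    fix x y a
    assume "x \<in> mcar (tensor_pre G 0)"
    then obtain c where x: "x = Poly_Mapping.single [] c" using eq by blast
    have lact: "mlact (tensor_pre G 0) a x = Poly_Mapping.single [] (a * c)"
      by (simp add: tensor_pre_def x lookup_single)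
    have ract: "mract (tensor_pre G 0) x a = Poly_Mapping.single [] (c * a)"
      by (simp add: tensor_pre_def x map_single)
    show "mract (tensor_pre G 0) x a \<in> mcar (tensor_pre G 0)" by (simp add: ract car)
    show "mlact (tensor_pre G 0) a x \<in> mcar (tensor_pre G 0)" by (simp add: lact car)
    show "Poly_Mapping.lookup (mract (tensor_pre G 0) x a) [] = Poly_Mapping.lookup x [] * a"
      by (simp only: ract) (simp add: x)
    show "Poly_Mapping.lookup (mlact (tensor_pre G 0) a x) [] = a * Poly_Mapping.lookup x []"
      by (simp only: lact) (simp add: x)
    assume "y \<in> mcar (tensor_pre G 0)"
    then obtain d where y: "y = Poly_Mapping.single [] d" using eq by blast
    have add: "madd (tensor_pre G 0) x y = Poly_Mapping.single [] (c + d)"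
      by (simp add: tensor_pre_def x y single_add)
    show "madd (tensor_pre G 0) x y \<in> mcar (tensor_pre G 0)" by (simp add: add car)
    show "Poly_Mapping.lookup (madd (tensor_pre G 0) x y) [] = Poly_Mapping.lookup x [] + Poly_Mapping.lookup y []"
      by (simp only: add) (simp add: x y lookup_single)
    show "mip (tensor_pre G 0) x y = adj (Poly_Mapping.lookup x []) * Poly_Mapping.lookup y []"
      by (simp add: tensor_pre_def x y lookup_single)
  next
    show "\<exists>x\<in>mcar (tensor_pre G 0). Poly_Mapping.lookup x [] = 1"
      by (rule bexI[of _ "Poly_Mapping.single [] 1"]) (simp_all add: car lookup_single)
  qed simp
qed

text \<open>An inner product with \<open>0\<close> in a completion is determined by a single representing
  sequence, so positivity of the tensor powers of an arbitrary \<open>G\<close> is not needed.\<close>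

lemma tensor_power_zero:
  fixes G :: "(climfun, 'g) corr"
  shows "represents (tensor_pre G n) (\<lambda>_. 0) (\<lambda>_. 0)"
    and "\<phi> \<in> mcar (tensor_power G n) \<Longrightarrow> mip (tensor_power G n) \<phi> (\<lambda>_. 0) = 0"
proof -
  have "Poly_Mapping.map h (0 :: 'g list \<Rightarrow>\<^sub>0 climfun) = 0" for h :: "climfun \<Rightarrow> climfun"
    by (simp add: map_eq_zero_iff)
  then have d: "mdiff (tensor_pre G n) 0 0 = 0"
    by (simp add: mdiff_def mscale_def tensor_pre_def)
  show "represents (tensor_pre G n) (\<lambda>_. 0) (\<lambda>_. 0)"
    unfolding represents_def mcauchy_def d by (simp add: mnorm_def) (simp add: tensor_pre_def)
  show "mip (tensor_power G n) \<phi> (\<lambda>_. 0) = 0" if "\<phi> \<in> mcar (tensor_power G n)"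
    using that by (auto simp: tensor_power_def completion_def LIMSEQ_const_iff)
qed

text \<open>The constant sequence of zero step functions represents the zero functional. This
  handles the components of the vacuum with at least one particle.\<close>

lemma sector_zero:
  fixes G :: "(climfun, 'g) corr"
  shows "(\<lambda>_. 0) \<in> mcar (sector G n)"
    and "mip (sector G n) (\<lambda>_. 0) (\<lambda>_. 0) = 0"
proof -
  let ?V = "tensor_power G n" and ?P = "step_pre G n" and ?z = "\<lambda>_::nat \<Rightarrow> real. \<lambda>_::'g list \<Rightarrow>\<^sub>0 climfun. 0 :: climfun"
  have V0: "mzero ?V = (\<lambda>_. 0)" "(\<lambda>_. 0) \<in> mcar ?V"
    using tensor_power_zero(1)[of G n] by (auto simp: tensor_power_def completion_def)
  have z: "?z \<in> mcar ?P"
    by (auto simp: step_pre_def Let_def V0 image_constant_conv intro: exI[of _ 0])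
  have d: "mdiff ?P ?z ?z = ?z"
    by (simp add: mdiff_def mscale_def step_pre_def Let_def) (simp add: tensor_power_def completion_def)
  have ip: "mip ?P y ?z = 0" if "y \<in> mcar ?P" for y
  proof -
    have "y p \<in> mcar ?V" for p using that by (auto simp: step_pre_def Let_def)
    then show ?thesis
      by (simp add: step_pre_def Let_def tensor_power_zero(2)
          Bochner_Integration.simple_bochner_integral_def image_constant_conv)
  qed
  have rep: "represents ?P (\<lambda>_. ?z) (\<lambda>_. 0)"
    unfolding represents_def mcauchy_def d by (simp add: mnorm_def z ip)
  then show c: "(\<lambda>_. 0) \<in> mcar (sector G n)" by (auto simp: sector_def completion_def)
  show "mip (sector G n) (\<lambda>_. 0) (\<lambda>_. 0) = 0"
    using rep by (auto simp: sector_def completion_def LIMSEQ_const_iff)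
qed

text \<open>The vacuum is the unit of the algebra, sitting in the sector where both actions are
  multiplication. Its norm is the mass 1 of the one-point simplex, and having no particles it meets
  the support condition at every time.\<close>

lemma central_vacuum:
  fixes G :: "(climfun, 'g) corr"
  assumes t: "t \<ge> 0"
  shows "central_unit_vector (ps_mem (time_ordered_system G) t) (ps_emb (time_ordered_system G) 1)"
proof -
  interpret z: scalar_power G 0 "\<lambda>f. Poly_Mapping.lookup f []" "\<lambda>a. a" by (rule scalar_power_zero)
  let ?D = "ord_simplex 0" and ?g = "\<lambda>p. if p \<in> ord_simplex 0 then 1 else 0 :: climfun"
  let ?O = "ps_emb (time_ordered_system G) 1"
  have D: "?D = time_simplex 0 0" by (simp add: time_simplex_def)
  have g: "step_fun 0 ?g" unfolding D by (rule step_fun_const[OF time_simplex_sets time_simplex_box])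
  have "const_on G 0 ?D [] 1 = z.stp (\<lambda>p. if p \<in> ?D then Poly_Mapping.lookup (Poly_Mapping.single [] 1) ([] :: 'g list) else 0)"
    by (rule z.const_on_stp) (auto simp: tensor_pre_def)
  also have "\<dots> = z.stp ?g" by (rule z.stp_eqI) (simp add: lookup_single)
  finally have O0: "?O 0 = z.stp ?g" by (simp add: time_ordered_system_def)
  have On: "?O n = (\<lambda>_. 0)" if "n \<ge> 1" for n
    using that by (simp add: time_ordered_system_def sector_def completion_def)
  have shift_sector: "?O n \<in> mcar (sector G n)" for n
    using sector_zero(1)[of G n] On[of n] z.stp_mem[OF g] O0 by (cases "n = 0") auto
  have ip0: "mip (sector G 0) (?O 0) (?O 0) = 1"
  proof (rule cl_eqI)
    fix s :: real assume s: "s \<ge> 0"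
    have "cl_app (step_ip 0 ?g ?g) s = (\<integral>p. cl_app (adj (?g p) * ?g p) s \<partial>leb_cube 0)"
      by (rule step_ip_linear(1)[OF bounded_linear_cl_app g g])
    also have "\<dots> = (\<integral>p. complex_of_real (indicator (time_simplex 0 0) p) \<partial>leb_cube 0)"
      by (rule Bochner_Integration.integral_cong) (simp_all add: D cl_rep s)
    also have "\<dots> = complex_of_real (measure (leb_cube 0) (time_simplex 0 0))"
      using sets.sets_into_space[OF time_simplex_sets[of 0 0]] by (simp add: Int_absorb2 del: of_real_indicator)
    finally show "cl_app (mip (sector G 0) (?O 0) (?O 0)) s = cl_app 1 s"
      using measure_time_simplex_0[of 0] s by (simp only: O0 z.mip_stp[OF g g]) simp
  qed
  have ipn: "mip (sector G n) (?O n) (?O n) = 0" if "n \<notin> {0}" for n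
    using that On[of n] sector_zero(2)[of G n] by simp
  have fock: "?O \<in> mcar (fock G)"
    using shift_sector summable_finite[of "{0}" "\<lambda>n. mip (sector G n) (?O n) (?O n)"] ipn by (simp add: fock_def)
  have mi: "mult_ind G n (ord_simplex n) (?O n) = ?O n" for n
  proof (cases "n = 0")
    case True
    have "mult_ind G 0 ?D (z.stp ?g) = z.stp (\<lambda>p. if p \<in> ?D then ?g p else 0)"
      by (rule z.mult_ind_stp[OF g]) (use ord_simplex_sets[of 0] in auto)
    also have "\<dots> = z.stp ?g" by (rule z.stp_eqI) simp
    finally show ?thesis using True O0 by simp
  qed (use On in \<open>simp add: mult_ind_def fun_eq_iff\<close>)
  have "?O \<in> (\<lambda>x n. mult_ind G n (ord_simplex n) (x n)) ` mcar (fock G)"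
    by (rule image_eqI[OF _ fock]) (simp add: mi)
  moreover have "mult_ind G n {p. t \<le> p n} (?O n) = mzero (sector G n)" if "n \<ge> 1" for n
    using On[OF that] by (simp add: mult_ind_def fun_eq_iff sector_def completion_def)
  ultimately have mem: "?O \<in> mcar (ps_mem (time_ordered_system G) t)"
    by (simp add: time_ordered_system_def time_ordered_fock_def)
  have "mip (ps_mem (time_ordered_system G) t) ?O ?O = suminf (\<lambda>n. mip (sector G n) (?O n) (?O n))"
    by (simp add: time_ordered_system_def time_ordered_fock_def fock_def)
  also have "\<dots> = 1"
    using suminf_finite[of "{0}" "\<lambda>n. mip (sector G n) (?O n) (?O n)"] ipn ip0 by simp
  finally have unit: "mip (ps_mem (time_ordered_system G) t) ?O ?O = 1" .
  have "mlact (sector G n) a (?O n) = mract (sector G n) (?O n) a" for n a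
  proof (cases "n = 0")
    case True
    have "mlact (sector G 0) a (?O 0) = mract (sector G 0) (?O 0) a"
      unfolding O0 z.mlact_stp[OF g] z.mract_stp[OF g] by (rule z.stp_eqI) (simp add: mult.commute)
    then show ?thesis using True by simp
  qed (use On in \<open>simp add: sector_def completion_def fun_eq_iff\<close>)
  then have "mlact (ps_mem (time_ordered_system G) t) a ?O = mract (ps_mem (time_ordered_system G) t) ?O a" for a
    by (simp add: time_ordered_system_def time_ordered_fock_def fock_def)
  with mem unit show ?thesis by (simp add: central_unit_vector_def)
qed

theorem theorem3p1:
  shows "let E = generated_subsystem (time_ordered_system shift_corr)
        (time_ordered_unit shift_corr 1)
    in (\<forall>t>0. \<not> (\<exists>\<omega>. central_unit_vector (ps_mem E t) \<omega>)) \<and>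
       (\<forall>G :: (climfun, 'g) corr. correspondence G \<longrightarrow>
          \<not> ps_isomorphic E (time_ordered_system G))"
  unfolding Let_def
proof (intro conjI allI impI notI)
  fix t :: real
  assume t: "t > 0" and "\<exists>\<omega>. central_unit_vector (ps_mem unit_subsystem t) \<omega>"
  then obtain \<omega> where "central_unit_vector (ps_mem unit_subsystem t) \<omega>" by blast
  then show False
    using no_weakly_central_unit_vector[OF t, of \<omega>] by (simp add: central_unit_vector_def unit_subsystem_ops)
next
  fix G :: "(climfun, 'g) corr"
  assume "ps_isomorphic unit_subsystem (time_ordered_system G)"
  \<comment> \<open>Any positive time would serve; 1 is taken.\<close>
  then obtain v where v: "bilinear_unitary (ps_mem unit_subsystem 1) (ps_mem (time_ordered_system G) 1) v"
    unfolding ps_isomorphic_def by (metis zero_le_one)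
  let ?N = "ps_mem (time_ordered_system G) 1" and ?M = "ps_mem unit_subsystem 1"
  obtain \<Omega> where \<Omega>: "central_unit_vector ?N \<Omega>" using central_vacuum[of 1 G] by auto
  then have "\<Omega> \<in> v ` mcar ?M" using v by (simp add: bilinear_unitary_def central_unit_vector_def)
  then obtain \<omega> where om: "\<omega> \<in> mcar ?M" and vom: "v \<omega> = \<Omega>" by blast
  have ip: "mip ?N (v x) (v y) = mip shift_fock x y" if "x \<in> mcar ?M" "y \<in> mcar ?M" for x y
    using v that by (simp add: bilinear_unitary_def unit_subsystem_ops)
  have "v (mlact shift_fock a \<omega>) = v (mract shift_fock \<omega> a)" for a
    using v om \<Omega> vom by (simp add: bilinear_unitary_def unit_subsystem_ops central_unit_vector_def)
  \<comment> \<open>Pair both images with the image of the unit. To pull the inner products back,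
    the unit and both products of \<omega> must lie in the subsystem, which is why its closure under
    the two actions was established.\<close>
  then have "mip shift_fock (unit_vec 1) (mlact shift_fock a \<omega>) = mip shift_fock (unit_vec 1) (mract shift_fock \<omega> a)" for a
    using ip[OF unit_in_unit_subsystem unit_subsystem_mlact[OF _ om, of a]] ip[OF unit_in_unit_subsystem unit_subsystem_mract[OF _ om, of a]] by simp
  moreover have "mip shift_fock \<omega> \<omega> = 1"
    using ip[OF om om] \<Omega> vom by (simp add: central_unit_vector_def)
  ultimately show False
    using no_weakly_central_unit_vector[OF _ om] by simp
qed

end
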